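(* Let $1<p<\infty$ and let $|1/2-1/p|\le\alpha<1$. Then there is an almost greedy basis $\mathcal{Y}_\alpha$ of $\ell_p$ with \[ \boldsymbol{k}_m[\mathcal{Y}_\alpha,\ell_p]\approx(\log m)^\alpha,\qquad m\ge 2. \]
   Context: Spaces are over the real or complex field. For a Schauder basis $\mathcal{X}=(\boldsymbol{x}_n)_{n=1}^\infty$ of a Banach space $\mathbb{X}$ with coordinate functionals $(\boldsymbol{x}_n^* )_{n=1}^\infty$ and a finite set $A\subseteq\mathbb{N}$, let $S_A(f)=\sum_{n\in A}\boldsymbol{x}_n^*(f)\,\boldsymbol{x}_n$. The conditionality constants are $\boldsymbol{k}_m[\mathcal{X},\mathbb{X}]=\sup_{|A|\le m}\|S_A\|$, $m\in\mathbb{N}$. A greedy set of $f\in\mathbb{X}$ is a finite set $G\subseteq\mathbb{N}$ with $|\boldsymbol{x}_n^*(f)|\ge|\boldsymbol{x}_k^*(f)|$ for all $n\in G$ and $k\notin G$. A semi-normalized Schauder basis $\mathcal{X}$ (semi-normalized: $0<\inf_n\|\boldsymbol{x}_n\|\le\sup_n\|\boldsymbol{x}_n\|<\infty$) is almost greedy if there is a constant $C$ such that $\|f-S_G(f)\|\le C\|f-S_A(f)\|$ for all $f\in\mathbb{X}$, all greedy sets $G$ of $f$ and all $A\subseteq\mathbb{N}$ with $|A|\le|G|$. The notation $a_m\approx b_m$ for $m\ge2$ means that there are constants $0<c\le C<\infty$ with $c\,b_m\le a_m\le C\,b_m$ for all $m\ge 2$. *)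

theory Defs
  imports "HOL-Analysis.Analysis" "HOL-Library.Function_Algebras"
begin

text \<open>
  The exponent of \<open>\<ell>\<^sub>p\<close> is a term, so the space cannot be a type of class \<open>banach\<close>. A Banach space
  over \<open>'k\<close> is instead given by its scalar multiplication, its carrier \<open>V\<close> and its norm \<open>nrm\<close>.
  Basis vectors are indexed from \<open>0\<close>.
\<close>

context
  fixes scale :: "'k::real_normed_field \<Rightarrow> 'v::ab_group_add \<Rightarrow> 'v"
    and V :: "'v set"
    and nrm :: "'v \<Rightarrow> real"
begin

definition expands :: "(nat \<Rightarrow> 'v) \<Rightarrow> 'v \<Rightarrow> (nat \<Rightarrow> 'k) \<Rightarrow> bool" where
  "expands x f a \<longleftrightarrow> (\<lambda>N. nrm (f - (\<Sum>n<N. scale (a n) (x n)))) \<longlonglongrightarrow> 0"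

definition schauder_basis :: "(nat \<Rightarrow> 'v) \<Rightarrow> bool" where
  "schauder_basis x \<longleftrightarrow> (\<forall>n. x n \<in> V) \<and> (\<forall>f\<in>V. \<exists>!a. expands x f a)"

text \<open>
  \<open>coord x f n\<close> is the value of the \<open>n\<close>-th coordinate functional at \<open>f\<close>; it is meaningful when \<open>x\<close>
  is a Schauder basis and \<open>f \<in> V\<close>.
\<close>

definition coord :: "(nat \<Rightarrow> 'v) \<Rightarrow> 'v \<Rightarrow> nat \<Rightarrow> 'k" where
  "coord x f = (THE a. expands x f a)"

definition coord_proj :: "(nat \<Rightarrow> 'v) \<Rightarrow> nat set \<Rightarrow> 'v \<Rightarrow> 'v" where
  "coord_proj x A f = (\<Sum>n\<in>A. scale (coord x f n) (x n))"

text \<open>Suprema are taken in \<^typ>\<open>ennreal\<close>, so that they are meaningful without boundedness proofs.\<close>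

definition op_norm :: "('v \<Rightarrow> 'v) \<Rightarrow> ennreal" where
  "op_norm T = (SUP f\<in>{f\<in>V. nrm f \<le> 1}. ennreal (nrm (T f)))"

definition conditionality_const :: "(nat \<Rightarrow> 'v) \<Rightarrow> nat \<Rightarrow> ennreal" where
  "conditionality_const x m = (SUP A\<in>{A. finite A \<and> card A \<le> m}. op_norm (coord_proj x A))"

definition greedy_set :: "(nat \<Rightarrow> 'v) \<Rightarrow> 'v \<Rightarrow> nat set \<Rightarrow> bool" where
  "greedy_set x f G \<longleftrightarrow>
     finite G \<and> (\<forall>n\<in>G. \<forall>k. k \<notin> G \<longrightarrow> norm (coord x f n) \<ge> norm (coord x f k))"

definition semi_normalized :: "(nat \<Rightarrow> 'v) \<Rightarrow> bool" where
  "semi_normalized x \<longleftrightarrow> (\<exists>c>0. \<forall>n. c \<le> nrm (x n)) \<and> (\<exists>C. \<forall>n. nrm (x n) \<le> C)"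

definition almost_greedy_basis :: "(nat \<Rightarrow> 'v) \<Rightarrow> bool" where
  "almost_greedy_basis x \<longleftrightarrow>
     schauder_basis x \<and> semi_normalized x \<and>
     (\<exists>C. \<forall>f\<in>V. \<forall>G A. greedy_set x f G \<and> finite A \<and> card A \<le> card G \<longrightarrow>
        nrm (f - coord_proj x G f) \<le> C * nrm (f - coord_proj x A f))"

end

definition seq_scale :: "'k::real_normed_field \<Rightarrow> (nat \<Rightarrow> 'k) \<Rightarrow> (nat \<Rightarrow> 'k)" where
  "seq_scale c f = (\<lambda>n. c * f n)"

definition lp :: "real \<Rightarrow> (nat \<Rightarrow> 'k::real_normed_field) set" where
  "lp p = {f. summable (\<lambda>n. norm (f n) powr p)}"

definition lp_norm :: "real \<Rightarrow> (nat \<Rightarrow> 'k::real_normed_field) \<Rightarrow> real" where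
  "lp_norm p f = (\<Sum>n. norm (f n) powr p) powr (1 / p)"

end

(*
  For b between -1/p and 1 - 1/p let x_n be the n-fold right shift of the Taylor coefficients of
  (1 - z)^(-b). The coordinates in this system are convolution with the coefficients of (1 - z)^b, and
  the matrix of a partial sum projection minus the corresponding truncation has the Hilbert-type kernel
  (s/r)^b / (r + s), which Schur's test bounds on l_p. On the first N coordinates, synthesis costs
  N^max(b,0) and analysis costs N^max(-b,0).

  Let (x_n) belong to b = -alpha/p and (x'_n) to b' = alpha (1 - 1/p). The vectors (x_n, x'_n) and
  (x_n, -x'_n) form a basis of l_p + l_p = l_p. Projecting onto the first kind transports the coefficients
  of a vector from (x_n) to (x'_n), that is, it applies (1 - z)^(-alpha); this has norm of order N^alpha on
  the first N coordinates, and N^alpha is also the product of the synthesis and analysis costs.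

  The Dilworth-Kalton-Kutzarova method turns this basis (z_n) into an almost greedy one. Split the
  indices into blocks of length 2^n, and replace the normalised indicator of the n-th block by z_n
  while keeping the part of the space with zero block averages. A coefficient of size at least t comes
  from the zero-average part unless it lies in one of the low blocks, which together hold only
  O((norm f / t)^p) indices; there the partial sum projections and a geometric series suffice. Since m
  coordinates interact with only about log m blocks, the conditionality constants become (log m)^alpha.
*)

theory Submission
  imports Defs "HOL-Computational_Algebra.Formal_Power_Series" "HOL-Library.Discrete_Functions"
begin

section \<open>The sequence spaces\<close>

text \<open>Why two bases: for a single exponent b the product of the synthesis and analysis costs
  is N^|b|, and boundedness of the partial sums confines b to (-1/p, 1 - 1/p). Differences of two
  exponents from this interval of length 1 take every value below 1, and dividing \<alpha> in the
  proportion 1/p to 1 - 1/p keeps both exponents inside for every \<alpha> < 1. One exponent is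
  nonpositive and the other nonnegative, so analysis is expensive only for the first and synthesis
  only for the second; the product N^\<alpha> of the two costs is also the size of the mixed
  operator, so the upper and lower estimates meet. Why the blocks restore greediness although (z_n)
  is conditional: a coefficient of (z_n) is bounded by a multiple of the norm, and spreading it over
  2^n coordinates with weight 2^(-n/p) makes its share in each coordinate decay geometrically in n.
  Hence only bounded coefficients and bounded partial sums of (z_n) enter the almost greedy
  estimate, and the power costs enter the conditionality constants alone.\<close>

lemma lpI:
  fixes f :: "nat \<Rightarrow> 'k::real_normed_field"
  assumes p: "0 < p" and M: "0 \<le> M" and b: "\<And>N. (\<Sum>j<N. norm (f j) powr p) \<le> M powr p"
  shows "f \<in> lp p" and "lp_norm p f \<le> M"
proof -
  have s: "summable (\<lambda>j. norm (f j) powr p)"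
    by (rule bounded_imp_summable[where B = "M powr p"]) (use b in \<open>auto simp flip: lessThan_Suc_atMost simp del: sum.lessThan_Suc\<close>)
  then show "f \<in> lp p" by (simp add: lp_def)
  have "(\<Sum>j. norm (f j) powr p) \<le> M powr p" by (rule suminf_le_const[OF s b])
  then have "(\<Sum>j. norm (f j) powr p) powr (1/p) \<le> (M powr p) powr (1/p)"
    using p by (intro powr_mono2) (auto intro: suminf_nonneg s)
  also have "\<dots> = M" using p M by (simp add: powr_powr)
  finally show "lp_norm p f \<le> M" by (simp add: lp_norm_def)
qed

lemma lp_norm_nonneg [simp]: "0 \<le> lp_norm p f"
  by (simp add: lp_norm_def)

lemma lp_sum_le:
  assumes "0 < p" "f \<in> lp p" "finite F"
  shows "(\<Sum>j\<in>F. norm (f j) powr p) \<le> lp_norm p f powr p"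
proof -
  have s: "summable (\<lambda>j. norm (f j) powr p)" using assms(2) by (simp add: lp_def)
  have "(\<Sum>j\<in>F. norm (f j) powr p) \<le> (\<Sum>j. norm (f j) powr p)"
    by (rule sum_le_suminf[OF s assms(3)]) auto
  also have "\<dots> = lp_norm p f powr p"
    using assms(1) by (simp add: lp_norm_def powr_powr suminf_nonneg s)
  finally show ?thesis .
qed

lemma le_of_powr_le: "0 < p \<Longrightarrow> 0 \<le> y \<Longrightarrow> x powr p \<le> y powr p \<Longrightarrow> x \<le> (y::real)"
  by (rule ccontr) (use powr_less_mono2[of p y x] in auto)

lemma lp_coord_le:
  assumes "0 < p" "f \<in> lp p" shows "norm (f j) \<le> lp_norm p f"
  by (rule le_of_powr_le[OF assms(1)]) (use lp_sum_le[OF assms, of "{j}"] in simp_all)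

text \<open>Shifts, truncations, parity parts and interleavings are all dominated coordinatewise
  along an injective change of index, so this one comparison gives membership and norm bound for
  each of them.\<close>

lemma lp_embed:
  fixes f u :: "nat \<Rightarrow> 'k::real_normed_field"
  assumes p: "0 < p" and u: "u \<in> lp p" and inj: "inj_on h S"
    and on: "\<And>j. j \<in> S \<Longrightarrow> norm (f j) \<le> norm (u (h j))" and off: "\<And>j. j \<notin> S \<Longrightarrow> f j = 0"
  shows "f \<in> lp p" and "lp_norm p f \<le> lp_norm p u"
proof -
  have "(\<Sum>j<N. norm (f j) powr p) \<le> lp_norm p u powr p" for N
  proof -
    have "(\<Sum>j<N. norm (f j) powr p) = (\<Sum>j\<in>{..<N} \<inter> S. norm (f j) powr p)"
      by (rule sum.mono_neutral_right) (auto simp: off)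
    also have "\<dots> \<le> (\<Sum>j\<in>{..<N} \<inter> S. norm (u (h j)) powr p)"
      using p by (intro sum_mono powr_mono2 on) auto
    also have "\<dots> = (\<Sum>i\<in>h ` ({..<N} \<inter> S). norm (u i) powr p)"
      by (rule sum.reindex_cong[symmetric]) (use inj in \<open>auto intro: inj_on_subset\<close>)
    also have "\<dots> \<le> lp_norm p u powr p" by (rule lp_sum_le[OF p u]) auto
    finally show ?thesis .
  qed
  from lpI[OF p lp_norm_nonneg this] show "f \<in> lp p" "lp_norm p f \<le> lp_norm p u" .
qed

lemma lp_mono:
  fixes f u :: "nat \<Rightarrow> 'k::real_normed_field"
  assumes "0 < p" "u \<in> lp p" "\<And>j. norm (f j) \<le> norm (u j)"
  shows "f \<in> lp p" and "lp_norm p f \<le> lp_norm p u"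
  using lp_embed[OF assms(1,2) inj_on_id, of UNIV f] assms(3) by auto

text \<open>Jensen's inequality for x^p with the weights divided by their sum. In this form it is
  Hoelder's inequality with only \<open>p\<close> in sight; it serves Minkowski's inequality,
  Schur's test and the block averages without a conjugate exponent.\<close>

lemma weighted_power_mean:
  fixes w x :: "'a \<Rightarrow> real"
  assumes S: "finite S" and w: "\<And>i. i \<in> S \<Longrightarrow> 0 \<le> w i" and x: "\<And>i. i \<in> S \<Longrightarrow> 0 \<le> x i"
    and p: "1 \<le> p"
  shows "(\<Sum>i\<in>S. w i * x i) powr p \<le> (\<Sum>i\<in>S. w i) powr (p - 1) * (\<Sum>i\<in>S. w i * x i powr p)"
proof -
  define T where "T = {i\<in>S. 0 < w i \<and> 0 < x i}"
  define W where "W = (\<Sum>i\<in>T. w i)"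
  have T: "finite T" "T \<subseteq> S" using S by (auto simp: T_def)
  have e1: "(\<Sum>i\<in>S. w i * x i) = (\<Sum>i\<in>T. w i * x i)"
    by (rule sum.mono_neutral_right) (use S w x in \<open>auto simp: T_def not_less intro: antisym\<close>)
  show ?thesis
  proof (cases "T = {}")
    case True
    then show ?thesis using e1 w by (simp add: sum_nonneg)
  next
    case False
    have W: "W > 0" unfolding W_def by (rule sum_pos) (use T False in \<open>auto simp: T_def\<close>)
    have "(\<Sum>i\<in>T. (w i / W) *\<^sub>R x i) powr p \<le> (\<Sum>i\<in>T. (w i / W) * (x i powr p))"
      by (rule convex_on_sum[OF T(1) False powr_convex[OF p]])
         (use W in \<open>auto simp: T_def W_def simp flip: sum_divide_distrib\<close>)
    also have "(\<Sum>i\<in>T. (w i / W) *\<^sub>R x i) = (\<Sum>i\<in>T. w i * x i) / W"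
      by (simp add: sum_divide_distrib)
    also have "(\<Sum>i\<in>T. (w i / W) * (x i powr p)) = (\<Sum>i\<in>T. w i * x i powr p) / W"
      by (simp add: sum_divide_distrib)
    finally have "(\<Sum>i\<in>T. w i * x i) powr p \<le> W powr p * ((\<Sum>i\<in>T. w i * x i powr p) / W)"
      using W by (simp add: powr_divide field_simps)
    also have "\<dots> = W powr (p - 1) * (\<Sum>i\<in>T. w i * x i powr p)"
      using W by (simp add: powr_diff)
    also have "\<dots> \<le> (\<Sum>i\<in>S. w i) powr (p - 1) * (\<Sum>i\<in>S. w i * x i powr p)"
      using T w p W S unfolding W_def
      by (intro mult_mono powr_mono2 sum_mono2 sum_nonneg) (auto intro!: sum_nonneg mult_nonneg_nonneg)
    finally show ?thesis by (simp add: e1)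
  qed
qed

text \<open>Write f + g = A (f/A) + B (g/B) and apply the power mean pointwise with weights A and B;
  after summation each normalised part contributes at most 1.\<close>

lemma minkowski_aux:
  fixes f g :: "nat \<Rightarrow> 'k::real_normed_field"
  assumes p: "1 \<le> p" and A: "0 < A" and B: "0 < B"
    and f: "(\<Sum>j\<in>F. norm (f j) powr p) \<le> A powr p" and g: "(\<Sum>j\<in>F. norm (g j) powr p) \<le> B powr p"
  shows "(\<Sum>j\<in>F. norm (f j + g j) powr p) \<le> (A + B) powr p"
proof -
  have pt: "norm (f j + g j) powr p \<le> (A + B) powr (p - 1) * (A * (norm (f j) powr p / A powr p) + B * (norm (g j) powr p / B powr p))" for j
  proof -
    have "norm (f j + g j) powr p \<le> (norm (f j) + norm (g j)) powr p"
      using p by (intro powr_mono2 norm_triangle_ineq) auto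
    also have "norm (f j) + norm (g j) = (\<Sum>i\<in>{True, False}. (if i then A else B) * (if i then norm (f j) / A else norm (g j) / B))"
      using A B by simp
    also have "\<dots> powr p \<le> (\<Sum>i\<in>{True, False}. (if i then A else B)) powr (p - 1) *
       (\<Sum>i\<in>{True, False}. (if i then A else B) * (if i then norm (f j) / A else norm (g j) / B) powr p)"
      by (rule weighted_power_mean) (use A B p in auto)
    finally show ?thesis by (simp add: powr_divide)
  qed
  have "(\<Sum>j\<in>F. norm (f j + g j) powr p) \<le> (\<Sum>j\<in>F. (A + B) powr (p - 1) * (A * (norm (f j) powr p / A powr p) + B * (norm (g j) powr p / B powr p)))"
    by (rule sum_mono) (rule pt)
  also have "\<dots> = (A + B) powr (p - 1) * (A * ((\<Sum>j\<in>F. norm (f j) powr p) / A powr p) + B * ((\<Sum>j\<in>F. norm (g j) powr p) / B powr p))"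
    by (simp flip: sum_distrib_left sum_divide_distrib add: sum.distrib)
  also have "\<dots> \<le> (A + B) powr (p - 1) * (A * 1 + B * 1)"
    using A B f g by (intro mult_left_mono add_mono) (auto simp: divide_le_eq)
  also have "\<dots> = (A + B) powr p" using A B by (simp add: powr_diff)
  finally show ?thesis .
qed

lemma lp_add:
  fixes f g :: "nat \<Rightarrow> 'k::real_normed_field"
  assumes p: "1 \<le> p" and f: "f \<in> lp p" and g: "g \<in> lp p"
  shows "f + g \<in> lp p" and "lp_norm p (f + g) \<le> lp_norm p f + lp_norm p g"
proof -
  \<comment> \<open>The added \<epsilon> keeps both bounds positive when one of the norms is
    zero.\<close>
  have b: "(\<Sum>j<N. norm ((f + g) j) powr p) \<le> (lp_norm p f + lp_norm p g + \<epsilon>) powr p" if "\<epsilon> > 0" for N \<epsilon>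
  proof -
    have "(\<Sum>j<N. norm (f j + g j) powr p) \<le> ((lp_norm p f + \<epsilon>/2) + (lp_norm p g + \<epsilon>/2)) powr p"
    proof (rule minkowski_aux[OF p])
      show "0 < lp_norm p f + \<epsilon>/2" "0 < lp_norm p g + \<epsilon>/2"
        using that lp_norm_nonneg[of p f] lp_norm_nonneg[of p g] by linarith+
      show "(\<Sum>j<N. norm (f j) powr p) \<le> (lp_norm p f + \<epsilon>/2) powr p"
        using that p by (intro order_trans[OF lp_sum_le[OF _ f]] powr_mono2) auto
      show "(\<Sum>j<N. norm (g j) powr p) \<le> (lp_norm p g + \<epsilon>/2) powr p"
        using that p by (intro order_trans[OF lp_sum_le[OF _ g]] powr_mono2) auto
    qed
    then show ?thesis by (simp add: algebra_simps)
  qed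
  have p0: "0 < p" using p by simp
  show "f + g \<in> lp p" by (rule lpI(1)[OF p0 _ b[of 1]]) (auto intro: add_nonneg_nonneg)
  show "lp_norm p (f + g) \<le> lp_norm p f + lp_norm p g"
    by (rule field_le_epsilon, rule lpI(2)[OF p0 _ b]) (auto intro: add_nonneg_nonneg)
qed

lemma lp_norm_scale:
  fixes f :: "nat \<Rightarrow> 'k::real_normed_field"
  assumes p: "0 < p" and f: "f \<in> lp p"
  shows "seq_scale c f \<in> lp p" and "lp_norm p (seq_scale c f) = norm c * lp_norm p f"
proof -
  have s: "summable (\<lambda>j. norm (f j) powr p)" using f by (simp add: lp_def)
  have eq: "(\<lambda>j. norm (seq_scale c f j) powr p) = (\<lambda>j. norm c powr p * norm (f j) powr p)"
    by (simp add: seq_scale_def norm_mult powr_mult)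
  show "seq_scale c f \<in> lp p" using s by (simp add: lp_def eq)
  show "lp_norm p (seq_scale c f) = norm c * lp_norm p f"
    using p s by (simp add: lp_norm_def eq suminf_mult powr_mult powr_powr)
qed

lemma lp_zero [simp]: "(0 :: nat \<Rightarrow> 'k::real_normed_field) \<in> lp p" "lp_norm p (0 :: nat \<Rightarrow> 'k::real_normed_field) = 0"
  by (simp_all add: lp_def lp_norm_def)

lemma lp_uminus:
  fixes f :: "nat \<Rightarrow> 'k::real_normed_field"
  shows "f \<in> lp p \<Longrightarrow> - f \<in> lp p" and "lp_norm p (- f) = lp_norm p f"
  by (simp_all add: lp_def lp_norm_def)

lemma lp_diff:
  fixes f g :: "nat \<Rightarrow> 'k::real_normed_field"
  assumes p: "1 \<le> p" and f: "f \<in> lp p" and g: "g \<in> lp p"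
  shows "f - g \<in> lp p" and "lp_norm p (f - g) \<le> lp_norm p f + lp_norm p g"
  using lp_add[OF p f lp_uminus(1)[OF g]] unfolding lp_uminus(2) by (simp_all only: diff_conv_add_uminus)

lemma lp_sum:
  fixes f :: "'i \<Rightarrow> nat \<Rightarrow> 'k::real_normed_field"
  assumes p: "1 \<le> p" and f: "\<And>i. i \<in> I \<Longrightarrow> f i \<in> lp p"
  shows "(\<Sum>i\<in>I. f i) \<in> lp p" and "lp_norm p (\<Sum>i\<in>I. f i) \<le> (\<Sum>i\<in>I. lp_norm p (f i))"
proof -
  have "(\<Sum>i\<in>I. f i) \<in> lp p \<and> lp_norm p (\<Sum>i\<in>I. f i) \<le> (\<Sum>i\<in>I. lp_norm p (f i))"
    using f
  proof (induction I rule: infinite_finite_induct)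
    case (insert i I)
    then have "f i + sum f I \<in> lp p" "lp_norm p (f i + sum f I) \<le> lp_norm p (f i) + (\<Sum>i\<in>I. lp_norm p (f i))"
      using lp_add[OF p, of "f i" "sum f I"] by (auto simp del: plus_fun_apply)
    then show ?case unfolding sum.insert[OF insert.hyps] by blast
  qed auto
  then show "(\<Sum>i\<in>I. f i) \<in> lp p" "lp_norm p (\<Sum>i\<in>I. f i) \<le> (\<Sum>i\<in>I. lp_norm p (f i))" by auto
qed

lemma sum_fun_app: "(\<Sum>i\<in>I. f i) x = (\<Sum>i\<in>I. f i x)"
  by (induction I rule: infinite_finite_induct) auto

definition restr :: "nat set \<Rightarrow> (nat \<Rightarrow> 'k) \<Rightarrow> nat \<Rightarrow> 'k::zero" where
  "restr A f = (\<lambda>n. if n \<in> A then f n else 0)"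

lemma lp_restr:
  fixes f :: "nat \<Rightarrow> 'k::real_normed_field"
  assumes "0 < p" "f \<in> lp p" 
  shows "restr A f \<in> lp p" "lp_norm p (restr A f) \<le> lp_norm p f"
  using lp_mono[OF assms, of "restr A f"] by (auto simp: restr_def)

lemma lp_norm_finite_support:
  fixes f :: "nat \<Rightarrow> 'k::real_normed_field"
  assumes p: "0 < p" and F: "finite F" and off: "\<And>j. j \<notin> F \<Longrightarrow> f j = 0"
  shows "f \<in> lp p" "lp_norm p f = (\<Sum>j\<in>F. norm (f j) powr p) powr (1/p)"
proof -
  have "(\<lambda>j. norm (f j) powr p) sums (\<Sum>j\<in>F. norm (f j) powr p)"
    by (rule sums_finite[OF F]) (simp add: off)
  then show "f \<in> lp p" "lp_norm p f = (\<Sum>j\<in>F. norm (f j) powr p) powr (1/p)"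
    by (auto simp: lp_def lp_norm_def sums_iff)
qed

lemma lp_norm_unit:
  assumes "0 < p"
  shows "(\<lambda>i. if i = j then c else (0::'k::real_normed_field)) \<in> lp p"
    and "lp_norm p (\<lambda>i. if i = j then c else (0::'k::real_normed_field)) = norm c"
  using lp_norm_finite_support[OF assms, of "{j}" "\<lambda>i. if i = j then c else 0"] assms
  by (auto simp: powr_powr)

lemma lp_tail_tendsto:
  fixes f :: "nat \<Rightarrow> 'k::real_normed_field"
  assumes p: "0 < p" and f: "f \<in> lp p"
  shows "(\<lambda>N. lp_norm p (restr {N..} f)) \<longlonglongrightarrow> 0"
proof -
  let ?g = "\<lambda>j. norm (f j) powr p"
  have s: "summable ?g" using f by (simp add: lp_def)
  have "(\<Sum>j. norm (restr {N..} f j) powr p) = (\<Sum>j. ?g (j + N))" for N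
  proof -
    have "(\<Sum>j. norm (restr {N..} f j) powr p) = (\<Sum>j. norm (restr {N..} f (j + N)) powr p) + (\<Sum>j<N. norm (restr {N..} f j) powr p)"
      using lp_restr(1)[OF p f, of "{N..}"] by (intro suminf_split_initial_segment) (simp add: lp_def)
    then show ?thesis by (simp add: restr_def)
  qed
  then have "(\<lambda>N. lp_norm p (restr {N..} f)) = (\<lambda>N. (\<Sum>j. ?g (j + N)) powr (1/p))"
    by (simp add: lp_norm_def)
  moreover have "(\<lambda>N. (\<Sum>j. ?g (j + N)) powr (1/p)) \<longlonglongrightarrow> 0"
  proof (rule tendsto_zero_powrI[where b = "1/p"])
    show "(\<lambda>N. (\<Sum>j. ?g (j + N))) \<longlonglongrightarrow> 0"
      using suminf_exist_split2[OF s] .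
    show "\<forall>\<^sub>F N in sequentially. 0 \<le> (\<Sum>j. ?g (j + N))"
      using summable_ignore_initial_segment[OF s] by (auto intro!: always_eventually suminf_nonneg)
  qed (use p in auto)
  ultimately show ?thesis by simp
qed

text \<open>Split K x as (K v)(x / v): the power mean with weights K v produces the row sums to the
  power p - 1, and after exchanging the summations the column condition takes over. Putting the
  power p - 1 on the weights in the column condition replaces the usual condition for the dual
  exponent.\<close>

lemma schur_test:
  fixes K :: "nat \<Rightarrow> nat \<Rightarrow> real" and x :: "nat \<Rightarrow> real"
  assumes p: "1 < p" and I: "finite I" and J: "finite J"
    and K: "\<And>i j. i \<in> I \<Longrightarrow> j \<in> J \<Longrightarrow> 0 \<le> K i j"
    and v: "\<And>j. j \<in> J \<Longrightarrow> 0 < v j" and w: "\<And>i. i \<in> I \<Longrightarrow> 0 \<le> w i"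
    and x: "\<And>j. j \<in> J \<Longrightarrow> 0 \<le> x j" and A: "0 \<le> A"
    and row: "\<And>i. i \<in> I \<Longrightarrow> (\<Sum>j\<in>J. K i j * v j) \<le> A * w i"
    and col: "\<And>j. j \<in> J \<Longrightarrow> (\<Sum>i\<in>I. K i j * w i powr (p - 1)) \<le> B * v j powr (p - 1)"
  shows "(\<Sum>i\<in>I. (\<Sum>j\<in>J. K i j * x j) powr p) \<le> A powr (p - 1) * B * (\<Sum>j\<in>J. x j powr p)"
proof -
  have r: "(\<Sum>j\<in>J. K i j * x j) powr p \<le> A powr (p - 1) * (\<Sum>j\<in>J. K i j * w i powr (p - 1) * (x j powr p / v j powr (p - 1)))"
    if i: "i \<in> I" for i
  proof -
    have "(\<Sum>j\<in>J. K i j * x j) = (\<Sum>j\<in>J. (K i j * v j) * (x j / v j))"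
      using v by (intro sum.cong) (auto simp: less_imp_neq[symmetric])
    also have "\<dots> powr p \<le> (\<Sum>j\<in>J. K i j * v j) powr (p - 1) * (\<Sum>j\<in>J. (K i j * v j) * (x j / v j) powr p)"
      by (rule weighted_power_mean) (use J K v x i p in \<open>auto simp: less_imp_le\<close>)
    also have "\<dots> \<le> (A * w i) powr (p - 1) * (\<Sum>j\<in>J. (K i j * v j) * (x j / v j) powr p)"
      using row[OF i] K v i p
      by (intro mult_right_mono powr_mono2) (auto intro!: sum_nonneg mult_nonneg_nonneg simp: less_imp_le)
    also have "(\<Sum>j\<in>J. (K i j * v j) * (x j / v j) powr p) = (\<Sum>j\<in>J. K i j * (x j powr p / v j powr (p - 1)))"
    proof (intro sum.cong refl)
      fix j assume "j \<in> J"
      then have "0 < v j" by (rule v)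
      then show "(K i j * v j) * (x j / v j) powr p = K i j * (x j powr p / v j powr (p - 1))"
        by (simp add: powr_divide powr_diff)
    qed
    finally show ?thesis by (simp add: powr_mult sum_distrib_left mult_ac)
  qed
  have "(\<Sum>i\<in>I. (\<Sum>j\<in>J. K i j * x j) powr p) \<le> (\<Sum>i\<in>I. A powr (p - 1) * (\<Sum>j\<in>J. K i j * w i powr (p - 1) * (x j powr p / v j powr (p - 1))))"
    by (rule sum_mono) (rule r)
  also have "\<dots> = A powr (p - 1) * (\<Sum>j\<in>J. (\<Sum>i\<in>I. K i j * w i powr (p - 1)) * (x j powr p / v j powr (p - 1)))"
    unfolding sum_distrib_left[symmetric] sum_distrib_right
    by (subst sum.swap) simp
  also have "\<dots> \<le> A powr (p - 1) * (\<Sum>j\<in>J. (B * v j powr (p - 1)) * (x j powr p / v j powr (p - 1)))"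
    by (intro mult_left_mono sum_mono mult_right_mono col) auto
  also have "(\<Sum>j\<in>J. (B * v j powr (p - 1)) * (x j powr p / v j powr (p - 1))) = (\<Sum>j\<in>J. B * x j powr p)"
    using v by (intro sum.cong) (auto simp: less_imp_neq[symmetric])
  finally show ?thesis by (simp add: sum_distrib_left mult_ac)
qed

section \<open>Fractional summation\<close>

text \<open>Taylor coefficients of $(1 - z)^{-\beta}$.\<close>

definition bc :: "real \<Rightarrow> nat \<Rightarrow> real" where
  "bc \<beta> k = pochhammer \<beta> k / fact k"

lemma bc_0 [simp]: "bc \<beta> 0 = 1"
  by (simp add: bc_def)

lemma bc_Suc: "bc \<beta> (Suc k) = bc \<beta> k * (\<beta> + real k) / (real k + 1)"
  by (simp add: bc_def pochhammer_Suc field_simps)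

lemma bc_Suc': "bc \<beta> (Suc k) = \<beta> * bc (1 + \<beta>) k / (real k + 1)"
  by (simp add: bc_def pochhammer_rec field_simps)

lemma bc_add: "bc (\<beta> + \<gamma>) n = (\<Sum>k\<le>n. bc \<beta> k * bc \<gamma> (n - k))"
proof -
  have "bc (\<beta> + \<gamma>) n = (\<Sum>k\<le>n. real (n choose k) * pochhammer \<beta> k * pochhammer \<gamma> (n - k)) / fact n"
    by (simp add: bc_def pochhammer_binomial_sum)
  also have "\<dots> = (\<Sum>k\<le>n. bc \<beta> k * bc \<gamma> (n - k))"
    unfolding sum_divide_distrib bc_def
    by (intro sum.cong refl) (simp add: binomial_fact)
  finally show ?thesis .
qed

lemma bc_zero: "bc 0 k = (if k = 0 then 1 else 0)"
  by (cases k) (simp_all add: bc_Suc')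

lemma bc_one [simp]: "bc 1 k = 1"
  by (simp add: bc_def flip: pochhammer_fact)

text \<open>Partial summation is multiplication by 1/(1 - z), whose coefficients are
  \<open>bc 1\<close>.\<close>

lemma sum_bc: "(\<Sum>k\<le>n. bc \<beta> k) = bc (1 + \<beta>) n"
  using bc_add[of \<beta> 1 n] by (simp add: add.commute)

lemma bc_nonneg: "0 \<le> \<beta> \<Longrightarrow> 0 \<le> bc \<beta> k"
  by (induction k) (simp_all add: bc_Suc)

text \<open>Consecutive terms have ratio 1 + \<beta>/(k + 1), at most exp(\<beta>/(k + 1)), so the
  product is controlled by exp(\<beta> H_k). The harmonic number H_k lies between ln(k + 1) and 1 +
  ln(k + 1); the sign of \<beta> decides which side is used, and the factor
  \<open>exp \<bar>\<beta>\<bar>\<close> covers both.\<close>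

lemma bc_upper:
  assumes "-1 \<le> \<beta>"
  shows "bc (1 + \<beta>) k \<le> exp \<bar>\<beta>\<bar> * (real k + 1) powr \<beta>"
proof -
  have "bc (1 + \<beta>) k \<le> exp (\<beta> * harm k)"
  proof (induction k)
    case (Suc k)
    have "bc (1 + \<beta>) (Suc k) = bc (1 + \<beta>) k * (1 + \<beta> / (real k + 1))"
      by (simp add: bc_Suc field_simps)
    also have "\<dots> \<le> exp (\<beta> * harm k) * exp (\<beta> / (real k + 1))"
      using assms bc_nonneg[of "1 + \<beta>" k] 
      by (intro mult_mono Suc exp_ge_add_one_self) (auto simp: field_simps)
    also have "\<dots> = exp (\<beta> * harm (Suc k))"
      by (simp add: harm_Suc field_simps flip: exp_add)
    finally show ?case .
  qed (simp add: harm_def)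
  also have "\<beta> * harm k \<le> \<bar>\<beta>\<bar> + \<beta> * ln (real k + 1)"
  proof (cases "0 \<le> \<beta>")
    case True
    have "harm k \<le> 1 + ln (real k + 1)"
    proof (cases "k = 0")
      case False
      then have "harm k - ln (real k) \<le> 1"
        using euler_mascheroni_sequence_decreasing[of 1 k] by (simp add: harm_def)
      moreover have "ln (real k) \<le> ln (real k + 1)" using False by simp
      ultimately show ?thesis by linarith
    qed (simp add: harm_def)
    then show ?thesis using mult_left_mono[OF _ True, of "harm k" "1 + ln (real k + 1)"] True
      by (simp add: distrib_left)
  next
    case False
    then show ?thesis using mult_left_mono_neg[OF harm_ge_ln[of k], of \<beta>] by linarith
  qed
  finally have "bc (1 + \<beta>) k \<le> exp (\<bar>\<beta>\<bar> + \<beta> * ln (real k + 1))" by simp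
  then show ?thesis by (simp add: exp_add powr_def)
qed

text \<open>Weighted AM-GM for \<open>1 + y\<close> and \<open>1\<close> with weights
  \<open>t\<close> and \<open>1 - t\<close>. It stands in for derivatives and integrals in the power
  estimates that follow.\<close>

lemma powr_Bernoulli:
  fixes t y :: real
  assumes "0 \<le> t" "t \<le> 1" "-1 \<le> y"
  shows "(1 + y) powr t \<le> 1 + t * y"
proof (cases "y = -1")
  case False
  then show ?thesis using Youngs_inequality_0[of t "1 - t" "1 + y" 1] assms by (simp add: algebra_simps)
qed (use assms in auto)

text \<open>Both sides are 1 at k = 0, and the step to k + 1 multiplies the left by (1 + 1/(k +
  1))^\<alpha>, which is at most the factor 1 + \<alpha>/(k + 1) on the right. The lower estimate of
  the conditionality constants rests on this.\<close>

lemma bc_lower: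
  assumes "0 \<le> \<alpha>" "\<alpha> \<le> 1"
  shows "(real k + 1) powr \<alpha> \<le> bc (1 + \<alpha>) k"
proof (induction k)
  case (Suc k)
  have "(real (Suc k) + 1) powr \<alpha> = (real k + 1) powr \<alpha> * (1 + 1 / (real k + 1)) powr \<alpha>"
    by (simp add: powr_divide field_simps flip: powr_mult)
  also have "\<dots> \<le> bc (1 + \<alpha>) k * (1 + \<alpha> * (1 / (real k + 1)))"
    using assms by (intro mult_mono Suc powr_Bernoulli) (auto intro: bc_nonneg order_trans[of _ 0])
  also have "\<dots> = bc (1 + \<alpha>) (Suc k)" by (simp add: bc_Suc field_simps)
  finally show ?case .
qed simp

text \<open>The l_1 norm of the truncated convolution kernel bounds its operator norm on the first
  \<open>N\<close> coordinates: a power of \<open>N\<close> for nonnegative order, a constant for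
  nonpositive order.\<close>

lemma sum_abs_bc_nonneg:
  assumes "0 \<le> \<beta>"
  shows "(\<Sum>k<N. \<bar>bc \<beta> k\<bar>) \<le> exp \<beta> * real N powr \<beta>"
proof (cases N)
  case (Suc n)
  have "(\<Sum>k<N. \<bar>bc \<beta> k\<bar>) = bc (1 + \<beta>) n"
    using assms by (simp add: Suc lessThan_Suc_atMost bc_nonneg sum_bc del: sum.lessThan_Suc)
  also have "\<dots> \<le> exp \<beta> * real N powr \<beta>"
    using bc_upper[of \<beta> n] assms Suc by (simp add: add.commute)
  finally show ?thesis .
qed simp

text \<open>All coefficients after the leading 1 are nonpositive, so the absolute sum is 2 minus the
  plain sum, and the plain sum \<open>bc (1 + \<beta>) n\<close> is nonnegative.\<close>

lemma sum_abs_bc_nonpos: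
  assumes "-1 \<le> \<beta>" "\<beta> \<le> 0"
  shows "(\<Sum>k<N. \<bar>bc \<beta> k\<bar>) \<le> 2"
proof (cases N)
  case (Suc n)
  have "(\<Sum>k<N. \<bar>bc \<beta> k\<bar>) = (\<Sum>k<N. (if k = 0 then 2 else 0) - bc \<beta> k)"
  proof (intro sum.cong refl)
    fix k show "\<bar>bc \<beta> k\<bar> = (if k = 0 then 2 else 0) - bc \<beta> k"
    proof (cases k)
      case (Suc j)
      have "bc \<beta> k \<le> 0" unfolding Suc bc_Suc' using assms bc_nonneg[of "1+\<beta>" j]
        by (simp add: divide_nonpos_pos mult_nonpos_nonneg)
      then show ?thesis using Suc by simp
    qed simp
  qed
  also have "\<dots> = 2 - bc (1 + \<beta>) n"
    by (simp add: sum_subtractf Suc lessThan_Suc_atMost sum_bc del: sum.lessThan_Suc)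
  also have "\<dots> \<le> 2" using assms bc_nonneg[of "1 + \<beta>" n] by simp
  finally show ?thesis .
qed simp

text \<open>The full convolution vanishes for \<open>c > 0\<close>, which is why its partial sums have a closed form.\<close>

lemma partial_bc_convolution:
  assumes "r < c"
  shows "(\<Sum>l\<le>r. bc (-\<beta>) l * bc \<beta> (c - l)) = \<beta> * bc (1 - \<beta>) r * bc (1 + \<beta>) (c - Suc r) / real c"
  using assms
proof (induction r)
  case 0
  then obtain n where "c = Suc n" by (cases c) auto
  then show ?case by (simp add: bc_Suc' add.commute)
next
  case (Suc r)
  define s where "s = c - r - 2"
  have c: "c = r + s + 2" using Suc.prems by (simp add: s_def)
  have e: "c - Suc r = Suc s" "c - Suc (Suc r) = s" using c by auto
  have b1: "bc (1 + \<beta>) (Suc s) = bc (1 + \<beta>) s * (1 + \<beta> + s) / (s + 1)"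
    and b2: "bc (- \<beta>) (Suc r) = - \<beta> * bc (1 - \<beta>) r / (r + 1)"
    and b3: "bc \<beta> (Suc s) = \<beta> * bc (1 + \<beta>) s / (s + 1)"
    and b4: "bc (1 - \<beta>) (Suc r) = bc (1 - \<beta>) r * (1 - \<beta> + r) / (r + 1)"
    using bc_Suc[of "1+\<beta>" s] bc_Suc'[of "-\<beta>" r] bc_Suc'[of \<beta> s] bc_Suc[of "1-\<beta>" r] by simp_all
  define R where "R = real r + 1"
  define S where "S = real s + 1"
  have RS: "real c = R + S" "R > 0" "S > 0" unfolding R_def S_def c by auto
  \<comment> \<open>The three terms of the induction step share the factor
    \<open>\<beta> * bc (1 - \<beta>) r * bc (1 + \<beta>) s\<close>; what remains is this identity
    of rational functions.\<close>
  have "(\<beta> + S) / (S * (R + S)) - \<beta> / (R * S) = (R - \<beta>) / (R * (R + S))"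
    using RS(2,3) by (simp add: divide_simps add_pos_pos) (simp add: algebra_simps)
  then have "(\<beta> * bc (1 - \<beta>) r * bc (1 + \<beta>) s) * ((\<beta> + S) / (S * (R + S)) - \<beta> / (R * S)) =
    (\<beta> * bc (1 - \<beta>) r * bc (1 + \<beta>) s) * ((R - \<beta>) / (R * (R + S)))" by simp
  moreover have "(\<Sum>l\<le>Suc r. bc (-\<beta>) l * bc \<beta> (c - l)) =
      \<beta> * bc (1 - \<beta>) r * bc (1 + \<beta>) (Suc s) / real c + bc (- \<beta>) (Suc r) * bc \<beta> (Suc s)"
    using Suc e by simp
  ultimately show ?case
    unfolding b1 b2 b3 b4 e RS(1) R_def[symmetric] S_def[symmetric]
    by (simp add: R_def S_def algebra_simps)
qed

section \<open>Discrete Hilbert-type sums\<close>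

lemma hilbert_sum_step:
  fixes x \<theta> :: real
  assumes "1 \<le> x" "0 < \<theta>" "\<theta> < 1"
  shows "x powr (-\<theta>) \<le> (x powr (1 - \<theta>) - (x - 1) powr (1 - \<theta>)) / (1 - \<theta>)"
proof -
  have "(x - 1) powr (1 - \<theta>) = x powr (1 - \<theta>) * (1 + - 1 / x) powr (1 - \<theta>)"
    using assms unfolding powr_mult[symmetric] by (simp add: right_diff_distrib)
  also have "\<dots> \<le> x powr (1 - \<theta>) * (1 + (1 - \<theta>) * (- 1 / x))"
    using assms by (intro mult_left_mono powr_Bernoulli) (auto simp: field_simps)
  also have "\<dots> = x powr (1 - \<theta>) - (1 - \<theta>) * x powr (-\<theta>)"
    using assms by (simp add: powr_diff powr_minus field_simps)
  finally show ?thesis using assms by (simp add: field_simps)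
qed

text \<open>Both step lemmas compare a summand with the increment of an antiderivative:
  t^(-\<theta>) with t^(1 - \<theta>)/(1 - \<theta>), and t^(-\<theta> - 1) with
  -t^(-\<theta>)/\<theta>. Here the Bernoulli bound for (1 - 1/x)^\<theta> is inverted by means of
  (1 - \<theta>/x)(1 + \<theta>/x) <= 1.\<close>

lemma hilbert_tail_step:
  fixes x \<theta> :: real
  assumes "1 < x" "0 < \<theta>" "\<theta> < 1"
  shows "x powr (-\<theta>) / x \<le> ((x - 1) powr (-\<theta>) - x powr (-\<theta>)) / \<theta>"
proof -
  define u where "u = (1 - 1/x)"
  have u: "0 < u" using assms by (simp add: u_def)
  have th: "\<theta> / x < 1" using assms by (simp add: field_simps)
  have "u powr \<theta> \<le> 1 + \<theta> * (- 1/x)"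
    using powr_Bernoulli[of \<theta> "-1/x"] assms by (simp add: u_def)
  then have "u powr \<theta> * (1 + \<theta>/x) \<le> (1 - \<theta>/x) * (1 + \<theta>/x)"
    using assms by (intro mult_right_mono) auto
  also have "\<dots> \<le> 1" by (simp add: algebra_simps)
  finally have "1 + \<theta>/x \<le> u powr (-\<theta>)" using u by (simp add: powr_minus field_simps)
  then have "x powr (-\<theta>) * (1 + \<theta>/x) \<le> x powr (-\<theta>) * u powr (-\<theta>)" by (rule mult_left_mono) auto
  also have "\<dots> = (x - 1) powr (-\<theta>)"
    using assms unfolding powr_mult[symmetric] by (simp add: u_def right_diff_distrib)
  finally show ?thesis using assms by (simp add: field_simps)
qed

text \<open>The denominator is at least s + 1 for r <= s and at least r + 1 beyond; each half then
  telescopes by its step lemma and contributes one of the two constants.\<close>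

lemma hilbert_sum:
  fixes \<theta> :: real
  assumes \<theta>: "0 < \<theta>" "\<theta> < 1"
  shows "(\<Sum>r<N. (real r + 1) powr (-\<theta>) / (real r + real s + 1)) \<le> (1 / (1 - \<theta>) + 1 / \<theta>) * (real s + 1) powr (-\<theta>)"
proof -
  let ?t = "\<lambda>r. (real r + 1) powr (-\<theta>) / (real r + real s + 1)"
  have 1: "(\<Sum>r<Suc s. ?t r) \<le> 1 / (1 - \<theta>) * (real s + 1) powr (-\<theta>)"
  proof -
    have "(\<Sum>r<Suc s. ?t r) \<le> (\<Sum>r<Suc s. ((real (Suc r)) powr (1-\<theta>) - (real r) powr (1 - \<theta>)) / ((1-\<theta>) * (real s + 1)))"
    proof (rule sum_mono)
      fix r
      have "?t r \<le> (real r + 1) powr (-\<theta>) / (real s + 1)" by (intro divide_left_mono) auto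
      also have "\<dots> \<le> (((real r + 1) powr (1-\<theta>) - (real r) powr (1 - \<theta>)) / (1-\<theta>)) / (real s + 1)"
        using hilbert_sum_step[of "real r + 1" \<theta>] \<theta> by (intro divide_right_mono) auto
      finally show "?t r \<le> ((real (Suc r)) powr (1-\<theta>) - (real r) powr (1 - \<theta>)) / ((1-\<theta>) * (real s + 1))"
        by (simp add: add.commute)
    qed
    also have "\<dots> = (real s + 1) powr (1 - \<theta>) / ((1-\<theta>) * (real s + 1))"
      using \<theta> sum_lessThan_telescope[of "\<lambda>r. real r powr (1 - \<theta>)" "Suc s"]
      by (simp add: add.commute flip: sum_divide_distrib del: sum.lessThan_Suc)
    also have "\<dots> = 1 / (1 - \<theta>) * (real s + 1) powr (-\<theta>)"
      using \<theta> powr_mult_base[of "real s + 1" "-\<theta>", symmetric] by simp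
    finally show ?thesis .
  qed
  have 2: "(\<Sum>r=Suc s..<M. ?t r) \<le> 1 / \<theta> * (real s + 1) powr (-\<theta>)" for M
  proof (cases "Suc s \<le> M")
    case True
    have "(\<Sum>r=Suc s..<M. ?t r) \<le> (\<Sum>r=Suc s..<M. - (real (Suc r) powr (-\<theta>)) / \<theta> - - (real r powr (-\<theta>)) / \<theta>)"
    proof (rule sum_mono)
      fix r assume r: "r \<in> {Suc s..<M}"
      have "?t r \<le> (real r + 1) powr (-\<theta>) / (real r + 1)" by (intro divide_left_mono) auto
      also have "\<dots> \<le> ((real r + 1 - 1) powr (-\<theta>) - (real r + 1) powr (-\<theta>)) / \<theta>"
        using r \<theta> by (intro hilbert_tail_step) auto
      finally show "?t r \<le> - (real (Suc r) powr (-\<theta>)) / \<theta> - - (real r powr (-\<theta>)) / \<theta>"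
        by (simp add: diff_divide_distrib add.commute)
    qed
    also have "\<dots> = - (real M powr (-\<theta>)) / \<theta> - - (real (Suc s) powr (-\<theta>)) / \<theta>"
      using sum_Suc_diff'[OF True, of "\<lambda>r. - (real r powr (-\<theta>)) / \<theta>"] by simp
    also have "\<dots> \<le> real (Suc s) powr (-\<theta>) / \<theta>" using \<theta> by simp
    finally show ?thesis by (simp add: add.commute)
  qed (use \<theta> in simp)
  have "(\<Sum>r<N. ?t r) \<le> (\<Sum>r<max N (Suc s). ?t r)"
    by (rule sum_mono2) auto
  also have "\<dots> = (\<Sum>r<Suc s. ?t r) + (\<Sum>r=Suc s..<max N (Suc s). ?t r)"
    by (simp add: lessThan_atLeast0 sum.atLeastLessThan_concat del: sum.op_ivl_Suc)
  also have "\<dots> \<le> 1 / (1 - \<theta>) * (real s + 1) powr (-\<theta>) + 1 / \<theta> * (real s + 1) powr (-\<theta>)"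
    by (rule add_mono[OF 1 2])
  finally show ?thesis by (simp add: distrib_right)
qed

section \<open>Fractional summation operators and their partial sum projections\<close>

definition frac_sum :: "real \<Rightarrow> (nat \<Rightarrow> 'k::real_normed_field) \<Rightarrow> nat \<Rightarrow> 'k" where
  "frac_sum \<beta> s n = (\<Sum>k\<le>n. of_real (bc \<beta> k) * s (n - k))"

text \<open>Convolution is multiplication of formal power series, so associativity and
  \<open>bc_add\<close> give the composition law; in particular order \<open>-\<beta>\<close>
  inverts order \<open>\<beta>\<close>.\<close>

lemma frac_sum_frac_sum: "frac_sum \<beta> (frac_sum \<gamma> s) = frac_sum (\<beta> + \<gamma>) (s :: nat \<Rightarrow> 'k::real_normed_field)"
proof -
  let ?E = "\<lambda>\<beta>. Abs_fps (\<lambda>k. of_real (bc \<beta> k)) :: 'k fps"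
  have fs: "frac_sum \<beta> s = fps_nth (?E \<beta> * Abs_fps s)" for \<beta> and s :: "nat \<Rightarrow> 'k"
    by (simp add: fun_eq_iff frac_sum_def fps_mult_nth atMost_atLeast0)
  have "?E \<beta> * ?E \<gamma> = ?E (\<beta> + \<gamma>)"
    by (simp add: fps_eq_iff fps_mult_nth bc_add atMost_atLeast0)
  then show ?thesis
    by (simp add: fs fps_nth_inverse flip: mult.assoc)
qed

lemma frac_sum_zero: "frac_sum 0 s = s"
proof
  fix n
  have "frac_sum 0 s n = (\<Sum>k\<le>n. if k = 0 then s n else 0)"
    unfolding frac_sum_def by (intro sum.cong) (auto simp: bc_zero)
  then show "frac_sum 0 s n = s n" by simp
qed

lemma frac_sum_add: "frac_sum \<beta> (f + g) = frac_sum \<beta> f + frac_sum \<beta> g"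
  by (simp add: fun_eq_iff frac_sum_def distrib_left sum.distrib)

lemma frac_sum_diff: "frac_sum \<beta> (f - g) = frac_sum \<beta> f - frac_sum \<beta> g"
  by (simp add: fun_eq_iff frac_sum_def right_diff_distrib sum_subtractf)

lemma frac_sum_scale: "frac_sum \<beta> (seq_scale c f) = seq_scale c (frac_sum \<beta> f)"
  by (simp add: fun_eq_iff frac_sum_def seq_scale_def sum_distrib_left mult_ac)

lemma frac_sum_cong: "(\<And>i. i \<le> n \<Longrightarrow> f i = g i) \<Longrightarrow> frac_sum \<beta> f n = frac_sum \<beta> g n"
  by (simp add: frac_sum_def)

lemma frac_sum_alt: "frac_sum \<beta> s n = (\<Sum>k\<le>n. of_real (bc \<beta> (n - k)) * s k)"
  unfolding frac_sum_def by (rule sum.reindex_bij_witness[of _ "\<lambda>k. n - k" "\<lambda>k. n - k"]) auto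

definition unit_seq :: "nat \<Rightarrow> nat \<Rightarrow> 'k::real_normed_field" where
  "unit_seq n = (\<lambda>i. if i = n then 1 else 0)"

lemma unit_seq_lp:
  assumes "0 < p"
  shows "(unit_seq n :: nat \<Rightarrow> 'k::real_normed_field) \<in> lp p" "lp_norm p (unit_seq n :: nat \<Rightarrow> 'k::real_normed_field) = 1"
  using lp_norm_unit[OF assms, of n "1::'k"] by (simp_all add: unit_seq_def)

lemma frac_sum_unit: "frac_sum \<beta> (unit_seq n) i = (if n \<le> i then of_real (bc \<beta> (i - n)) else 0)"
proof -
  have "frac_sum \<beta> (unit_seq n) i = (\<Sum>k\<le>i. if k = n then of_real (bc \<beta> (i - n)) else 0)"
    unfolding frac_sum_alt unit_seq_def by (intro sum.cong) auto
  then show ?thesis by simp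
qed

text \<open>The basis vectors are \<open>frac_sum \<beta> (unit_seq n)\<close>, so this is the \<open>N\<close>-th partial sum of \<open>g\<close>.\<close>

definition frac_psum :: "real \<Rightarrow> nat \<Rightarrow> (nat \<Rightarrow> 'k::real_normed_field) \<Rightarrow> nat \<Rightarrow> 'k" where
  "frac_psum \<beta> N g = frac_sum \<beta> (restr {..<N} (frac_sum (-\<beta>) g))"

text \<open>The convolutions are lower triangular, so entries below \<open>N\<close> see only
  retained coefficients, and the two fractional sums cancel there.\<close>

lemma frac_psum_below:
  assumes "i < N" shows "frac_psum \<beta> N g i = g i"
proof -
  have "frac_psum \<beta> N g i = frac_sum \<beta> (frac_sum (-\<beta>) g) i"
    unfolding frac_psum_def by (rule frac_sum_cong) (use assms in \<open>simp add: restr_def\<close>)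
  then show ?thesis by (simp add: frac_sum_frac_sum frac_sum_zero)
qed

text \<open>Entry of the partial sum projection at the cut \<open>N\<close> in row
  \<open>N + s\<close> and column \<open>N - 1 - r\<close>: both indices count the distance to the
  cut, which makes the kernel independent of \<open>N\<close>.\<close>

definition tail_kernel :: "real \<Rightarrow> nat \<Rightarrow> nat \<Rightarrow> real" where
  "tail_kernel \<beta> r s = \<beta> * bc (1 - \<beta>) r * bc (1 + \<beta>) s / (real r + real s + 1)"

lemma frac_psum_above:
  fixes g :: "nat \<Rightarrow> 'k::real_normed_field"
  assumes "N \<le> i"
  shows "frac_psum \<beta> N g i = (\<Sum>j<N. of_real (tail_kernel \<beta> (N - Suc j) (i - N)) * g j)"
proof -
  have "frac_psum \<beta> N g i = (\<Sum>n\<le>i. of_real (bc \<beta> (i - n)) * restr {..<N} (frac_sum (-\<beta>) g) n)"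
    by (simp add: frac_psum_def frac_sum_alt)
  also have "\<dots> = (\<Sum>n<N. of_real (bc \<beta> (i - n)) * frac_sum (-\<beta>) g n)"
    by (rule sum.mono_neutral_cong_right) (use assms in \<open>auto simp: restr_def\<close>)
  also have "\<dots> = (\<Sum>n<N. \<Sum>j\<le>n. of_real (bc (-\<beta>) (n - j) * bc \<beta> (i - n)) * g j)"
    by (simp add: frac_sum_alt sum_distrib_left mult_ac)
  also have "\<dots> = (\<Sum>(n,j)\<in>Sigma {..<N} (\<lambda>n. {..n}). of_real (bc (-\<beta>) (n - j) * bc \<beta> (i - n)) * g j)"
    by (simp add: sum.Sigma)
  \<comment> \<open>With \<open>n = j + l\<close> the inner sum becomes a convolution of total
    degree \<open>i - j\<close> stopped at \<open>N - 1 - j\<close>, which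
    \<open>partial_bc_convolution\<close> evaluates.\<close>
  also have "\<dots> = (\<Sum>(j,l)\<in>Sigma {..<N} (\<lambda>j. {..N - Suc j}). of_real (bc (-\<beta>) l * bc \<beta> (i - j - l)) * g j)"
    by (rule sum.reindex_bij_witness[of _ "\<lambda>(j,l). (j + l, j)" "\<lambda>(n,j). (j, n - j)"]) auto
  also have "\<dots> = (\<Sum>j<N. \<Sum>l\<le>N - Suc j. of_real (bc (-\<beta>) l * bc \<beta> (i - j - l)) * g j)"
    by (simp add: sum.Sigma)
  also have "\<dots> = (\<Sum>j<N. of_real (\<Sum>l\<le>N - Suc j. bc (-\<beta>) l * bc \<beta> (i - j - l)) * g j)"
    by (simp add: sum_distrib_right)
  also have "\<dots> = (\<Sum>j<N. of_real (tail_kernel \<beta> (N - Suc j) (i - N)) * g j)"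
  proof (intro sum.cong refl)
    fix j assume j: "j \<in> {..<N}"
    have e: "i - j - Suc (N - Suc j) = i - N" "real (i - j) = real (N - Suc j) + real (i - N) + 1"
      using j assms by auto
    have "N - Suc j < i - j" using j assms by auto
    from partial_bc_convolution[OF this, of \<beta>] 
    show "of_real (\<Sum>l\<le>N - Suc j. bc (-\<beta>) l * bc \<beta> (i - j - l)) * g j = of_real (tail_kernel \<beta> (N - Suc j) (i - N)) * g j"
      unfolding e tail_kernel_def by simp
  qed
  finally show ?thesis .
qed

lemma tail_kernel_bound:
  assumes "-1 < \<beta>" "\<beta> < 1"
  shows "\<bar>tail_kernel \<beta> r s\<bar> \<le> exp (2 * \<bar>\<beta>\<bar>) * (real r + 1) powr (-\<beta>) * (real s + 1) powr \<beta> / (real r + real s + 1)"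
proof -
  have "\<bar>\<beta>\<bar> * bc (1 - \<beta>) r * bc (1 + \<beta>) s \<le> 1 * (exp \<bar>\<beta>\<bar> * (real r + 1) powr (-\<beta>)) * (exp \<bar>\<beta>\<bar> * (real s + 1) powr \<beta>)"
    using assms bc_upper[of "-\<beta>" r] bc_upper[of \<beta> s] 
    by (intro mult_mono) (auto intro!: bc_nonneg mult_nonneg_nonneg)
  also have "\<dots> = exp (2 * \<bar>\<beta>\<bar>) * (real r + 1) powr (-\<beta>) * (real s + 1) powr \<beta>"
    by (simp add: exp_double power2_eq_square)
  finally have "\<bar>\<beta>\<bar> * bc (1 - \<beta>) r * bc (1 + \<beta>) s / (real r + real s + 1) \<le> exp (2 * \<bar>\<beta>\<bar>) * (real r + 1) powr (-\<beta>) * (real s + 1) powr \<beta> / (real r + real s + 1)"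
    by (rule divide_right_mono) auto
  then show ?thesis using assms bc_nonneg[of "1-\<beta>" r] bc_nonneg[of "1+\<beta>" s]
    by (simp add: tail_kernel_def abs_mult)
qed

text \<open>Schur's test with the same weight (r + 1)^(-1/p) on rows and columns. Once the powers
  are combined, the row sums are Hilbert sums with exponent \<theta> and the column sums with \<eta>
  = 1 - \<theta>; both lie in (0, 1) exactly when -1/p < \<beta> < 1 - 1/p.\<close>

lemma tail_kernel_schur:
  fixes x :: "nat \<Rightarrow> real"
  assumes p: "1 < p" and \<beta>: "-1/p < \<beta>" "\<beta> < 1 - 1/p"
  shows "\<exists>C\<ge>0. \<forall>x N M. (\<forall>r. 0 \<le> x r) \<longrightarrow>
    (\<Sum>s<M. (\<Sum>r<N. \<bar>tail_kernel \<beta> r s\<bar> * x r) powr p) \<le> C powr p * (\<Sum>r<N. x r powr p)"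
proof -
  define \<theta> \<eta> where "\<theta> = \<beta> + 1/p" and "\<eta> = 1 - 1/p - \<beta>"
  have \<theta>: "0 < \<theta>" "\<theta> < 1" and \<eta>: "0 < \<eta>" "\<eta> < 1" using \<beta> p by (auto simp: \<theta>_def \<eta>_def)
  have p1: "1/p < 1" "0 < 1/p" using p by auto
  then have \<beta>1: "-1 < \<beta>" "\<beta> < 1" using \<beta> by linarith+
  define E where "E = exp (2 * \<bar>\<beta>\<bar>)"
  define A where "A = E * (1 / (1 - \<theta>) + 1 / \<theta>)"
  define B where "B = E * (1 / (1 - \<eta>) + 1 / \<eta>)"
  have E0: "E > 0" by (simp add: E_def)
  have A0: "A > 0" "B > 0" unfolding A_def B_def using \<theta> \<eta> E0 by (auto intro!: mult_pos_pos add_pos_pos)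
  define v where "v = (\<lambda>r. (real r + 1) powr (-1/p))"
  have vp: "v r powr (p - 1) = (real r + 1) powr (-(1 - 1/p))" for r
  proof -
    have "-1/p * (p - 1) = -(1 - 1/p)" using p by (simp add: field_simps)
    then show ?thesis by (simp only: v_def powr_powr)
  qed
  have row: "(\<Sum>r<N. \<bar>tail_kernel \<beta> r s\<bar> * v r) \<le> A * v s" for N s
  proof -
    have "(\<Sum>r<N. \<bar>tail_kernel \<beta> r s\<bar> * v r) \<le> (\<Sum>r<N. E * (real s + 1) powr \<beta> * ((real r + 1) powr (-\<theta>) / (real r + real s + 1)))"
    proof (rule sum_mono)
      fix r
      have "\<bar>tail_kernel \<beta> r s\<bar> * v r \<le> (E * (real r + 1) powr (-\<beta>) * (real s + 1) powr \<beta> / (real r + real s + 1)) * v r"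
        unfolding E_def by (intro mult_right_mono tail_kernel_bound \<beta>1) (simp add: v_def)
      also have "\<dots> = E * (real s + 1) powr \<beta> * (((real r + 1) powr (-\<beta>) * (real r + 1) powr (-1/p)) / (real r + real s + 1))"
        by (simp add: v_def)
      also have "(real r + 1) powr (-\<beta>) * (real r + 1) powr (-1/p) = (real r + 1) powr (-\<theta>)"
        by (simp add: \<theta>_def flip: powr_add)
      finally show "\<bar>tail_kernel \<beta> r s\<bar> * v r \<le> E * (real s + 1) powr \<beta> * ((real r + 1) powr (-\<theta>) / (real r + real s + 1))" .
    qed
    also have "\<dots> \<le> E * (real s + 1) powr \<beta> * ((1 / (1 - \<theta>) + 1 / \<theta>) * (real s + 1) powr (-\<theta>))"
      unfolding sum_distrib_left[symmetric] by (intro mult_left_mono hilbert_sum \<theta>) (use E0 in auto)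
    also have "\<dots> = A * ((real s + 1) powr \<beta> * (real s + 1) powr (-\<theta>))" by (simp add: A_def)
    also have "(real s + 1) powr \<beta> * (real s + 1) powr (-\<theta>) = v s"
      by (simp add: \<theta>_def v_def flip: powr_add)
    finally show ?thesis .
  qed
  have col: "(\<Sum>s<M. \<bar>tail_kernel \<beta> r s\<bar> * v s powr (p - 1)) \<le> B * v r powr (p - 1)" for M r
  proof -
    have "(\<Sum>s<M. \<bar>tail_kernel \<beta> r s\<bar> * v s powr (p - 1)) \<le> (\<Sum>s<M. E * (real r + 1) powr (-\<beta>) * ((real s + 1) powr (-\<eta>) / (real s + real r + 1)))"
    proof (rule sum_mono)
      fix s
      have "\<bar>tail_kernel \<beta> r s\<bar> * v s powr (p - 1) \<le> (E * (real r + 1) powr (-\<beta>) * (real s + 1) powr \<beta> / (real r + real s + 1)) * v s powr (p - 1)"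
        unfolding E_def by (intro mult_right_mono tail_kernel_bound \<beta>1) simp
      also have "\<dots> = E * (real r + 1) powr (-\<beta>) * (((real s + 1) powr \<beta> * (real s + 1) powr (-(1 - 1/p))) / (real s + real r + 1))"
        by (simp add: vp add.commute)
      also have "(real s + 1) powr \<beta> * (real s + 1) powr (-(1 - 1/p)) = (real s + 1) powr (-\<eta>)"
        by (simp add: \<eta>_def algebra_simps flip: powr_add)
      finally show "\<bar>tail_kernel \<beta> r s\<bar> * v s powr (p - 1) \<le> E * (real r + 1) powr (-\<beta>) * ((real s + 1) powr (-\<eta>) / (real s + real r + 1))" .
    qed
    also have "\<dots> \<le> E * (real r + 1) powr (-\<beta>) * ((1 / (1 - \<eta>) + 1 / \<eta>) * (real r + 1) powr (-\<eta>))"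
      unfolding sum_distrib_left[symmetric] by (intro mult_left_mono hilbert_sum \<eta>) (use E0 in auto)
    also have "\<dots> = B * ((real r + 1) powr (-\<beta>) * (real r + 1) powr (-\<eta>))" by (simp add: B_def)
    also have "(real r + 1) powr (-\<beta>) * (real r + 1) powr (-\<eta>) = v r powr (p - 1)"
      unfolding vp by (simp add: \<eta>_def flip: powr_add)
    finally show ?thesis .
  qed
  define C where "C = (A powr (p - 1) * B) powr (1/p)"
  have Cp: "C powr p = A powr (p - 1) * B" using p A0 by (simp add: C_def powr_powr)
  have "(\<Sum>s<M. (\<Sum>r<N. \<bar>tail_kernel \<beta> r s\<bar> * x r) powr p) \<le> C powr p * (\<Sum>r<N. x r powr p)"
    if "\<forall>r. 0 \<le> x r" for x :: "nat \<Rightarrow> real" and N M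
    unfolding Cp
    by (rule schur_test[OF p, where v = v and w = v]) (use A0 that row col in \<open>auto simp: v_def\<close>)
  then show ?thesis by (intro exI[of _ C]) (simp add: C_def)
qed
lemma restr_diff: "restr A (f - g) = restr A f - restr A (g :: nat \<Rightarrow> 'k::real_normed_field)"
  by (simp add: restr_def fun_eq_iff)

text \<open>Above the cut the projection is the fixed kernel applied to the entries before the cut
  in reversed order, so the Schur bound is uniform in \<open>N\<close>; the truncation below the cut
  adds 1 to the constant.\<close>

lemma frac_psum_bounded:
  assumes p: "1 < p" and \<beta>: "-1/p < \<beta>" "\<beta> < 1 - 1/p"
  obtains C where "1 \<le> C"
    "\<And>N (g :: nat \<Rightarrow> 'k::real_normed_field). g \<in> lp p \<Longrightarrow> frac_psum \<beta> N g \<in> lp p"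
    "\<And>N (g :: nat \<Rightarrow> 'k::real_normed_field). g \<in> lp p \<Longrightarrow> lp_norm p (frac_psum \<beta> N g) \<le> C * lp_norm p g"
proof -
  obtain C where C: "C \<ge> 0" "\<forall>x N M. (\<forall>r. 0 \<le> x r) \<longrightarrow>
    (\<Sum>s<M. (\<Sum>r<N. \<bar>tail_kernel \<beta> r s\<bar> * x r) powr p) \<le> C powr p * (\<Sum>r<N. x r powr p)"
    using tail_kernel_schur[OF p \<beta>] by blast
  have p0: "0 < p" "1 \<le> p" using p by auto
  have main: "frac_psum \<beta> N g \<in> lp p \<and> lp_norm p (frac_psum \<beta> N g) \<le> (1 + C) * lp_norm p g"
    if g: "g \<in> lp p" for N and g :: "nat \<Rightarrow> 'k"
  proof -
    define t where "t = restr {N..} (frac_psum \<beta> N g)"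
    have tb: "(\<Sum>i<M. norm (t i) powr p) \<le> (C * lp_norm p g) powr p" for M
    proof -
      have "(\<Sum>i<M. norm (t i) powr p) \<le> (\<Sum>i<N + M. norm (t i) powr p)"
        by (rule sum_mono2) auto
      also have "\<dots> = (\<Sum>i<N. norm (t i) powr p) + (\<Sum>i=0+N..<M+N. norm (t i) powr p)"
        by (simp add: lessThan_atLeast0 sum.atLeastLessThan_concat add.commute)
      also have "\<dots> = (\<Sum>s<M. norm (t (s + N)) powr p)"
        unfolding sum.shift_bounds_nat_ivl using p by (simp add: t_def restr_def lessThan_atLeast0)
      also have "\<dots> \<le> (\<Sum>s<M. (\<Sum>r<N. \<bar>tail_kernel \<beta> r s\<bar> * norm (g (N - Suc r))) powr p)"
      proof (intro sum_mono powr_mono2)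
        fix s
        have "norm (t (s + N)) = norm (\<Sum>j<N. of_real (tail_kernel \<beta> (N - Suc j) s) * g j)"
          by (simp add: t_def restr_def frac_psum_above)
        also have "\<dots> \<le> (\<Sum>j<N. \<bar>tail_kernel \<beta> (N - Suc j) s\<bar> * norm (g j))"
          by (rule order_trans[OF norm_sum]) (simp add: norm_mult)
        also have "\<dots> = (\<Sum>r<N. \<bar>tail_kernel \<beta> r s\<bar> * norm (g (N - Suc r)))"
          by (rule sum.reindex_bij_witness[of _ "\<lambda>r. N - Suc r" "\<lambda>r. N - Suc r"]) auto
        finally show "norm (t (s + N)) \<le> (\<Sum>r<N. \<bar>tail_kernel \<beta> r s\<bar> * norm (g (N - Suc r)))" .
      qed (use p in auto)
      also have "\<dots> \<le> C powr p * (\<Sum>r<N. norm (g (N - Suc r)) powr p)"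
        by (rule C(2)[rule_format]) simp
      also have "\<dots> = C powr p * (\<Sum>j<N. norm (g j) powr p)"
        by (simp add: sum.nat_diff_reindex[of "\<lambda>j. norm (g j) powr p"])
      also have "\<dots> \<le> C powr p * lp_norm p g powr p"
        by (intro mult_left_mono lp_sum_le p0 g) auto
      finally show ?thesis by (simp add: powr_mult)
    qed
    note t = lpI[OF p0(1) _ tb] 
    have eq: "frac_psum \<beta> N g = restr {..<N} g + t"
      by (auto simp: fun_eq_iff t_def restr_def frac_psum_below)
    show ?thesis
      using lp_add[OF p0(2) lp_restr(1)[OF p0(1) g, of "{..<N}"] t(1)] lp_restr(2)[OF p0(1) g, of "{..<N}"] t(2) C(1)
      unfolding eq by (auto simp: distrib_right)
  qed
  show thesis by (rule that[of "1 + C"]) (use main C(1) in auto)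
qed

text \<open>On the first \<open>N\<close> coordinates a convolution is a combination of
  \<open>N\<close> truncated shifts, none of which increases the norm: Young's inequality for l_1
  and l_p.\<close>

lemma truncated_frac_sum_le:
  fixes s :: "nat \<Rightarrow> 'k::real_normed_field"
  assumes p: "1 < p"
  shows "lp_norm p (restr {..<N} (frac_sum \<beta> s)) \<le> (\<Sum>k<N. \<bar>bc \<beta> k\<bar>) * lp_norm p (restr {..<N} s)"
proof -
  have p0: "0 < p" "1 \<le> p" using p by auto
  define u where "u = (\<lambda>k i. if k \<le> i \<and> i < N then s (i - k) else 0)"
  have r: "restr {..<N} s \<in> lp p" by (rule lp_norm_finite_support(1)[OF p0(1), of "{..<N}"]) (auto simp: restr_def)
  have u: "u k \<in> lp p" "lp_norm p (u k) \<le> lp_norm p (restr {..<N} s)" for k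
  proof -
    have inj: "inj_on (\<lambda>i. i - k) {k..<N}" by (auto simp: inj_on_def)
    have *: "norm (u k i) \<le> norm (restr {..<N} s (i - k))" if "i \<in> {k..<N}" for i
      using that by (auto simp: u_def restr_def)
    have **: "u k i = 0" if "i \<notin> {k..<N}" for i using that by (auto simp: u_def)
    show "u k \<in> lp p" by (rule lp_embed(1)[OF p0(1) r inj * **])
    show "lp_norm p (u k) \<le> lp_norm p (restr {..<N} s)" by (rule lp_embed(2)[OF p0(1) r inj * **])
  qed
  have eq: "restr {..<N} (frac_sum \<beta> s) = (\<Sum>k<N. seq_scale (of_real (bc \<beta> k)) (u k))"
  proof
    fix i
    show "restr {..<N} (frac_sum \<beta> s) i = (\<Sum>k<N. seq_scale (of_real (bc \<beta> k)) (u k)) i"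
    proof (cases "i < N")
      case True
      have "(\<Sum>k\<le>i. of_real (bc \<beta> k) * s (i - k)) = (\<Sum>k<N. of_real (bc \<beta> k) * u k i)"
        by (rule sum.mono_neutral_cong_left) (use True in \<open>auto simp: u_def\<close>)
      then show ?thesis using True by (simp add: restr_def frac_sum_def sum_fun_app seq_scale_def)
    qed (simp add: restr_def sum_fun_app seq_scale_def u_def)
  qed
  have "lp_norm p (restr {..<N} (frac_sum \<beta> s)) \<le> (\<Sum>k<N. lp_norm p (seq_scale (of_real (bc \<beta> k)) (u k)))"
    unfolding eq by (rule lp_sum(2)[OF p0(2)]) (rule lp_norm_scale(1)[OF p0(1) u(1)])
  also have "\<dots> \<le> (\<Sum>k<N. \<bar>bc \<beta> k\<bar> * lp_norm p (restr {..<N} s))"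
    by (rule sum_mono) (simp add: lp_norm_scale(2)[OF p0(1) u(1)] mult_left_mono u(2))
  finally show ?thesis by (simp add: sum_distrib_right)
qed

text \<open>The parameter \<open>ty\<close> only pins down the scalar field.\<close>

locale frac_basis =
  fixes p \<beta> C :: real and ty :: "'k::real_normed_field itself"
  assumes p: "1 < p" and \<beta>: "-1/p < \<beta>" "\<beta> < 1 - 1/p" and C1: "1 \<le> C"
    and psum_lp: "\<And>N (g :: nat \<Rightarrow> 'k). g \<in> lp p \<Longrightarrow> frac_psum \<beta> N g \<in> lp p"
    and psum_le: "\<And>N (g :: nat \<Rightarrow> 'k). g \<in> lp p \<Longrightarrow> lp_norm p (frac_psum \<beta> N g) \<le> C * lp_norm p g"
begin

section \<open>Basis properties of the shifted Taylor coefficients\<close>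

lemma p0: "0 < p" "1 \<le> p" using p by auto

lemma \<beta>1: "-1 < \<beta>" "\<beta> < 1"
proof -
  have "1/p < 1" "0 < 1/p" using p by auto
  then show "-1 < \<beta>" "\<beta> < 1" using \<beta> by linarith+
qed

text \<open>Needed for convergence: as the cut moves away from a fixed column, the kernel in that
  column must vanish in norm. Bounding the denominator below by (r + 1)^(1 - \<delta>) (s +
  1)^\<delta> separates the variables, with \<gamma> = 1 + \<beta> - \<delta>.\<close>

lemma tail_kernel_row:
  obtains D \<gamma> where "0 < \<gamma>" "0 \<le> D" 
    "\<And>r. (\<lambda>s. of_real (tail_kernel \<beta> r s) :: 'k) \<in> lp p"
    "\<And>r. lp_norm p (\<lambda>s. of_real (tail_kernel \<beta> r s) :: 'k) \<le> D * (real r + 1) powr (-\<gamma>)"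
proof -
  \<comment> \<open>The midpoint of the admissible interval: above \<beta> + 1/p the powers of s are
    p-summable, below 1 + \<beta> the exponent \<gamma> is positive, and below 1 the denominator can
    be split.\<close>
  define \<delta> where "\<delta> = (\<beta> + 1/p + min 1 (1 + \<beta>)) / 2"
  have p1: "1/p < 1" "0 < 1/p" using p by auto
  define q where "q = 1/p"
  have q: "0 < q" "q < 1" "0 < \<beta> + q" "\<beta> + q < 1" using p1 \<beta> by (auto simp: q_def)
  have \<delta>: "0 < \<delta>" "\<delta> < 1" "\<delta> < 1 + \<beta>" "\<beta> + 1/p < \<delta>"
    using q \<beta>1 unfolding \<delta>_def q_def[symmetric] min_def by auto
  define w where "w = (\<lambda>s. of_real ((real s + 1) powr (\<beta> - \<delta>)) :: 'k)"
  have "(\<beta> - \<delta>) * p < -1" using \<delta>(4) p by (simp add: field_simps)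
  then have "summable (\<lambda>s. real (Suc s) powr ((\<beta> - \<delta>) * p))"
    by (subst summable_Suc_iff) (simp add: summable_real_powr_iff)
  then have w: "w \<in> lp p" by (simp add: lp_def w_def powr_powr add.commute)
  define E where "E = exp (2 * \<bar>\<beta>\<bar>)"
  have le: "\<bar>tail_kernel \<beta> r s\<bar> \<le> E * (real r + 1) powr (-(1 + \<beta> - \<delta>)) * (real s + 1) powr (\<beta> - \<delta>)" for r s
  proof -
    have "(real r + 1) powr (1 - \<delta>) * (real s + 1) powr \<delta> \<le> (real r + real s + 1) powr (1 - \<delta>) * (real r + real s + 1) powr \<delta>"
      using \<delta> by (intro mult_mono powr_mono2) auto
    also have "\<dots> = real r + real s + 1" by (simp flip: powr_add)
    finally have q: "(real r + 1) powr (1 - \<delta>) * (real s + 1) powr \<delta> \<le> real r + real s + 1" .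
    have "\<bar>tail_kernel \<beta> r s\<bar> \<le> E * (real r + 1) powr (-\<beta>) * (real s + 1) powr \<beta> / (real r + real s + 1)"
      unfolding E_def by (rule tail_kernel_bound[OF \<beta>1])
    also have "\<dots> \<le> E * (real r + 1) powr (-\<beta>) * (real s + 1) powr \<beta> / ((real r + 1) powr (1 - \<delta>) * (real s + 1) powr \<delta>)"
      by (intro divide_left_mono q) (auto simp: E_def intro!: mult_pos_pos)
    also have "\<dots> = E * ((real r + 1) powr (-\<beta>) / (real r + 1) powr (1 - \<delta>)) * ((real s + 1) powr \<beta> / (real s + 1) powr \<delta>)"
      by simp
    also have "\<dots> = E * (real r + 1) powr (-(1 + \<beta> - \<delta>)) * (real s + 1) powr (\<beta> - \<delta>)"
      by (simp flip: powr_diff) (simp add: algebra_simps)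
    finally show ?thesis .
  qed
  show thesis
  proof (rule that[of "1 + \<beta> - \<delta>" "E * lp_norm p w"])
    fix r
    let ?u = "seq_scale (of_real (E * (real r + 1) powr (-(1 + \<beta> - \<delta>)))) w"
    have u: "?u \<in> lp p" "lp_norm p ?u = E * (real r + 1) powr (-(1 + \<beta> - \<delta>)) * lp_norm p w"
      using lp_norm_scale[OF p0(1) w] by (simp_all add: E_def norm_mult)
    have pt: "norm (of_real (tail_kernel \<beta> r s) :: 'k) \<le> norm (?u s)" for s
      using le[of r s] by (simp add: seq_scale_def w_def norm_mult E_def abs_mult)
    show "(\<lambda>s. of_real (tail_kernel \<beta> r s) :: 'k) \<in> lp p" by (rule lp_mono(1)[OF p0(1) u(1) pt])
    show "lp_norm p (\<lambda>s. of_real (tail_kernel \<beta> r s) :: 'k) \<le> E * lp_norm p w * (real r + 1) powr (-(1 + \<beta> - \<delta>))"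
      using lp_mono(2)[OF p0(1) u(1) pt] unfolding u(2) by (simp add: mult_ac)
  qed (use \<delta> in \<open>auto simp: E_def\<close>)
qed

text \<open>Once \<open>N\<close> passes the support, the error lives entirely above the cut:
  finitely many kernel columns \<open>j\<close>, at distance \<open>N - 1 - j\<close>, with norms
  decaying by \<open>tail_kernel_row\<close>.\<close>

lemma psum_finite_tendsto:
  fixes g :: "nat \<Rightarrow> 'k"
  assumes off: "\<And>j. M \<le> j \<Longrightarrow> g j = 0"
  shows "(\<lambda>N. lp_norm p (g - frac_psum \<beta> N g)) \<longlonglongrightarrow> 0"
proof -
  obtain D \<gamma> where D: "0 < \<gamma>" "0 \<le> D" 
    "\<And>r. (\<lambda>s. of_real (tail_kernel \<beta> r s) :: 'k) \<in> lp p"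
    "\<And>r. lp_norm p (\<lambda>s. of_real (tail_kernel \<beta> r s) :: 'k) \<le> D * (real r + 1) powr (-\<gamma>)"
    by (rule tail_kernel_row) (rule that)
  define bd where "bd = (\<lambda>N. \<Sum>j<M. norm (g j) * (D * (real (N - Suc j) + 1) powr (-\<gamma>)))"
  have le: "lp_norm p (g - frac_psum \<beta> N g) \<le> bd N" if N: "M \<le> N" for N
  proof -
    define k where "k = (\<lambda>j i. if N \<le> i then of_real (tail_kernel \<beta> (N - Suc j) (i - N)) else 0 :: 'k)"
    have k: "k j \<in> lp p" "lp_norm p (k j) \<le> D * (real (N - Suc j) + 1) powr (-\<gamma>)" for j
    proof -
      have inj: "inj_on (\<lambda>i. i - N) {N..}" by (auto simp: inj_on_def)
      have *: "norm (k j i) \<le> norm (of_real (tail_kernel \<beta> (N - Suc j) (i - N)) :: 'k)" if "i \<in> {N..}" for i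
        using that by (simp add: k_def)
      have **: "k j i = 0" if "i \<notin> {N..}" for i using that by (simp add: k_def)
      show "k j \<in> lp p" by (rule lp_embed(1)[OF p0(1) D(3) inj * **])
      show "lp_norm p (k j) \<le> D * (real (N - Suc j) + 1) powr (-\<gamma>)"
        by (rule order_trans[OF lp_embed(2)[OF p0(1) D(3) inj * **] D(4)])
    qed
    have eq: "g - frac_psum \<beta> N g = - (\<Sum>j<M. seq_scale (g j) (k j))"
    proof
      fix i
      show "(g - frac_psum \<beta> N g) i = (- (\<Sum>j<M. seq_scale (g j) (k j))) i"
      proof (cases "i < N")
        case True
        then show ?thesis by (simp add: frac_psum_below sum_fun_app seq_scale_def k_def)
      next
        case False
        have "(\<Sum>j<N. of_real (tail_kernel \<beta> (N - Suc j) (i - N)) * g j) = (\<Sum>j<M. of_real (tail_kernel \<beta> (N - Suc j) (i - N)) * g j)"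
          by (rule sum.mono_neutral_right) (use N off in \<open>auto simp: not_less\<close>)
        then show ?thesis using False off[of i] N
          by (simp add: frac_psum_above sum_fun_app seq_scale_def k_def mult.commute)
      qed
    qed
    have "lp_norm p (g - frac_psum \<beta> N g) \<le> (\<Sum>j<M. lp_norm p (seq_scale (g j) (k j)))"
      unfolding eq lp_uminus(2) by (rule lp_sum(2)[OF p0(2)]) (rule lp_norm_scale(1)[OF p0(1) k(1)])
    also have "\<dots> \<le> bd N"
      unfolding bd_def by (rule sum_mono) (simp add: lp_norm_scale(2)[OF p0(1) k(1)] mult_left_mono k(2))
    finally show ?thesis .
  qed
  have "bd \<longlonglongrightarrow> (\<Sum>j<M. norm (g j) * (D * 0))"
    unfolding bd_def
  proof (intro tendsto_intros tendsto_neg_powr)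
    fix j
    have "filterlim (\<lambda>N. real (N - Suc j)) at_top sequentially"
      by (rule filterlim_compose[OF filterlim_real_sequentially filterlim_minus_const_nat_at_top])
    then show "filterlim (\<lambda>N. real (N - Suc j) + 1) at_top sequentially"
      by (rule filterlim_at_top_mono) auto
  qed (use D in auto)
  then have "bd \<longlonglongrightarrow> 0" by simp
  then show ?thesis
    by (rule tendsto_sandwich[OF _ _ tendsto_const, rotated 2])
       (use le in \<open>auto intro: eventually_sequentiallyI\<close>)
qed

lemma psum_diff: "frac_psum \<beta> N (f - g) = frac_psum \<beta> N f - frac_psum \<beta> N (g :: nat \<Rightarrow> 'k)"
  by (simp add: frac_psum_def frac_sum_diff restr_diff)

text \<open>Finitely supported sequences are dense and the projections are uniformly
  bounded.\<close>

lemma psum_tendsto: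
  fixes g :: "nat \<Rightarrow> 'k"
  assumes g: "g \<in> lp p"
  shows "(\<lambda>N. lp_norm p (g - frac_psum \<beta> N g)) \<longlonglongrightarrow> 0"
proof (rule LIMSEQ_I)
  fix \<epsilon> :: real assume \<epsilon>: "0 < \<epsilon>"
  have "(\<lambda>M. (1 + C) * lp_norm p (restr {M..} g)) \<longlonglongrightarrow> (1 + C) * 0"
    by (intro tendsto_intros lp_tail_tendsto p0 g)
  then obtain M where M: "(1 + C) * lp_norm p (restr {M..} g) < \<epsilon>/2"
    using order_tendstoD(2)[of _ "(1 + C) * 0" sequentially "\<epsilon>/2"] \<epsilon>
    by (auto simp: eventually_sequentially)
  define h where "h = restr {M..} g"
  define g' where "g' = restr {..<M} g"
  have h: "h \<in> lp p" and g': "g' \<in> lp p" unfolding h_def g'_def by (intro lp_restr p0 g)+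
  have gh: "g' = g - h" by (auto simp: fun_eq_iff g'_def h_def restr_def)
  have "(\<lambda>N. lp_norm p (g' - frac_psum \<beta> N g')) \<longlonglongrightarrow> 0"
    by (rule psum_finite_tendsto[of M]) (simp add: g'_def restr_def)
  then have "\<forall>\<^sub>F N in sequentially. lp_norm p (g' - frac_psum \<beta> N g') < \<epsilon>/2"
    by (rule order_tendstoD) (use \<epsilon> in simp)
  then obtain N0 where N0: "\<And>N. N0 \<le> N \<Longrightarrow> lp_norm p (g' - frac_psum \<beta> N g') < \<epsilon>/2"
    by (auto simp: eventually_sequentially)
  have "lp_norm p (g - frac_psum \<beta> N g) < \<epsilon>" if "N0 \<le> N" for N
  proof -
    have "g - frac_psum \<beta> N g = (g' - frac_psum \<beta> N g') + (h - frac_psum \<beta> N h)"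
      unfolding gh psum_diff by (simp add: algebra_simps)
    moreover have "lp_norm p (h - frac_psum \<beta> N h) \<le> lp_norm p h + C * lp_norm p h"
      using lp_diff(2)[OF p0(2) h psum_lp[OF h]] psum_le[OF h, of N] by (rule order_trans[OF _ add_left_mono])
    ultimately have "lp_norm p (g - frac_psum \<beta> N g) \<le> lp_norm p (g' - frac_psum \<beta> N g') + (1 + C) * lp_norm p h"
      using lp_add(2)[OF p0(2) lp_diff(1)[OF p0(2) g' psum_lp[OF g', of N]] lp_diff(1)[OF p0(2) h psum_lp[OF h, of N]]]
      by (simp add: distrib_right)
    then show ?thesis using N0[OF that] M by (simp add: h_def)
  qed
  then show "\<exists>N0. \<forall>N\<ge>N0. norm (lp_norm p (g - frac_psum \<beta> N g) - 0) < \<epsilon>" by auto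
qed

text \<open>Consecutive partial sums differ by the coefficient times the \<open>N\<close>-th basis
  vector, whose entry at \<open>N\<close> is 1. Boundedness and convergence of the partial sums thus
  pass to the coefficients.\<close>

lemma coeff_psum:
  fixes g :: "nat \<Rightarrow> 'k"
  shows "frac_sum (-\<beta>) g N = frac_psum \<beta> (Suc N) g N - frac_psum \<beta> N g N"
proof -
  let ?c = "frac_sum (-\<beta>) g"
  have "restr {..<Suc N} ?c - restr {..<N} ?c = seq_scale (?c N) (unit_seq N)"
    by (auto simp: fun_eq_iff restr_def seq_scale_def unit_seq_def)
  then have "frac_psum \<beta> (Suc N) g - frac_psum \<beta> N g = seq_scale (?c N) (frac_sum \<beta> (unit_seq N))"
    by (simp add: frac_psum_def flip: frac_sum_diff frac_sum_scale)
  then have "(frac_psum \<beta> (Suc N) g - frac_psum \<beta> N g) N = seq_scale (?c N) (frac_sum \<beta> (unit_seq N)) N" by simp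
  then show ?thesis by (simp add: seq_scale_def frac_sum_unit)
qed

lemma coeff_le:
  fixes g :: "nat \<Rightarrow> 'k"
  assumes g: "g \<in> lp p"
  shows "norm (frac_sum (-\<beta>) g N) \<le> 2 * C * lp_norm p g"
proof -
  have "norm (frac_sum (-\<beta>) g N) \<le> lp_norm p (frac_psum \<beta> (Suc N) g) + lp_norm p (frac_psum \<beta> N g)"
    unfolding coeff_psum by (intro norm_triangle_le_diff add_mono lp_coord_le p0 psum_lp g)
  then show ?thesis using psum_le[OF g, of N] psum_le[OF g, of "Suc N"] by linarith
qed

lemma coeff_tendsto:
  fixes g :: "nat \<Rightarrow> 'k"
  assumes g: "g \<in> lp p"
  shows "frac_sum (-\<beta>) g \<longlonglongrightarrow> 0"
proof (rule Lim_null_comparison)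
  let ?d = "\<lambda>N. lp_norm p (g - frac_psum \<beta> N g)"
  show "\<forall>\<^sub>F N in sequentially. norm (frac_sum (-\<beta>) g N) \<le> ?d N + ?d (Suc N)"
  proof (intro always_eventually allI)
    fix N
    have "frac_sum (-\<beta>) g N = (g - frac_psum \<beta> N g) N - (g - frac_psum \<beta> (Suc N) g) N"
      by (simp add: coeff_psum)
    also have "norm \<dots> \<le> ?d N + ?d (Suc N)"
      by (intro norm_triangle_le_diff add_mono lp_coord_le lp_diff p0 psum_lp g)
    finally show "norm (frac_sum (-\<beta>) g N) \<le> ?d N + ?d (Suc N)" .
  qed
  have "(\<lambda>N. ?d N + ?d (Suc N)) \<longlonglongrightarrow> 0 + 0"
    by (intro tendsto_add psum_tendsto g LIMSEQ_Suc[OF psum_tendsto[OF g]])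
  then show "(\<lambda>N. ?d N + ?d (Suc N)) \<longlonglongrightarrow> 0" by simp
qed

text \<open>The synthesised vector is the partial sum of its own first \<open>N\<close> entries, so
  the infinite tail costs only the projection constant and a truncated convolution remains to be
  estimated.\<close>

lemma synthesis:
  fixes s :: "nat \<Rightarrow> 'k"
  shows "frac_sum \<beta> (restr {..<N} s) \<in> lp p"
    and "lp_norm p (frac_sum \<beta> (restr {..<N} s)) \<le> C * ((\<Sum>k<N. \<bar>bc \<beta> k\<bar>) * lp_norm p (restr {..<N} s))"
proof -
  let ?u = "restr {..<N} (frac_sum \<beta> s)"
  have u: "?u \<in> lp p" by (rule lp_norm_finite_support(1)[OF p0(1), of "{..<N}"]) (auto simp: restr_def)
  have "restr {..<N} (frac_sum (-\<beta>) ?u) = restr {..<N} s"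
  proof
    fix i
    have "frac_sum (-\<beta>) ?u i = frac_sum (-\<beta>) (frac_sum \<beta> s) i" if "i < N"
      by (rule frac_sum_cong) (use that in \<open>simp add: restr_def\<close>)
    then show "restr {..<N} (frac_sum (-\<beta>) ?u) i = restr {..<N} s i"
      by (simp add: restr_def frac_sum_frac_sum frac_sum_zero)
  qed
  then have eq: "frac_sum \<beta> (restr {..<N} s) = frac_psum \<beta> N ?u" by (simp add: frac_psum_def)
  show "frac_sum \<beta> (restr {..<N} s) \<in> lp p" unfolding eq by (rule psum_lp[OF u])
  have "lp_norm p (frac_psum \<beta> N ?u) \<le> C * lp_norm p ?u" by (rule psum_le[OF u])
  also have "\<dots> \<le> C * ((\<Sum>k<N. \<bar>bc \<beta> k\<bar>) * lp_norm p (restr {..<N} s))"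
    using C1 by (intro mult_left_mono truncated_frac_sum_le p) auto
  finally show "lp_norm p (frac_sum \<beta> (restr {..<N} s)) \<le> C * ((\<Sum>k<N. \<bar>bc \<beta> k\<bar>) * lp_norm p (restr {..<N} s))"
    unfolding eq .
qed

text \<open>The coefficients of \<open>unit_seq n\<close> start with a 1 at \<open>n\<close>, so the
  basis vector is the partial sum of \<open>unit_seq n\<close> with the cut just behind
  \<open>n\<close>.\<close>

lemma basis_vector:
  shows "frac_sum \<beta> (unit_seq n :: nat \<Rightarrow> 'k) \<in> lp p" and "lp_norm p (frac_sum \<beta> (unit_seq n :: nat \<Rightarrow> 'k)) \<le> C"
proof -
  have "restr {..<Suc n} (frac_sum (-\<beta>) (unit_seq n :: nat \<Rightarrow> 'k)) = unit_seq n"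
  proof
    fix i
    have "unit_seq n i = (if i = n then 1 else (0::'k))" by (simp add: unit_seq_def)
    then show "restr {..<Suc n} (frac_sum (-\<beta>) (unit_seq n :: nat \<Rightarrow> 'k)) i = unit_seq n i"
      by (auto simp: restr_def frac_sum_unit)
  qed
  then have eq: "frac_sum \<beta> (unit_seq n :: nat \<Rightarrow> 'k) = frac_psum \<beta> (Suc n) (unit_seq n)"
    by (simp add: frac_psum_def)
  show "frac_sum \<beta> (unit_seq n :: nat \<Rightarrow> 'k) \<in> lp p"
    unfolding eq by (rule psum_lp[OF unit_seq_lp(1)[OF p0(1)]])
  show "lp_norm p (frac_sum \<beta> (unit_seq n :: nat \<Rightarrow> 'k)) \<le> C"
    unfolding eq using psum_le[OF unit_seq_lp(1)[OF p0(1)], of "Suc n" n] by (simp add: unit_seq_lp(2)[OF p0(1)])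
qed

end

section \<open>Interleaving two bases\<close>

definition synth :: "(nat \<Rightarrow> nat \<Rightarrow> 'k::real_normed_field) \<Rightarrow> nat \<Rightarrow> (nat \<Rightarrow> 'k) \<Rightarrow> nat \<Rightarrow> 'k" where
  "synth z N s = (\<Sum>n<N. seq_scale (s n) (z n))"

text \<open>The exponents \<open>\<alpha>\<^sub>1\<close> and \<open>\<alpha>\<^sub>2\<close> are the costs of passing, over the first \<open>N\<close> indices,
  from vectors to coefficients in the \<open>lp p\<close> norm and back. By \<open>lower\<close> nothing is lost in their product.\<close>

locale power_conditional_basis =
  fixes p \<alpha>\<^sub>1 \<alpha>\<^sub>2 C \<kappa> :: real and z :: "nat \<Rightarrow> nat \<Rightarrow> 'k::real_normed_field"
    and c :: "(nat \<Rightarrow> 'k) \<Rightarrow> nat \<Rightarrow> 'k"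
  assumes p: "1 < p" and C1: "1 \<le> C" and \<kappa>: "0 < \<kappa>"
    and \<alpha>_nonneg: "0 \<le> \<alpha>\<^sub>1" "0 \<le> \<alpha>\<^sub>2"
    and z_lp: "z n \<in> lp p" and z_norm: "lp_norm p (z n) \<le> C"
    and c_add: "c (f + g) = c f + c g" and c_scale: "c (seq_scale a f) = seq_scale a (c f)"
    and c_z: "c (z n) = unit_seq n"
    and c_le: "g \<in> lp p \<Longrightarrow> norm (c g n) \<le> C * lp_norm p g"
    and c_tendsto: "g \<in> lp p \<Longrightarrow> c g \<longlonglongrightarrow> 0"
    and psum_le: "g \<in> lp p \<Longrightarrow> lp_norm p (synth z N (c g)) \<le> C * lp_norm p g"
    and psum_tendsto: "g \<in> lp p \<Longrightarrow> (\<lambda>N. lp_norm p (g - synth z N (c g))) \<longlonglongrightarrow> 0"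
    and synth_le: "lp_norm p (synth z N s) \<le> C * real N powr \<alpha>\<^sub>2 * lp_norm p (restr {..<N} s)"
    and c_restr_le: "g \<in> lp p \<Longrightarrow> lp_norm p (restr {..<N} (c g)) \<le> C * real N powr \<alpha>\<^sub>1 * lp_norm p g"
    and lower: "1 \<le> L \<Longrightarrow> \<exists>g\<in>lp p. \<exists>A. A \<subseteq> {..<2 * L} \<and> lp_norm p g \<le> 1 \<and>
      \<kappa> * real L powr (\<alpha>\<^sub>1 + \<alpha>\<^sub>2) \<le> lp_norm p (synth z (2 * L) (restr A (c g)))"

definition interleave :: "(nat \<Rightarrow> 'k) \<Rightarrow> (nat \<Rightarrow> 'k) \<Rightarrow> nat \<Rightarrow> 'k" where
  "interleave u v = (\<lambda>i. if even i then u (i div 2) else v (i div 2))"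

definition evens :: "(nat \<Rightarrow> 'k) \<Rightarrow> nat \<Rightarrow> 'k" where "evens g = (\<lambda>i. g (2 * i))"
definition odds :: "(nat \<Rightarrow> 'k) \<Rightarrow> nat \<Rightarrow> 'k" where "odds g = (\<lambda>i. g (2 * i + 1))"

lemma evens_interleave [simp]: "evens (interleave u v) = u"
  and odds_interleave [simp]: "odds (interleave u v) = v"
  and interleave_evens_odds: "interleave (evens g) (odds g) = g"
  by (auto simp: interleave_def evens_def odds_def fun_eq_iff)

lemma evens_lp:
  fixes g :: "nat \<Rightarrow> 'k::real_normed_field"
  assumes "0 < p" "g \<in> lp p"
  shows "evens g \<in> lp p" "lp_norm p (evens g) \<le> lp_norm p g"
  by (rule lp_embed[OF assms, of "\<lambda>i. 2 * i" UNIV], auto simp: evens_def inj_on_def)+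

lemma odds_lp:
  fixes g :: "nat \<Rightarrow> 'k::real_normed_field"
  assumes "0 < p" "g \<in> lp p"
  shows "odds g \<in> lp p" "lp_norm p (odds g) \<le> lp_norm p g"
  by (rule lp_embed[OF assms, of "\<lambda>i. 2 * i + 1" UNIV], auto simp: odds_def inj_on_def)+

lemma interleave_lp:
  fixes u v :: "nat \<Rightarrow> 'k::real_normed_field"
  assumes p: "1 < p" and u: "u \<in> lp p" and v: "v \<in> lp p"
  shows "interleave u v \<in> lp p" "lp_norm p (interleave u v) \<le> lp_norm p u + lp_norm p v"
proof -
  have p0: "0 < p" "1 \<le> p" using p by auto
  have eq: "interleave u v = interleave u 0 + interleave 0 v"
    by (auto simp: interleave_def fun_eq_iff)
  have 1: "interleave u 0 \<in> lp p" "lp_norm p (interleave u 0) \<le> lp_norm p u"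
    by (rule lp_embed[OF p0(1) u, of "\<lambda>i. i div 2" "{i. even i}"], auto simp: interleave_def inj_on_def elim!: evenE)+
  have 2: "interleave 0 v \<in> lp p" "lp_norm p (interleave 0 v) \<le> lp_norm p v"
    by (rule lp_embed[OF p0(1) v, of "\<lambda>i. i div 2" "{i. odd i}"], auto simp: interleave_def inj_on_def elim!: oddE)+
  show "interleave u v \<in> lp p" unfolding eq by (rule lp_add[OF p0(2) 1(1) 2(1)])
  show "lp_norm p (interleave u v) \<le> lp_norm p u + lp_norm p v"
    unfolding eq using lp_add(2)[OF p0(2) 1(1) 2(1)] 1(2) 2(2) by linarith
qed

lemma interleave_add: "interleave (u + u') (v + v') = interleave u v + interleave u' (v' :: nat \<Rightarrow> 'k::real_normed_field)"
  by (auto simp: interleave_def fun_eq_iff)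

lemma interleave_diff: "interleave (u - u') (v - v') = interleave u v - interleave u' (v' :: nat \<Rightarrow> 'k::real_normed_field)"
  by (auto simp: interleave_def fun_eq_iff)

lemma restr_lp:
  fixes s :: "nat \<Rightarrow> 'k::real_normed_field"
  assumes "0 < p" "finite A" shows "restr A s \<in> lp p"
  by (rule lp_norm_finite_support(1)[OF assms]) (auto simp: restr_def)

lemma restr_restr [simp]: "restr A (restr A s) = restr A s"
  by (simp add: restr_def fun_eq_iff)

lemma restr_lessThan_Suc:
  "restr {..<Suc N} s = restr {..<N} s + seq_scale (s N) (unit_seq N :: nat \<Rightarrow> 'k::real_normed_field)"
  by (auto simp: restr_def fun_eq_iff seq_scale_def unit_seq_def less_Suc_eq)

lemma synth_restr: "N \<le> M \<Longrightarrow> synth z N s = synth z M (restr {..<N} s)"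
  unfolding synth_def by (rule sum.mono_neutral_cong_left) (auto simp: restr_def seq_scale_def fun_eq_iff)

section \<open>The sum and difference vectors of two fractional bases\<close>

locale paired_basis =
  X1: frac_basis p \<beta>\<^sub>1 C ty + X2: frac_basis p \<beta>\<^sub>2 C ty
  for p \<beta>\<^sub>1 \<beta>\<^sub>2 C :: real and ty :: "'k::real_normed_field itself" +
  assumes sign: "\<beta>\<^sub>1 \<le> 0" "0 \<le> \<beta>\<^sub>2" and diff1: "\<beta>\<^sub>2 - \<beta>\<^sub>1 \<le> 1"
begin

lemmas p0 = X1.p0

definition z :: "nat \<Rightarrow> nat \<Rightarrow> 'k" where
  "z m = interleave (frac_sum \<beta>\<^sub>1 (unit_seq (m div 2))) (seq_scale (if even m then 1 else -1) (frac_sum \<beta>\<^sub>2 (unit_seq (m div 2))))"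

text \<open>Solves a + b = s, a - b = t for the coefficients on the two kinds of vectors, where s
  and t are the coefficients of the two components in their own bases.\<close>

definition c :: "(nat \<Rightarrow> 'k) \<Rightarrow> nat \<Rightarrow> 'k" where
  "c g = seq_scale (1/2) (interleave (frac_sum (-\<beta>\<^sub>1) (evens g) + frac_sum (-\<beta>\<^sub>2) (odds g))
    (frac_sum (-\<beta>\<^sub>1) (evens g) - frac_sum (-\<beta>\<^sub>2) (odds g)))"

text \<open>Each pair of coefficients acts on the first basis through its sum and on the second
  through its difference, so an even number of vectors reduces to the two component bases.\<close>

lemma synth_even:
  "synth z (2 * \<nu>) s = interleave (frac_sum \<beta>\<^sub>1 (restr {..<\<nu>} (evens s + odds s))) (frac_sum \<beta>\<^sub>2 (restr {..<\<nu>} (evens s - odds s)))"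
proof (induction \<nu>)
  case 0
  show ?case by (auto simp: synth_def restr_def interleave_def fun_eq_iff frac_sum_def)
next
  case (Suc \<nu>)
  let ?X = "frac_sum \<beta>\<^sub>1 (unit_seq \<nu> :: nat \<Rightarrow> 'k)" and ?Y = "frac_sum \<beta>\<^sub>2 (unit_seq \<nu> :: nat \<Rightarrow> 'k)"
  have "synth z (2 * Suc \<nu>) s = synth z (2 * \<nu>) s + (seq_scale (s (2 * \<nu>)) (z (2 * \<nu>)) + seq_scale (s (Suc (2 * \<nu>))) (z (Suc (2 * \<nu>))))"
    by (simp add: synth_def add.assoc)
  also have "seq_scale (s (2 * \<nu>)) (z (2 * \<nu>)) + seq_scale (s (Suc (2 * \<nu>))) (z (Suc (2 * \<nu>))) =
     interleave (seq_scale ((evens s + odds s) \<nu>) ?X) (seq_scale ((evens s - odds s) \<nu>) ?Y)"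
    by (auto simp: z_def interleave_def evens_def odds_def seq_scale_def fun_eq_iff algebra_simps)
  finally show ?case
    unfolding Suc restr_lessThan_Suc frac_sum_add frac_sum_scale interleave_add .
qed

lemma c_sum: "evens (c g) + odds (c g) = frac_sum (-\<beta>\<^sub>1) (evens g)"
  and c_diff: "evens (c g) - odds (c g) = frac_sum (-\<beta>\<^sub>2) (odds g)"
proof -
  have "(evens (c g) + odds (c g)) i = frac_sum (-\<beta>\<^sub>1) (evens g) i \<and> (evens (c g) - odds (c g)) i = frac_sum (-\<beta>\<^sub>2) (odds g) i" for i
    unfolding c_def by (simp add: evens_def odds_def interleave_def seq_scale_def field_simps)
  then show "evens (c g) + odds (c g) = frac_sum (-\<beta>\<^sub>1) (evens g)" "evens (c g) - odds (c g) = frac_sum (-\<beta>\<^sub>2) (odds g)"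
    by blast+
qed

lemma psum_even: "synth z (2 * \<nu>) (c g) = interleave (frac_psum \<beta>\<^sub>1 \<nu> (evens g)) (frac_psum \<beta>\<^sub>2 \<nu> (odds g))"
  unfolding synth_even c_sum c_diff frac_psum_def ..

lemma z_lp: "z n \<in> lp p" and z_norm: "lp_norm p (z n) \<le> 2 * C"
proof -
  let ?Y = "seq_scale (if even n then 1 else -1) (frac_sum \<beta>\<^sub>2 (unit_seq (n div 2) :: nat \<Rightarrow> 'k))"
  have Y: "?Y \<in> lp p" "lp_norm p ?Y \<le> C"
    using lp_norm_scale[OF p0(1) X2.basis_vector(1), of "if even n then 1 else -1" "n div 2"] X2.basis_vector(2)[of "n div 2"]
    by (auto split: if_splits)
  show "z n \<in> lp p" unfolding z_def by (rule interleave_lp(1)[OF X1.p X1.basis_vector(1) Y(1)])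
  show "lp_norm p (z n) \<le> 2 * C"
    unfolding z_def using interleave_lp(2)[OF X1.p X1.basis_vector(1)[of "n div 2"] Y(1)] X1.basis_vector(2)[of "n div 2"] Y(2)
    by linarith
qed

lemma c_app: "c g n = (1/2) * (frac_sum (-\<beta>\<^sub>1) (evens g) (n div 2) + (if even n then 1 else -1) * frac_sum (-\<beta>\<^sub>2) (odds g) (n div 2))"
  by (simp add: c_def interleave_def seq_scale_def)

lemma c_norm_le: "norm (c g n) \<le> norm (frac_sum (-\<beta>\<^sub>1) (evens g) (n div 2)) + norm (frac_sum (-\<beta>\<^sub>2) (odds g) (n div 2))"
proof -
  have "norm (c g n) = 1/2 * norm (frac_sum (-\<beta>\<^sub>1) (evens g) (n div 2) + (if even n then 1 else -1) * frac_sum (-\<beta>\<^sub>2) (odds g) (n div 2))"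
    unfolding c_app by (simp add: norm_mult norm_divide)
  also have "\<dots> \<le> 1 * (norm (frac_sum (-\<beta>\<^sub>1) (evens g) (n div 2)) + norm (frac_sum (-\<beta>\<^sub>2) (odds g) (n div 2)))"
    by (intro mult_mono order_trans[OF norm_triangle_ineq] add_mono) (auto simp: norm_mult)
  finally show ?thesis by simp
qed

lemma c_le:
  assumes g: "g \<in> lp p"
  shows "norm (c g n) \<le> 4 * C * lp_norm p g"
proof -
  have "norm (frac_sum (-\<beta>\<^sub>1) (evens g) (n div 2)) \<le> 2 * C * lp_norm p g"
    using X1.coeff_le[OF evens_lp(1)[OF p0(1) g]] evens_lp(2)[OF p0(1) g] X1.C1 
    by (meson mult_left_mono order_trans zero_le_mult_iff zero_le_numeral zero_le_one)
  moreover have "norm (frac_sum (-\<beta>\<^sub>2) (odds g) (n div 2)) \<le> 2 * C * lp_norm p g"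
    using X2.coeff_le[OF odds_lp(1)[OF p0(1) g]] odds_lp(2)[OF p0(1) g] X1.C1 
    by (meson mult_left_mono order_trans zero_le_mult_iff zero_le_numeral zero_le_one)
  ultimately show ?thesis using c_norm_le[of g n] by linarith
qed

lemma half_at_top: "filterlim (\<lambda>n::nat. n div 2) at_top sequentially"
  by (rule filterlim_at_top_div_const_nat) simp

lemma c_tendsto:
  assumes g: "g \<in> lp p"
  shows "c g \<longlonglongrightarrow> 0"
proof (rule Lim_null_comparison)
  let ?d = "\<lambda>n. norm (frac_sum (-\<beta>\<^sub>1) (evens g) (n div 2)) + norm (frac_sum (-\<beta>\<^sub>2) (odds g) (n div 2))"
  show "\<forall>\<^sub>F n in sequentially. norm (c g n) \<le> ?d n"
    by (intro always_eventually allI c_norm_le)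
  have "?d \<longlonglongrightarrow> norm (0::'k) + norm (0::'k)"
    by (intro tendsto_add tendsto_norm filterlim_compose[OF X1.coeff_tendsto half_at_top] filterlim_compose[OF X2.coeff_tendsto half_at_top]
         evens_lp odds_lp p0 g)
  then show "?d \<longlonglongrightarrow> 0" by simp
qed

text \<open>A cut in the middle of a pair leaves one extra vector, to be handled by the uniform
  bound on the coefficients or by their convergence to 0.\<close>

lemma synth_parity:
  "synth z N s = synth z (2 * (N div 2)) s + (if even N then 0 else seq_scale (s (2 * (N div 2))) (z (2 * (N div 2))))"
  by (cases "even N") (auto simp: synth_def elim!: oddE)

lemma synth_lp: "synth z N s \<in> lp p"
  unfolding synth_def by (intro lp_sum(1) p0 lp_norm_scale(1) z_lp)

lemma psum_le:
  assumes g: "g \<in> lp p"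
  shows "lp_norm p (synth z N (c g)) \<le> 10 * C\<^sup>2 * lp_norm p g"
proof -
  let ?n = "N div 2"
  let ?t = "if even N then 0 else seq_scale (c g (2 * ?n)) (z (2 * ?n))"
  note e = evens_lp[OF p0(1) g] and o = odds_lp[OF p0(1) g]
  have C0: "0 \<le> C" using X1.C1 by simp
  have "lp_norm p (synth z (2 * ?n) (c g)) \<le> lp_norm p (frac_psum \<beta>\<^sub>1 ?n (evens g)) + lp_norm p (frac_psum \<beta>\<^sub>2 ?n (odds g))"
    unfolding psum_even by (rule interleave_lp(2)[OF X1.p X1.psum_lp[OF e(1)] X2.psum_lp[OF o(1)]])
  also have "\<dots> \<le> C * lp_norm p g + C * lp_norm p g"
    by (intro add_mono order_trans[OF X1.psum_le[OF e(1)]] order_trans[OF X2.psum_le[OF o(1)]] mult_left_mono e o C0)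
  finally have 1: "lp_norm p (synth z (2 * ?n) (c g)) \<le> 2 * C * lp_norm p g" by simp
  \<comment> \<open>The unpaired vector costs (4 C)(2 C); with 2 C from the two components this
    makes the factor 10 C^2.\<close>
  have "norm (c g (2 * ?n)) * lp_norm p (z (2 * ?n)) \<le> (4 * C * lp_norm p g) * (2 * C)"
    by (intro mult_mono c_le g z_norm) (use C0 in auto)
  then have 2: "?t \<in> lp p" "lp_norm p ?t \<le> 8 * C\<^sup>2 * lp_norm p g"
    using lp_norm_scale[OF p0(1) z_lp] C0 by (auto simp: power2_eq_square mult_ac intro!: mult_nonneg_nonneg)
  have "C * lp_norm p g \<le> C\<^sup>2 * lp_norm p g"
    using X1.C1 by (intro mult_right_mono) (auto simp: power2_eq_square)
  then show ?thesis
    using lp_add(2)[OF p0(2) synth_lp 2(1), of "2 * ?n" "c g"] 1 2(2)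
    unfolding synth_parity[of N] by linarith
qed

lemma psum_tendsto:
  assumes g: "g \<in> lp p"
  shows "(\<lambda>N. lp_norm p (g - synth z N (c g))) \<longlonglongrightarrow> 0"
proof (rule Lim_null_comparison)
  note e = evens_lp(1)[OF p0(1) g] and o = odds_lp(1)[OF p0(1) g]
  let ?e = "\<lambda>\<nu>. lp_norm p (evens g - frac_psum \<beta>\<^sub>1 \<nu> (evens g))"
  let ?o = "\<lambda>\<nu>. lp_norm p (odds g - frac_psum \<beta>\<^sub>2 \<nu> (odds g))"
  let ?d = "\<lambda>N. ?e (N div 2) + ?o (N div 2) + norm (c g (2 * (N div 2))) * (2 * C)"
  show "\<forall>\<^sub>F N in sequentially. norm (lp_norm p (g - synth z N (c g))) \<le> ?d N"
  proof (intro always_eventually allI)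
    fix N :: nat
    let ?n = "N div 2"
    let ?t = "if even N then 0 else seq_scale (c g (2 * ?n)) (z (2 * ?n))"
    have t: "?t \<in> lp p" "lp_norm p ?t \<le> norm (c g (2 * ?n)) * (2 * C)"
      using lp_norm_scale[OF p0(1) z_lp] X1.C1 by (auto intro!: mult_left_mono z_norm)
    note es = lp_diff(1)[OF p0(2) e X1.psum_lp[OF e, of ?n]] and os = lp_diff(1)[OF p0(2) o X2.psum_lp[OF o, of ?n]]
    let ?i = "interleave (evens g - frac_psum \<beta>\<^sub>1 ?n (evens g)) (odds g - frac_psum \<beta>\<^sub>2 ?n (odds g))"
    have "g - synth z N (c g) = ?i - ?t"
      unfolding synth_parity[of N] psum_even interleave_diff interleave_evens_odds by (simp only: diff_diff_eq)
    then have "lp_norm p (g - synth z N (c g)) \<le> lp_norm p ?i + lp_norm p ?t"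
      by (simp only: lp_diff(2)[OF p0(2) interleave_lp(1)[OF X1.p es os] t(1)])
    then show "norm (lp_norm p (g - synth z N (c g))) \<le> ?d N"
      using interleave_lp(2)[OF X1.p es os] t(2) by simp
  qed
  have h2: "filterlim (\<lambda>N::nat. 2 * (N div 2)) at_top sequentially"
    by (rule filterlim_at_top_mono[OF half_at_top]) auto
  have "?d \<longlonglongrightarrow> 0 + 0 + norm (0::'k) * (2 * C)"
    by (intro tendsto_add tendsto_mult tendsto_const tendsto_norm filterlim_compose[OF X1.psum_tendsto half_at_top] filterlim_compose[OF X2.psum_tendsto half_at_top]
         filterlim_compose[OF c_tendsto h2] e o g)
  then show "?d \<longlonglongrightarrow> 0" by simp
qed

lemma synth_le: "lp_norm p (synth z N s) \<le> 10 * C\<^sup>2 * real N powr \<beta>\<^sub>2 * lp_norm p (restr {..<N} s)"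
proof (cases "N = 0")
  case False
  define s' where "s' = restr {..<N} s"
  have s': "s' \<in> lp p" unfolding s'_def by (rule restr_lp[OF p0(1)]) simp
  have C0: "0 \<le> C" "C \<le> C\<^sup>2" using X1.C1 by (auto simp: power2_eq_square)
  have N1: "1 \<le> real N powr \<beta>\<^sub>2" using False sign by (intro ge_one_powr_ge_zero) auto
  have b2: "\<beta>\<^sub>2 \<le> 1" using X2.\<beta>1 by simp
  note e = evens_lp[OF p0(1) s'] and o = odds_lp[OF p0(1) s']
  have es: "lp_norm p (restr {..<N} (evens s' + odds s')) \<le> 2 * lp_norm p s'"
    using lp_restr(2)[OF p0(1) lp_add(1)[OF p0(2) e(1) o(1)], of "{..<N}"] lp_add(2)[OF p0(2) e(1) o(1)] e(2) o(2) by linarith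
  have ds: "lp_norm p (restr {..<N} (evens s' - odds s')) \<le> 2 * lp_norm p s'"
    using lp_restr(2)[OF p0(1) lp_diff(1)[OF p0(2) e(1) o(1)], of "{..<N}"] lp_diff(2)[OF p0(2) e(1) o(1)] e(2) o(2) by linarith
  have "(\<Sum>k<N. \<bar>bc \<beta>\<^sub>1 k\<bar>) \<le> 2" using X1.\<beta>1 sign by (intro sum_abs_bc_nonpos) auto
  then have s1: "(\<Sum>k<N. \<bar>bc \<beta>\<^sub>1 k\<bar>) \<le> 2 * real N powr \<beta>\<^sub>2" using N1 by linarith
  have "exp \<beta>\<^sub>2 \<le> 3" using b2 by (intro order_trans[OF _ exp_le]) simp
  then have s2: "(\<Sum>k<N. \<bar>bc \<beta>\<^sub>2 k\<bar>) \<le> 3 * real N powr \<beta>\<^sub>2"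
    by (intro order_trans[OF sum_abs_bc_nonneg[OF sign(2)]] mult_right_mono) auto
  \<comment> \<open>Padding the coefficients by zeros up to length \<open>2 * N\<close> avoids the
    parity of \<open>N\<close>.\<close>
  have eq: "synth z N s = synth z (2 * N) s'" unfolding s'_def by (rule synth_restr) simp
  have "lp_norm p (synth z N s) \<le> C * ((\<Sum>k<N. \<bar>bc \<beta>\<^sub>1 k\<bar>) * lp_norm p (restr {..<N} (evens s' + odds s')))
     + C * ((\<Sum>k<N. \<bar>bc \<beta>\<^sub>2 k\<bar>) * lp_norm p (restr {..<N} (evens s' - odds s')))"
    unfolding eq synth_even
    by (rule order_trans[OF interleave_lp(2)[OF X1.p X1.synthesis(1) X2.synthesis(1)] add_mono[OF X1.synthesis(2) X2.synthesis(2)]])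
  also have "\<dots> \<le> C * ((2 * real N powr \<beta>\<^sub>2) * (2 * lp_norm p s')) + C * ((3 * real N powr \<beta>\<^sub>2) * (2 * lp_norm p s'))"
  proof -
    have "(\<Sum>k<N. \<bar>bc \<beta>\<^sub>1 k\<bar>) * lp_norm p (restr {..<N} (evens s' + odds s')) \<le> (2 * real N powr \<beta>\<^sub>2) * (2 * lp_norm p s')"
      by (rule mult_mono[OF s1 es]) simp_all
    moreover have "(\<Sum>k<N. \<bar>bc \<beta>\<^sub>2 k\<bar>) * lp_norm p (restr {..<N} (evens s' - odds s')) \<le> (3 * real N powr \<beta>\<^sub>2) * (2 * lp_norm p s')"
      by (rule mult_mono[OF s2 ds]) simp_all
    ultimately show ?thesis using C0(1) by (simp only: add_mono mult_left_mono)
  qed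
  also have "\<dots> = 10 * C * real N powr \<beta>\<^sub>2 * lp_norm p s'" by simp
  also have "\<dots> \<le> 10 * C\<^sup>2 * real N powr \<beta>\<^sub>2 * lp_norm p s'"
    using C0 by (intro mult_right_mono mult_left_mono) auto
  finally show ?thesis by (simp add: s'_def)
qed (simp add: synth_def)

lemma c_restr_le:
  assumes g: "g \<in> lp p"
  shows "lp_norm p (restr {..<N} (c g)) \<le> 10 * C\<^sup>2 * real N powr (-\<beta>\<^sub>1) * lp_norm p g"
proof (cases "N = 0")
  case True
  then have "restr {..<N} (c g) = 0" by (simp add: restr_def fun_eq_iff)
  then show ?thesis by simp
next
  case False
  define a b where "a = restr {..<N} (frac_sum (-\<beta>\<^sub>1) (evens g))" and "b = restr {..<N} (frac_sum (-\<beta>\<^sub>2) (odds g))"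
  have ab: "a \<in> lp p" "b \<in> lp p" unfolding a_def b_def by (intro restr_lp p0 finite_lessThan)+
  have C0: "1 \<le> C\<^sup>2" using X1.C1 by simp
  have N1: "1 \<le> real N powr (-\<beta>\<^sub>1)" using False sign by (intro ge_one_powr_ge_zero) auto
  note e = evens_lp[OF p0(1) g] and o = odds_lp[OF p0(1) g]
  have "exp (-\<beta>\<^sub>1) \<le> 3" using X1.\<beta>1 by (intro order_trans[OF _ exp_le]) simp
  then have s1: "(\<Sum>k<N. \<bar>bc (-\<beta>\<^sub>1) k\<bar>) \<le> 3 * real N powr (-\<beta>\<^sub>1)"
    using sign by (intro order_trans[OF sum_abs_bc_nonneg] mult_right_mono) auto
  have s2: "(\<Sum>k<N. \<bar>bc (-\<beta>\<^sub>2) k\<bar>) \<le> 2 * real N powr (-\<beta>\<^sub>1)"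
    using X2.\<beta>1 sign N1 by (intro order_trans[OF sum_abs_bc_nonpos]) auto
  have an: "lp_norm p a \<le> 3 * real N powr (-\<beta>\<^sub>1) * lp_norm p g"
    unfolding a_def
    by (rule order_trans[OF truncated_frac_sum_le[OF X1.p] mult_mono[OF s1 order_trans[OF lp_restr(2)[OF p0(1) e(1)] e(2)]]]) simp_all
  have bn: "lp_norm p b \<le> 2 * real N powr (-\<beta>\<^sub>1) * lp_norm p g"
    unfolding b_def
    by (rule order_trans[OF truncated_frac_sum_le[OF X1.p] mult_mono[OF s2 order_trans[OF lp_restr(2)[OF p0(1) o(1)] o(2)]]]) simp_all
  have i: "interleave (a + b) (a - b) \<in> lp p" "lp_norm p (interleave (a + b) (a - b)) \<le> 2 * lp_norm p a + 2 * lp_norm p b"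
    using interleave_lp[OF X1.p lp_add(1)[OF p0(2) ab] lp_diff(1)[OF p0(2) ab]] lp_add(2)[OF p0(2) ab] lp_diff(2)[OF p0(2) ab]
    by auto
  have "norm (restr {..<N} (c g) i) \<le> norm (interleave (a + b) (a - b) i)" for i
    by (auto simp: restr_def c_app interleave_def a_def b_def norm_mult norm_divide)
  then have "lp_norm p (restr {..<N} (c g)) \<le> 2 * lp_norm p a + 2 * lp_norm p b"
    by (rule order_trans[OF lp_mono(2)[OF p0(1) i(1)] i(2)])
  also have "\<dots> \<le> 10 * real N powr (-\<beta>\<^sub>1) * lp_norm p g" using an bn by linarith
  also have "\<dots> \<le> 10 * C\<^sup>2 * real N powr (-\<beta>\<^sub>1) * lp_norm p g"
    using C0 by (intro mult_right_mono) auto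
  finally show ?thesis .
qed

text \<open>The test vector is the normalised indicator of the first \<open>L\<close> entries in the
  first component. Keeping only the even coefficients halves them and copies them to the second
  component, where the two fractional sums compose to order \<alpha>, so that the entry at
  \<open>i\<close> is of order i^\<alpha> L^(-1/p).\<close>

lemma lower:
  assumes L: "1 \<le> L"
  shows "\<exists>g\<in>lp p. \<exists>A. A \<subseteq> {..<2 * L} \<and> lp_norm p g \<le> 1 \<and>
      1/8 * real L powr (-\<beta>\<^sub>1 + \<beta>\<^sub>2) \<le> lp_norm p (synth z (2 * L) (restr A (c g)))"
proof -
  define \<alpha> where "\<alpha> = \<beta>\<^sub>2 - \<beta>\<^sub>1"
  have \<alpha>: "0 \<le> \<alpha>" "\<alpha> \<le> 1" using sign diff1 by (auto simp: \<alpha>_def)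
  define w where "w = of_real (real L powr (-1/p)) * (1::'k)"
  have w: "norm w = real L powr (-1/p)" by (simp add: w_def)
  define u where "u = (restr {..<L} (\<lambda>_. w) :: nat \<Rightarrow> 'k)"
  define g where "g = interleave u 0"
  define A where "A = {n. even n \<and> n < 2 * L}"
  have u: "u \<in> lp p" unfolding u_def by (rule restr_lp[OF p0(1)]) simp
  have un: "lp_norm p u = 1"
  proof -
    have "lp_norm p u = (\<Sum>j<L. norm (u j) powr p) powr (1/p)"
      by (rule lp_norm_finite_support(2)[OF p0(1)]) (auto simp: u_def restr_def)
    moreover have "(real L powr (-1/p)) powr p = inverse (real L)"
    proof -
      have "-1/p * p = -1" using p0 by simp
      then show ?thesis using L by (simp only: powr_powr) (simp add: powr_minus)
    qed
    then have "(\<Sum>j<L. norm (u j) powr p) = (\<Sum>j<L. inverse (real L))"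
      by (intro sum.cong) (auto simp: u_def restr_def w)
    ultimately show ?thesis using L by simp
  qed
  have g: "g \<in> lp p" "lp_norm p g \<le> 1"
    using interleave_lp[OF X1.p u lp_zero(1)] un by (auto simp: g_def)
  define f where "f = synth z (2 * L) (restr A (c g))"
  have f: "f \<in> lp p" unfolding f_def by (rule synth_lp)
  have g_parts: "evens g = u" "odds g = 0" by (simp_all add: g_def)
  have "\<And>i. evens (restr A (c g)) i = restr {..<L} (seq_scale (1/2) (frac_sum (-\<beta>\<^sub>1) u)) i"
    unfolding evens_def[of "restr A (c g)"] by (simp add: restr_def A_def seq_scale_def c_app g_parts frac_sum_def)
  then have ev: "evens (restr A (c g)) = restr {..<L} (seq_scale (1/2) (frac_sum (-\<beta>\<^sub>1) u))" by blast
  have od: "odds (restr A (c g)) = 0"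
    by (auto simp: odds_def restr_def A_def fun_eq_iff)
  have fi: "real L powr (-1/p) * (1/2 * (real i + 1) powr \<alpha>) \<le> norm (f (2 * i + 1))" if i: "i < L" for i
  proof -
    have "f (2 * i + 1) = frac_sum \<beta>\<^sub>2 (restr {..<L} (seq_scale (1/2) (frac_sum (-\<beta>\<^sub>1) u))) i"
      unfolding f_def synth_even ev od by (simp add: interleave_def)
    also have "\<dots> = frac_sum \<beta>\<^sub>2 (seq_scale (1/2) (frac_sum (-\<beta>\<^sub>1) u)) i"
      by (rule frac_sum_cong) (use i in \<open>simp add: restr_def\<close>)
    also have "\<dots> = 1/2 * frac_sum \<alpha> u i"
      unfolding frac_sum_scale frac_sum_frac_sum by (simp add: seq_scale_def \<alpha>_def)
    also have "frac_sum \<alpha> u i = of_real (\<Sum>k\<le>i. bc \<alpha> k) * w"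
      unfolding frac_sum_def u_def restr_def of_real_sum sum_distrib_right
      by (intro sum.cong) (use i in auto)
    finally have "norm (f (2 * i + 1)) = norm (1/2::'k) * (\<bar>\<Sum>k\<le>i. bc \<alpha> k\<bar> * norm w)"
      by (simp only: norm_mult norm_of_real)
    then have "norm (f (2 * i + 1)) = 1/2 * bc (1 + \<alpha>) i * real L powr (-1/p)"
      using \<alpha> by (simp add: norm_divide w sum_bc bc_nonneg)
    then show ?thesis using mult_right_mono[OF bc_lower[OF \<alpha>, of i], of "real L powr (-1/p)"] by (simp add: mult.commute)
  qed
  \<comment> \<open>Only the upper half of the indices is kept: there are at least L/2 of them, and
    each satisfies i + 1 >= L/2. The powers of 1/2 lost here are each at least 1/2 and, with the
    halved coefficients, give the constant 1/8.\<close>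
  define S where "S = (\<lambda>i. 2 * i + 1) ` {L div 2..<L}"
  define t where "t = real L powr (-1/p) * (1/2 * (real L / 2) powr \<alpha>)"
  have t0: "0 \<le> t" by (simp add: t_def)
  have "(real L / 2) * t powr p \<le> real (card {L div 2..<L}) * t powr p"
    by (intro mult_right_mono) auto
  also have "\<dots> = (\<Sum>i\<in>{L div 2..<L}. t powr p)" by simp
  also have "\<dots> \<le> (\<Sum>i\<in>{L div 2..<L}. norm (f (2 * i + 1)) powr p)"
  proof (intro sum_mono powr_mono2)
    fix i assume i: "i \<in> {L div 2..<L}"
    then have "real L / 2 \<le> real i + 1" by auto
    then have "t \<le> real L powr (-1/p) * (1/2 * (real i + 1) powr \<alpha>)"
      unfolding t_def using \<alpha> by (intro mult_left_mono powr_mono2) auto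
    also have "\<dots> \<le> norm (f (2 * i + 1))" using i by (intro fi) auto
    finally show "t \<le> norm (f (2 * i + 1))" .
  qed (use p0 t0 in auto)
  also have "\<dots> = (\<Sum>j\<in>S. norm (f j) powr p)"
    unfolding S_def by (rule sum.reindex_cong[symmetric, where l = "\<lambda>i. 2 * i + 1"]) (auto simp: inj_on_def)
  also have "\<dots> \<le> lp_norm p f powr p"
    by (rule lp_sum_le[OF p0(1) f]) (simp add: S_def)
  finally have "((real L / 2) powr (1/p) * t) powr p \<le> lp_norm p f powr p"
    using p0 t0 L by (simp add: powr_mult powr_powr)
  then have "(real L / 2) powr (1/p) * t \<le> lp_norm p f"
    by (rule le_of_powr_le[OF p0(1) lp_norm_nonneg])
  moreover have "1/8 * real L powr \<alpha> \<le> (real L / 2) powr (1/p) * t"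
  proof -
    have h: "1/2 \<le> (1/2::real) powr x" if "x \<le> 1" "0 \<le> x" for x
      using powr_mono'[of x 1 "1/2::real"] that by simp
    have "1/8 * real L powr \<alpha> = (1/2) * (1/2) * (1/2 * real L powr \<alpha>)" by simp
    also have "\<dots> \<le> (1/2) powr (1/p) * (1/2) powr \<alpha> * (1/2 * real L powr \<alpha>)"
      using \<alpha> p0 by (intro mult_right_mono mult_mono h) auto
    also have "\<dots> = (real L powr (1/p) * real L powr (-1/p)) * ((1/2) powr (1/p) * (1/2) powr \<alpha> * (1/2 * real L powr \<alpha>))"
      using L by (simp flip: powr_add)
    also have "\<dots> = (real L / 2) powr (1/p) * t"
      by (simp add: t_def powr_divide)
    finally show ?thesis .
  qed
  ultimately have "1/8 * real L powr \<alpha> \<le> lp_norm p f" by linarith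
  then show ?thesis
    using g by (intro bexI[of _ g] exI[of _ A]) (auto simp: A_def f_def \<alpha>_def add.commute)
qed

lemma c_z: "c (z m) = unit_seq m"
proof
  fix i
  have u: "frac_sum (-\<beta>) (frac_sum \<beta> (unit_seq n :: nat \<Rightarrow> 'k)) = unit_seq n" for \<beta> n
    by (simp add: frac_sum_frac_sum frac_sum_zero)
  define D E F where "D \<longleftrightarrow> i div 2 = m div 2" and "E \<longleftrightarrow> even i" and "F \<longleftrightarrow> even m"
  have "i = m \<longleftrightarrow> D \<and> (E \<longleftrightarrow> F)" unfolding D_def E_def F_def by presburger
  then have u1: "unit_seq m i = (if D \<and> (E \<longleftrightarrow> F) then 1 else (0::'k))" by (simp only: unit_seq_def)
  have u2: "unit_seq (m div 2) (i div 2) = (if D then 1 else (0::'k))" by (simp only: unit_seq_def D_def)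
  show "c (z m) i = unit_seq m i"
    unfolding c_app z_def evens_interleave odds_interleave frac_sum_scale u
    unfolding seq_scale_def u1 u2 E_def[symmetric] F_def[symmetric]
    by (cases D; cases E; cases F) simp_all
qed

lemma power_conditional: "power_conditional_basis p (-\<beta>\<^sub>1) \<beta>\<^sub>2 (10 * C\<^sup>2) (1/8) z c"
proof (rule power_conditional_basis.intro)
  have C2: "C \<le> C\<^sup>2" "1 \<le> C\<^sup>2" using self_le_power[OF X1.C1, of 2] one_le_power[OF X1.C1, of 2] by auto
  show "1 < p" by (rule X1.p)
  show "1 \<le> 10 * C\<^sup>2" using C2 by simp
  show "lp_norm p (z n) \<le> 10 * C\<^sup>2" for n using z_norm[of n] C2 X1.C1 by linarith
  show "c (f + g) = c f + c g" for f g
  proof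
    fix n
    have eo: "evens (f + g) = evens f + evens g" "odds (f + g) = odds f + odds g"
      by (simp_all add: evens_def odds_def fun_eq_iff)
    show "c (f + g) n = (c f + c g) n"
      unfolding c_app eo frac_sum_add plus_fun_apply by (simp add: algebra_simps)
  qed
  show "c (seq_scale a f) = seq_scale a (c f)" for a f
  proof
    fix n
    have eo: "evens (seq_scale a f) = seq_scale a (evens f)" "odds (seq_scale a f) = seq_scale a (odds f)"
      by (simp_all add: evens_def odds_def fun_eq_iff seq_scale_def)
    have sc: "seq_scale a h n = a * h n" for h :: "nat \<Rightarrow> 'k" and n by (simp add: seq_scale_def)
    show "c (seq_scale a f) n = seq_scale a (c f) n"
      unfolding c_app eo frac_sum_scale sc by (simp add: algebra_simps)
  qed
  show "norm (c g n) \<le> 10 * C\<^sup>2 * lp_norm p g" if "g \<in> lp p" for g n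
  proof -
    have "4 * C * lp_norm p g \<le> 10 * C\<^sup>2 * lp_norm p g"
      using C2 X1.C1 by (intro mult_right_mono) auto
    then show ?thesis using c_le[OF that, of n] by linarith
  qed
  show "0 \<le> -\<beta>\<^sub>1" "0 \<le> \<beta>\<^sub>2" using sign by auto
qed (fact z_lp c_z c_tendsto psum_le psum_tendsto synth_le c_restr_le lower | simp)+

end

section \<open>Dyadic blocks\<close>

lemma geometric_sum_le:
  fixes x :: real
  assumes "0 \<le> x" "x < 1" "finite S"
  shows "(\<Sum>i\<in>S. x ^ i) \<le> 1 / (1 - x)"
proof -
  have "(\<Sum>i\<in>S. x ^ i) \<le> (\<Sum>i. x ^ i)"
    by (rule sum_le_suminf) (use assms in \<open>auto intro: summable_geometric\<close>)
  then show ?thesis using assms by (simp add: suminf_geometric)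
qed

definition geo :: "real \<Rightarrow> real" where "geo \<gamma> = 1 / (1 - 2 powr (-\<gamma>))"

lemma geo_pos: "0 < \<gamma> \<Longrightarrow> 0 < geo \<gamma>"
  by (simp add: geo_def powr_less_one)

lemma geo_tail:
  assumes "0 < \<gamma>"
  shows "(\<Sum>n=l..<N. 2 powr (-\<gamma> * real n)) \<le> geo \<gamma> * 2 powr (-\<gamma> * real l)"
proof -
  let ?x = "2 powr (-\<gamma>) :: real"
  have x: "0 \<le> ?x" "?x < 1" using assms by (auto simp: powr_less_one)
  have "(\<Sum>n=l..<N. 2 powr (-\<gamma> * real n)) = (\<Sum>n=l..<N. 2 powr (-\<gamma> * real l) * ?x ^ (n - l))"
  proof (rule sum.cong)
    fix n assume "n \<in> {l..<N}"
    then have e: "-\<gamma> * real n = -\<gamma> * real l + -\<gamma> * real (n - l)" by (simp add: algebra_simps of_nat_diff)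
    show "2 powr (-\<gamma> * real n) = 2 powr (-\<gamma> * real l) * ?x ^ (n - l)"
      unfolding e powr_add by (simp add: powr_powr flip: powr_realpow)
  qed simp
  also have "\<dots> = 2 powr (-\<gamma> * real l) * (\<Sum>i\<in>(\<lambda>n. n - l) ` {l..<N}. ?x ^ i)"
    unfolding sum_distrib_left[symmetric] by (subst sum.reindex) (auto simp: inj_on_def)
  also have "\<dots> \<le> 2 powr (-\<gamma> * real l) * (1 / (1 - ?x))"
    by (intro mult_left_mono geometric_sum_le x) auto
  finally show ?thesis by (simp add: geo_def)
qed

lemma geo_head:
  assumes "0 < \<gamma>"
  shows "(\<Sum>n<l. 2 powr (\<gamma> * real n)) \<le> geo \<gamma> * 2 powr (\<gamma> * real l)"
proof -
  let ?x = "2 powr (-\<gamma>) :: real"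
  have x: "0 \<le> ?x" "?x < 1" using assms by (auto simp: powr_less_one)
  have "(\<Sum>n<l. 2 powr (\<gamma> * real n)) = (\<Sum>n<l. 2 powr (\<gamma> * real l) * ?x ^ (l - n))"
  proof (rule sum.cong)
    fix n assume "n \<in> {..<l}"
    then have e: "\<gamma> * real n = \<gamma> * real l + -\<gamma> * real (l - n)" by (simp add: algebra_simps of_nat_diff)
    show "2 powr (\<gamma> * real n) = 2 powr (\<gamma> * real l) * ?x ^ (l - n)"
      unfolding e powr_add by (simp add: powr_powr flip: powr_realpow)
  qed simp
  also have "\<dots> = 2 powr (\<gamma> * real l) * (\<Sum>i\<in>(\<lambda>n. l - n) ` {..<l}. ?x ^ i)"
    unfolding sum_distrib_left[symmetric] by (subst sum.reindex) (auto simp: inj_on_def)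
  also have "\<dots> \<le> 2 powr (\<gamma> * real l) * (1 / (1 - ?x))"
    by (intro mult_left_mono geometric_sum_le x) auto
  finally show ?thesis by (simp add: geo_def)
qed

text \<open>The shift by one makes block \<open>n\<close> the interval from 2^n - 1 to 2^(n+1) - 2,
  of size exactly 2^n.\<close>

definition blk :: "nat \<Rightarrow> nat" where "blk j = floor_log (Suc j)"

lemma blk_less_iff: "blk j < l \<longleftrightarrow> Suc j < 2 ^ l"
proof
  assume "blk j < l"
  have "Suc j < 2 ^ Suc (blk j)" unfolding blk_def using floor_log_exp2_gt[of "Suc j"] by simp
  also have "\<dots> \<le> 2 ^ l" using \<open>blk j < l\<close> by (intro power_increasing) auto
  finally show "Suc j < 2 ^ l" .
next
  assume "Suc j < 2 ^ l"
  moreover have "2 ^ blk j \<le> Suc j" unfolding blk_def by (rule floor_log_exp2_le) simp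
  ultimately have "(2::nat) ^ blk j < 2 ^ l" by linarith
  then show "blk j < l" by (rule power_less_imp_less_exp[rotated]) simp
qed

definition low :: "nat \<Rightarrow> nat set" where "low l = {j. blk j < l}"
definition block :: "nat \<Rightarrow> nat set" where "block n = {j. blk j = n}"

lemma low_eq: "low l = {..<2 ^ l - 1}"
  unfolding low_def blk_less_iff by auto

lemma finite_low [simp]: "finite (low l)" and card_low: "card (low l) = 2 ^ l - 1"
  unfolding low_eq by simp_all

lemma block_low: "block n = low (Suc n) - low n" and low_mono: "l \<le> m \<Longrightarrow> low l \<subseteq> low m"
  by (auto simp: block_def low_def)

lemma finite_block [simp]: "finite (block n)"
  by (simp add: block_low)

lemma card_block: "card (block n) = 2 ^ n"
  unfolding block_low by (subst card_Diff_subset) (auto simp: low_mono card_low)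

lemma sum_low: "(\<Sum>j\<in>low l. F j) = (\<Sum>n<l. \<Sum>j\<in>block n. F j)" for F :: "nat \<Rightarrow> real"
proof -
  have "(\<Sum>j\<in>low l. F j) = (\<Sum>n<l. sum F {j \<in> low l. blk j = n})"
    by (rule sum.group[symmetric]) (auto simp: low_def intro: finite_low[of l, unfolded low_def])
  also have "\<dots> = (\<Sum>n<l. \<Sum>j\<in>block n. F j)"
    by (intro sum.cong) (auto simp: low_def block_def)
  finally show ?thesis .
qed

lemma finite_subset_low: "finite A \<Longrightarrow> \<exists>N. A \<subseteq> low N"
proof -
  assume "finite A"
  then obtain k where k: "A \<subseteq> {..<k}" by (meson finite_nat_iff_bounded)
  have "k \<le> 2 ^ k - 1" using less_exp[of k] by linarith
  then have "A \<subseteq> low k" using k by (auto simp: low_eq)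
  then show ?thesis ..
qed

text \<open>The factor is dual to the normalised block indicators, of height 2^(-n/p), used in
  \<open>bspread\<close>: \<open>bavg\<close> becomes a left inverse of \<open>bspread\<close>, and
  both are contractive. So \<open>bspread\<close> after \<open>bavg\<close> averages over each
  block, and \<open>bosc\<close> is the complementary projection onto zero block averages.\<close>

definition bavg :: "real \<Rightarrow> (nat \<Rightarrow> 'k::real_normed_field) \<Rightarrow> nat \<Rightarrow> 'k" where
  "bavg p h n = of_real (2 powr (real n * (1/p - 1))) * (\<Sum>j\<in>block n. h j)"

definition bspread :: "real \<Rightarrow> (nat \<Rightarrow> 'k::real_normed_field) \<Rightarrow> nat \<Rightarrow> 'k" where
  "bspread p g j = of_real (2 powr (- (1/p) * real (blk j))) * g (blk j)"

definition bosc :: "real \<Rightarrow> (nat \<Rightarrow> 'k::real_normed_field) \<Rightarrow> nat \<Rightarrow> 'k" where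
  "bosc p h = h - bspread p (bavg p h)"

lemma bavg_add: "bavg p (f + g) = bavg p f + bavg p g"
  by (simp add: bavg_def fun_eq_iff sum.distrib distrib_left)

lemma bavg_scale: "bavg p (seq_scale a f) = seq_scale a (bavg p f)"
  by (simp add: bavg_def fun_eq_iff seq_scale_def sum_distrib_left mult_ac)

lemma bspread_add: "bspread p (f + g) = bspread p f + bspread p g"
  by (simp add: bspread_def fun_eq_iff distrib_left)

lemma bspread_diff: "bspread p (f - g) = bspread p f - bspread p g"
  by (simp add: bspread_def fun_eq_iff right_diff_distrib)

lemma bspread_scale: "bspread p (seq_scale a f) = seq_scale a (bspread p f)"
  by (simp add: bspread_def fun_eq_iff seq_scale_def mult_ac)

lemma bosc_add: "bosc p (f + g) = bosc p f + bosc p g"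
  by (simp add: bosc_def bavg_add bspread_add fun_eq_iff)

lemma bosc_scale: "bosc p (seq_scale a f) = seq_scale a (bosc p f)"
  by (simp add: bosc_def bavg_scale bspread_scale) (simp add: seq_scale_def fun_eq_iff right_diff_distrib)

lemma bavg_bspread: "bavg p (bspread p g) = g"
proof
  fix n
  have "(\<Sum>j\<in>block n. bspread p g j) = (\<Sum>j\<in>block n. of_real (2 powr (- (1/p) * real n)) * g n)"
    by (intro sum.cong) (auto simp: block_def bspread_def)
  also have "\<dots> = of_real (2 powr real n * 2 powr (- (1/p) * real n)) * g n"
    by (simp add: card_block powr_realpow)
  finally have "bavg p (bspread p g) n = of_real (2 powr (real n * (1/p - 1)) * (2 powr real n * 2 powr (- (1/p) * real n))) * g n"
    by (simp add: bavg_def)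
  also have "2 powr (real n * (1/p - 1)) * (2 powr real n * 2 powr (- (1/p) * real n)) = (1::real)"
    unfolding powr_add[symmetric] by (simp add: algebra_simps)
  finally show "bavg p (bspread p g) n = g n" by simp
qed

lemma bavg_bosc: "bavg p (bosc p h) = 0"
proof -
  have "bosc p h + bspread p (bavg p h) = h" by (simp add: bosc_def)
  then have "bavg p (bosc p h) + bavg p (bspread p (bavg p h)) = bavg p h" by (metis bavg_add)
  then show ?thesis by (simp add: bavg_bspread)
qed

lemma bosc_bspread: "bosc p (bspread p g) = 0"
  by (simp add: bosc_def bavg_bspread)

lemma bosc_bosc: "bosc p (bosc p h) = bosc p h"
  unfolding bosc_def[of p "bosc p h"] bavg_bosc by (simp add: bspread_def fun_eq_iff)

lemma bavg_restr_low: "bavg p (restr (low l) h) = restr {..<l} (bavg p h)"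
proof
  fix n
  have "(\<Sum>j\<in>block n. restr (low l) h j) = (if n < l then \<Sum>j\<in>block n. h j else 0)"
    by (auto simp: restr_def low_def block_def intro!: sum.neutral sum.cong)
  then show "bavg p (restr (low l) h) n = restr {..<l} (bavg p h) n"
    by (simp add: bavg_def restr_def)
qed

text \<open>Since \<open>low l\<close> is a union of whole blocks, truncation to it commutes with
  averaging. This is why partial sums are compared with the sets \<open>low l\<close>.\<close>

lemma bosc_restr_low: "bosc p (restr (low l) h) = restr (low l) (bosc p h)"
  unfolding bosc_def bavg_restr_low by (auto simp: restr_def fun_eq_iff bspread_def low_def)

lemma bavg_zero_outside: "(\<And>j. blk j = n \<Longrightarrow> h j = 0) \<Longrightarrow> bavg p h n = 0"
  by (simp add: bavg_def block_def)

lemma bavg_unit: "bavg p (unit_seq j :: nat \<Rightarrow> 'k::real_normed_field) = seq_scale (of_real (2 powr (real (blk j) * (1/p - 1)))) (unit_seq (blk j))"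
proof
  fix n
  have "(\<Sum>i\<in>block n. unit_seq j i) = (if j \<in> block n then 1 else (0::'k))"
    by (simp add: unit_seq_def)
  then show "bavg p (unit_seq j :: nat \<Rightarrow> 'k) n = seq_scale (of_real (2 powr (real (blk j) * (1/p - 1)))) (unit_seq (blk j)) n"
    unfolding bavg_def by (simp only:) (auto simp: seq_scale_def unit_seq_def block_def)
qed

text \<open>Hoelder on the part of the block that meets \<open>B\<close>. With \<open>B\<close> the
  whole block it yields contractivity of the averages, with \<open>B\<close> a small support a gain
  in long blocks.\<close>

lemma bavg_powr_le:
  fixes h :: "nat \<Rightarrow> 'k::real_normed_field"
  assumes p: "1 < p" and B: "finite B" and supp: "\<And>j. j \<in> block n - B \<Longrightarrow> h j = 0"
  shows "norm (bavg p h n) powr p \<le> (real (card B) / 2 ^ n) powr (p - 1) * (\<Sum>j\<in>block n. norm (h j) powr p)"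
proof -
  let ?S = "block n \<inter> B"
  have S: "finite ?S" using B by simp
  have "norm (\<Sum>j\<in>block n. h j) \<le> (\<Sum>j\<in>block n. norm (h j))" by (rule norm_sum)
  also have "\<dots> = (\<Sum>j\<in>?S. 1 * norm (h j))"
    by simp (rule sum.mono_neutral_right, use supp in auto)
  finally have "norm (\<Sum>j\<in>block n. h j) powr p \<le> (\<Sum>j\<in>?S. 1 * norm (h j)) powr p"
    using p by (intro powr_mono2) auto
  also have "\<dots> \<le> (\<Sum>j\<in>?S. 1) powr (p - 1) * (\<Sum>j\<in>?S. 1 * norm (h j) powr p)"
    by (rule weighted_power_mean[OF S]) (use p in auto)
  also have "\<dots> \<le> real (card B) powr (p - 1) * (\<Sum>j\<in>block n. norm (h j) powr p)"
    using p B S by (intro mult_mono powr_mono2) (auto intro!: sum_mono2 card_mono sum_nonneg)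
  finally have 1: "norm (\<Sum>j\<in>block n. h j) powr p \<le> real (card B) powr (p - 1) * (\<Sum>j\<in>block n. norm (h j) powr p)" .
  have e: "(2 powr (real n * (1/p - 1))) powr p = 1 / (2 ^ n) powr (p - 1)"
  proof -
    have "real n * (1/p - 1) * p = - (real n * (p - 1))" using p by (simp add: field_simps)
    then have "(2 powr (real n * (1/p - 1))) powr p = 2 powr - (real n * (p - 1))" by (simp only: powr_powr)
    then show ?thesis by (simp add: powr_minus_divide powr_powr flip: powr_realpow)
  qed
  have "norm (bavg p h n) powr p = 1 / (2 ^ n) powr (p - 1) * norm (\<Sum>j\<in>block n. h j) powr p"
    unfolding bavg_def norm_mult powr_mult e[symmetric] by simp
  also have "\<dots> \<le> 1 / (2 ^ n) powr (p - 1) * (real (card B) powr (p - 1) * (\<Sum>j\<in>block n. norm (h j) powr p))"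
    by (intro mult_left_mono 1) auto
  finally show ?thesis by (simp add: powr_divide)
qed

lemma bavg_lp:
  fixes h :: "nat \<Rightarrow> 'k::real_normed_field"
  assumes p: "1 < p" and h: "h \<in> lp p"
  shows "bavg p h \<in> lp p" "lp_norm p (bavg p h) \<le> lp_norm p h"
proof -
  have p0: "0 < p" using p by simp
  have "(\<Sum>n<N. norm (bavg p h n) powr p) \<le> lp_norm p h powr p" for N
  proof -
    have "(\<Sum>n<N. norm (bavg p h n) powr p) \<le> (\<Sum>n<N. \<Sum>j\<in>block n. norm (h j) powr p)"
    proof (rule sum_mono)
      fix n show "norm (bavg p h n) powr p \<le> (\<Sum>j\<in>block n. norm (h j) powr p)"
        using bavg_powr_le[OF p, of "block n" n h] by (simp add: card_block)
    qed
    also have "\<dots> = (\<Sum>j\<in>low N. norm (h j) powr p)" by (rule sum_low[symmetric])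
    also have "\<dots> \<le> lp_norm p h powr p" by (rule lp_sum_le[OF p0 h]) simp
    finally show ?thesis .
  qed
  from lpI[OF p0 lp_norm_nonneg this] show "bavg p h \<in> lp p" "lp_norm p (bavg p h) \<le> lp_norm p h" .
qed

text \<open>A vector on few coordinates has small averages in blocks longer than its support; this
  geometric decay in \<open>n\<close> keeps sums over all high blocks bounded.\<close>

lemma bavg_le_support:
  fixes h :: "nat \<Rightarrow> 'k::real_normed_field"
  assumes p: "1 < p" and h: "h \<in> lp p" and B: "finite B" and supp: "\<And>j. j \<notin> B \<Longrightarrow> h j = 0"
  shows "norm (bavg p h n) \<le> (real (card B) / 2 ^ n) powr (1 - 1/p) * lp_norm p h"
proof (rule le_of_powr_le)
  show p0: "0 < p" using p by simp
  have "norm (bavg p h n) powr p \<le> (real (card B) / 2 ^ n) powr (p - 1) * (\<Sum>j\<in>block n. norm (h j) powr p)"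
    by (rule bavg_powr_le[OF p B]) (use supp in auto)
  also have "\<dots> \<le> (real (card B) / 2 ^ n) powr (p - 1) * lp_norm p h powr p"
    by (intro mult_left_mono lp_sum_le p0 h) auto
  also have "\<dots> = ((real (card B) / 2 ^ n) powr (1 - 1/p) * lp_norm p h) powr p"
  proof -
    have "(1 - 1/p) * p = p - 1" using p by (simp add: field_simps)
    then show ?thesis by (simp only: powr_mult powr_powr)
  qed
  finally show "norm (bavg p h n) powr p \<le> ((real (card B) / 2 ^ n) powr (1 - 1/p) * lp_norm p h) powr p" .
qed simp

lemma bspread_lp:
  fixes g :: "nat \<Rightarrow> 'k::real_normed_field"
  assumes p: "1 < p" and g: "g \<in> lp p"
  shows "bspread p g \<in> lp p" "lp_norm p (bspread p g) \<le> lp_norm p g"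
proof -
  have p0: "0 < p" using p by simp
  have "(\<Sum>j<M. norm (bspread p g j) powr p) \<le> lp_norm p g powr p" for M
  proof -
    obtain N where N: "{..<M} \<subseteq> low N" using finite_subset_low[of "{..<M}"] by auto
    have "(\<Sum>j<M. norm (bspread p g j) powr p) \<le> (\<Sum>j\<in>low N. norm (bspread p g j) powr p)"
      by (rule sum_mono2) (use N in auto)
    also have "\<dots> = (\<Sum>n<N. \<Sum>j\<in>block n. norm (bspread p g j) powr p)" by (rule sum_low)
    also have "\<dots> = (\<Sum>n<N. norm (g n) powr p)"
    proof (rule sum.cong)
      fix n
      have "(\<Sum>j\<in>block n. norm (bspread p g j) powr p) = (\<Sum>j\<in>block n. 2 powr (- real n) * norm (g n) powr p)"
        using p by (intro sum.cong) (auto simp: block_def bspread_def norm_mult powr_mult powr_powr)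
      also have "\<dots> = norm (g n) powr p"
        by (simp add: card_block powr_minus powr_realpow)
      finally show "(\<Sum>j\<in>block n. norm (bspread p g j) powr p) = norm (g n) powr p" .
    qed simp
    also have "\<dots> \<le> lp_norm p g powr p" by (rule lp_sum_le[OF p0 g]) simp
    finally show ?thesis .
  qed
  from lpI[OF p0 lp_norm_nonneg this] show "bspread p g \<in> lp p" "lp_norm p (bspread p g) \<le> lp_norm p g" .
qed

text \<open>\<open>bavg\<close> is a contractive left inverse, so lower bounds survive the
  spreading.\<close>

lemma bspread_norm_ge:
  assumes "1 < p" "g \<in> lp p" shows "lp_norm p g \<le> lp_norm p (bspread p g)"
  using bavg_lp(2)[OF assms(1) bspread_lp(1)[OF assms]] by (simp add: bavg_bspread)

lemma bosc_lp:
  fixes h :: "nat \<Rightarrow> 'k::real_normed_field"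
  assumes p: "1 < p" and h: "h \<in> lp p"
  shows "bosc p h \<in> lp p" "lp_norm p (bosc p h) \<le> 2 * lp_norm p h"
proof -
  note P = bavg_lp[OF p h] and J = bspread_lp[OF p bavg_lp(1)[OF p h]]
  show "bosc p h \<in> lp p" unfolding bosc_def by (rule lp_diff(1)) (use p h J in auto)
  show "lp_norm p (bosc p h) \<le> 2 * lp_norm p h"
    unfolding bosc_def using lp_diff(2)[OF _ h J(1)] p J(2) P(2) by linarith
qed

lemma restr_bounded:
  fixes h :: "nat \<Rightarrow> 'k::real_normed_field"
  assumes p: "0 < p" and B: "finite B" and t: "0 \<le> t" "\<And>j. j \<in> B \<Longrightarrow> norm (h j) \<le> t"
  shows "lp_norm p (restr B h) \<le> t * real (card B) powr (1/p)"
proof -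
  have "lp_norm p (restr B h) = (\<Sum>j\<in>B. norm (restr B h j) powr p) powr (1/p)"
    by (rule lp_norm_finite_support(2)[OF p B]) (simp add: restr_def)
  also have "\<dots> \<le> (\<Sum>j\<in>B. t powr p) powr (1/p)"
    using p t by (intro powr_mono2 sum_mono) (auto simp: restr_def sum_nonneg)
  also have "\<dots> = t * real (card B) powr (1/p)"
    using p t by (simp add: powr_mult powr_powr mult.commute)
  finally show ?thesis .
qed

text \<open>Chebyshev's inequality for the counting measure.\<close>

lemma card_powr_le:
  fixes h :: "nat \<Rightarrow> 'k::real_normed_field"
  assumes p: "0 < p" and h: "h \<in> lp p" and B: "finite B" and t: "0 \<le> t" "\<And>j. j \<in> B \<Longrightarrow> t \<le> norm (h j)"
  shows "t * real (card B) powr (1/p) \<le> lp_norm p h"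
proof (rule le_of_powr_le[OF p lp_norm_nonneg])
  have "(t * real (card B) powr (1/p)) powr p = (\<Sum>j\<in>B. t powr p)"
    using p by (simp add: powr_mult powr_powr mult.commute)
  also have "\<dots> \<le> (\<Sum>j\<in>B. norm (h j) powr p)"
    using p t by (intro sum_mono powr_mono2) auto
  also have "\<dots> \<le> lp_norm p h powr p" by (rule lp_sum_le[OF p h B])
  finally show "(t * real (card B) powr (1/p)) powr p \<le> lp_norm p h powr p" .
qed

section \<open>The almost greedy basis\<close>

lemma restr_insert: "j \<notin> A \<Longrightarrow> restr (insert j A) h = restr A h + seq_scale (h j) (unit_seq j :: nat \<Rightarrow> 'k::real_normed_field)"
  by (auto simp: restr_def fun_eq_iff seq_scale_def unit_seq_def)

lemma seq_scale_add: "seq_scale r (f + g) = seq_scale r f + seq_scale r (g :: nat \<Rightarrow> 'k::real_normed_field)"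
  by (simp add: seq_scale_def fun_eq_iff distrib_left)

lemma synth_add: "synth z N (f + g) = synth z N f + synth z N g"
  by (simp add: synth_def fun_eq_iff sum_fun_app seq_scale_def distrib_right sum.distrib)

lemma synth_scale: "synth z N (seq_scale a f) = seq_scale a (synth z N f)"
  by (simp add: synth_def fun_eq_iff sum_fun_app seq_scale_def sum_distrib_left mult_ac)

lemma synth_unit: "n < N \<Longrightarrow> synth z N (unit_seq n) = z n"
proof
  fix i
  assume n: "n < N"
  have "synth z N (unit_seq n) i = (\<Sum>m<N. if m = n then z n i else 0)"
    unfolding synth_def sum_fun_app by (intro sum.cong) (auto simp: seq_scale_def unit_seq_def)
  then show "synth z N (unit_seq n) i = z n i" using n by simp
qed

text \<open>From the least such \<open>l\<close> on, a bounded coefficient spread over a block is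
  small against \<open>t\<close>. Minimality bounds the power from above, with the loss 2^(1/p) <=
  2, except at \<open>l = 0\<close>, where no earlier level can fail.\<close>

lemma threshold_level:
  fixes t M p :: real
  assumes p: "1 \<le> p" and t: "0 < t"
  shows "\<exists>l::nat. M \<le> t * 2 powr ((1/p) * real l) \<and> (l = 0 \<or> t * 2 powr ((1/p) * real l) \<le> 2 * M)"
proof -
  let ?P = "\<lambda>l::nat. M \<le> t * 2 powr ((1/p) * real l)"
  have "1 < 2 powr (1/p)" using p by simp
  then obtain n where "M / t < (2 powr (1/p)) ^ n" using real_arch_pow by blast
  then have ex: "?P n" using t by (simp add: field_simps powr_powr flip: powr_realpow)
  define l where "l = Least ?P"
  have l: "?P l" unfolding l_def by (rule LeastI[of ?P, OF ex])
  have "l = 0 \<or> t * 2 powr ((1/p) * real l) \<le> 2 * M"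
  proof (cases l)
    case (Suc k)
    have "\<not> ?P k" using not_less_Least[of k ?P] Suc by (simp add: l_def)
    moreover have "2 powr ((1/p) * real l) = 2 powr (1/p) * 2 powr ((1/p) * real k)"
      by (simp add: Suc algebra_simps flip: powr_add)
    moreover have "2 powr (1/p) \<le> (2::real)" using powr_mono[of "1/p" 1 "2::real"] p by simp
    ultimately have "t * 2 powr ((1/p) * real l) \<le> t * (2 * 2 powr ((1/p) * real k))" "t * 2 powr ((1/p) * real k) < M"
      using t by (auto intro!: mult_left_mono mult_right_mono)
    then show ?thesis by simp
  qed simp
  then show ?thesis using l by blast
qed

section \<open>The modified system: biorthogonality and convergence of expansions\<close>

context power_conditional_basis
begin

lemma p0: "0 < p" "1 \<le> p" using p by auto

lemma p': "0 < 1/p" "0 < 1 - 1/p" using p by auto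

text \<open>The functionals \<open>a\<close> turn out to be the coordinates of the basis \<open>y\<close>, and \<open>comb N h\<close> is the vector with finitely
  supported coordinates \<open>h\<close>, provided that \<open>N\<close> exceeds every block that \<open>h\<close> meets.\<close>

definition y :: "nat \<Rightarrow> nat \<Rightarrow> 'k" where
  "y j = bosc p (unit_seq j) + seq_scale (of_real (2 powr (real (blk j) * (1/p - 1)))) (bspread p (z (blk j)))"

definition a :: "(nat \<Rightarrow> 'k) \<Rightarrow> nat \<Rightarrow> 'k" where
  "a f = bosc p f + bspread p (c (bavg p f))"

definition comb :: "nat \<Rightarrow> (nat \<Rightarrow> 'k) \<Rightarrow> nat \<Rightarrow> 'k" where
  "comb N h = bosc p h + bspread p (synth z N (bavg p h))"

lemma comb_add: "comb N (f + g) = comb N f + comb N g"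
  by (simp add: comb_def bosc_add bavg_add synth_add bspread_add add.assoc add.left_commute)

lemma comb_scale: "comb N (seq_scale r f) = seq_scale r (comb N f)"
  by (simp add: comb_def bosc_scale bavg_scale synth_scale bspread_scale seq_scale_add)

lemma comb_diff: "comb N (f - g) = comb N f - comb N g"
proof -
  have "comb N (f - g) + comb N g = comb N f" by (simp flip: comb_add)
  then show ?thesis by (simp only: eq_diff_eq)
qed

text \<open>A unit vector is its oscillation plus a multiple of the spread unit vector of its block;
  \<open>comb\<close> keeps the former and puts the vector \<open>z (blk j)\<close> in place of that
  block unit vector.\<close>

lemma comb_unit: "blk j < N \<Longrightarrow> comb N (unit_seq j) = y j"
  by (simp add: comb_def y_def bavg_unit synth_scale synth_unit bspread_scale)

lemma comb_zero: "comb N 0 = 0"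
  using comb_diff[of N 0 0] by simp

text \<open>Turns coordinate projections into the linear operator \<open>comb N\<close> on truncated
  coefficient sequences, the form in which they are estimated.\<close>

lemma sum_y:
  assumes "A \<subseteq> low N"
  shows "(\<Sum>j\<in>A. seq_scale (h j) (y j)) = comb N (restr A h)"
proof -
  have "finite A" using assms finite_low finite_subset by blast
  then show ?thesis using assms
  proof (induction A)
    case empty
    have "restr {} h = 0" by (simp add: restr_def fun_eq_iff)
    then show ?case by (simp only: sum.empty comb_zero)
  next
    case (insert j A)
    then have "blk j < N" by (simp add: low_def)
    then show ?case unfolding sum.insert[OF insert.hyps] restr_insert[OF insert.hyps(2)] comb_add comb_scale comb_unit[OF \<open>blk j < N\<close>]
      using insert by (simp add: add.commute)
  qed
qed

lemma a_add: "a (f + g) = a f + a g"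
  by (simp add: a_def bosc_add bavg_add c_add bspread_add add.assoc add.left_commute)

lemma a_scale: "a (seq_scale r f) = seq_scale r (a f)"
  by (simp add: a_def bosc_scale bavg_scale c_scale bspread_scale seq_scale_add)

lemma a_diff: "a (f - g) = a f - a g"
proof -
  have "a (f - g) + a g = a f" by (simp flip: a_add)
  then show ?thesis by (simp only: eq_diff_eq)
qed

lemma a_zero: "a 0 = 0"
  using a_diff[of 0 0] by simp

text \<open>Oscillation and averages do not interact, and \<open>c\<close> sends \<open>z n\<close>
  back to the unit vector it replaced.\<close>

lemma a_y: "a (y j) = unit_seq j"
proof -
  let ?r = "of_real (2 powr (real (blk j) * (1/p - 1))) :: 'k"
  have 1: "bosc p (y j) = bosc p (unit_seq j)"
    by (simp add: y_def bosc_add bosc_bosc bosc_scale bosc_bspread) (simp add: seq_scale_def fun_eq_iff)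
  have 2: "bavg p (y j) = seq_scale ?r (z (blk j))"
    by (simp add: y_def bavg_add bavg_bosc bavg_scale bavg_bspread)
  have "a (y j) = bosc p (unit_seq j) + bspread p (bavg p (unit_seq j))"
    by (simp add: a_def 1 2 c_scale c_z bavg_unit)
  then show ?thesis by (simp add: bosc_def)
qed

lemma a_sum: "finite A \<Longrightarrow> a (\<Sum>j\<in>A. seq_scale (h j) (y j)) = restr A h"
proof (induction A rule: finite_induct)
  case empty
  have "restr {} h = 0" by (simp add: restr_def fun_eq_iff)
  then show ?case by (simp only: sum.empty a_zero)
next
  case (insert j A)
  show ?case unfolding sum.insert[OF insert.hyps] a_add a_scale a_y insert.IH restr_insert[OF insert.hyps(2)]
    by (simp add: add.commute)
qed

lemma bosc_a: "bosc p (a f) = bosc p f"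
  by (simp add: a_def bosc_add bosc_bosc bosc_bspread)

lemma bavg_a: "bavg p (a f) = c (bavg p f)"
  by (simp add: a_def bavg_add bavg_bosc bavg_bspread)

lemma synth_lp: "synth z N s \<in> lp p"
  unfolding synth_def by (intro lp_sum(1) p0 lp_norm_scale(1) z_lp)

lemma comb_lp: "h \<in> lp p \<Longrightarrow> comb N h \<in> lp p"
  unfolding comb_def by (intro lp_add(1) p0 bosc_lp bspread_lp synth_lp p)

lemma comb_le: "h \<in> lp p \<Longrightarrow> lp_norm p (comb N h) \<le> lp_norm p (bosc p h) + lp_norm p (synth z N (bavg p h))"
  unfolding comb_def
  by (rule order_trans[OF lp_add(2)[OF p0(2) bosc_lp(1)[OF p] bspread_lp(1)[OF p synth_lp]] add_left_mono[OF bspread_lp(2)[OF p synth_lp]]])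

text \<open>The crude triangle bound. Where the averages decay geometrically it suffices, and no
  power of \<open>N\<close> enters.\<close>

lemma synth_sum_le: "lp_norm p (synth z N s) \<le> (\<Sum>n<N. C * norm (s n))"
proof -
  have "lp_norm p (synth z N s) \<le> (\<Sum>n<N. lp_norm p (seq_scale (s n) (z n)))"
    unfolding synth_def by (rule lp_sum(2)[OF p0(2) lp_norm_scale(1)[OF p0(1) z_lp]])
  also have "\<dots> \<le> (\<Sum>n<N. C * norm (s n))"
    unfolding lp_norm_scale(2)[OF p0(1) z_lp] mult.commute[of C] by (intro sum_mono mult_left_mono z_norm) auto
  finally show ?thesis .
qed

lemma y_lp: "y j \<in> lp p"
  unfolding y_def by (intro lp_add(1) p0 bosc_lp bspread_lp lp_norm_scale(1) z_lp p unit_seq_lp)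

lemma y_norm_le: "lp_norm p (y j) \<le> 2 + C"
proof -
  let ?r = "of_real (2 powr (real (blk j) * (1/p - 1))) :: 'k"
  have "real (blk j) * (1/p - 1) \<le> 0" using p' by (intro mult_nonneg_nonpos) auto
  then have r: "norm ?r \<le> 1" using powr_mono[of _ 0 "2::real"] by simp
  have b: "lp_norm p (bspread p (z (blk j))) \<le> C" by (rule order_trans[OF bspread_lp(2)[OF p z_lp] z_norm])
  have "lp_norm p (seq_scale ?r (bspread p (z (blk j)))) = norm ?r * lp_norm p (bspread p (z (blk j)))"
    by (rule lp_norm_scale(2)[OF p0(1) bspread_lp(1)[OF p z_lp]])
  also have "\<dots> \<le> 1 * C" using C1 by (intro mult_mono r b) auto
  finally have 1: "lp_norm p (seq_scale ?r (bspread p (z (blk j)))) \<le> C" by simp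
  have 2: "lp_norm p (bosc p (unit_seq j :: nat \<Rightarrow> 'k)) \<le> 2"
    using bosc_lp(2)[OF p unit_seq_lp(1)[OF p0(1)], of j] by (simp add: unit_seq_lp(2)[OF p0(1)])
  show ?thesis unfolding y_def
    using lp_add(2)[OF p0(2) bosc_lp(1)[OF p unit_seq_lp(1)[OF p0(1)]] lp_norm_scale(1)[OF p0(1) bspread_lp(1)[OF p z_lp]], of j ?r "blk j"] 1 2
    by linarith
qed

text \<open>A uniform bound on the coefficients with respect to \<open>z\<close> is enough, because
  the weight 2^(-n/p) of the spreading supplies the decay in the block number.\<close>

lemma spread_c_le:
  assumes f: "f \<in> lp p"
  shows "norm (bspread p (c (bavg p f)) j) \<le> C * lp_norm p f * 2 powr (- (1/p) * real (blk j))"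
proof -
  have "norm (c (bavg p f) (blk j)) \<le> C * lp_norm p f"
    using c_le[OF bavg_lp(1)[OF p f], of "blk j"] mult_left_mono[OF bavg_lp(2)[OF p f], of C] C1 by linarith
  then show ?thesis by (simp add: bspread_def norm_mult mult.commute mult_right_mono)
qed

lemma a_le:
  assumes f: "f \<in> lp p"
  shows "norm (a f j) \<le> (2 + C) * lp_norm p f"
proof -
  have "norm (bosc p f j) \<le> 2 * lp_norm p f"
    by (rule order_trans[OF lp_coord_le[OF p0(1) bosc_lp(1)[OF p f]] bosc_lp(2)[OF p f]])
  moreover have "norm (bspread p (c (bavg p f)) j) \<le> C * lp_norm p f"
  proof -
    have "C * lp_norm p f * 2 powr (- (1/p) * real (blk j)) \<le> C * lp_norm p f * 1"
      using C1 p0 powr_mono[of "- (1/p) * real (blk j)" 0 "2::real"] by (intro mult_left_mono) auto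
    then show ?thesis using spread_c_le[OF f, of j] by simp
  qed
  ultimately show ?thesis unfolding a_def plus_fun_apply
    by (intro order_trans[OF norm_triangle_ineq]) (simp add: distrib_right)
qed

lemma blk_at_top: "filterlim blk at_top sequentially"
  unfolding filterlim_at_top eventually_sequentially
proof
  fix m
  have "m \<le> blk n" if "2 ^ m \<le> n" for n
    using that blk_less_iff[of n m] by (meson linorder_not_less order_trans le_SucI)
  then show "\<exists>N. \<forall>n\<ge>N. m \<le> blk n" by blast
qed

text \<open>The cut at \<open>N\<close> falls inside block \<open>l = blk N\<close>. The complete
  blocks below give a truncation of the oscillation and a partial sum over \<open>z\<close>; the
  incomplete block costs a tail of the oscillation and the single coefficient
  \<open>c (bavg p f) l\<close>, and both tend to 0.\<close>

lemma expansion_tendsto: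
  assumes f: "f \<in> lp p"
  shows "(\<lambda>N. lp_norm p (f - (\<Sum>n<N. seq_scale (a f n) (y n)))) \<longlonglongrightarrow> 0"
proof (rule Lim_null_comparison)
  let ?q = "bosc p f" and ?g = "bavg p f"
  let ?s = "c (bavg p f)"
  note q = bosc_lp(1)[OF p f] and g = bavg_lp(1)[OF p f]
  let ?d = "\<lambda>l. lp_norm p (restr {l..} ?q)"
  let ?e = "\<lambda>l. lp_norm p (?g - synth z l ?s)"
  let ?b = "\<lambda>N. ?d (blk N) + ?e (blk N) + (2 + C) * (?d (blk N) + norm (?s (blk N)))"
  show "\<forall>\<^sub>F N in sequentially. norm (lp_norm p (f - (\<Sum>n<N. seq_scale (a f n) (y n)))) \<le> ?b N"
  proof (intro always_eventually allI)
    fix N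
    define l where "l = blk N"
    define B where "B = {j. j < N \<and> blk j = l}"
    have lowN: "low l \<subseteq> {..<N}" and Nlow: "{..<N} \<subseteq> low (Suc l)"
      using blk_less_iff[of N l] blk_less_iff[of N "Suc l"] by (auto simp: low_def blk_less_iff l_def)
    have finB: "finite B" by (simp add: B_def)
    have dec: "restr {..<N} (a f) = restr (low l) (a f) + restr B (a f)"
    proof
      fix j
      have "blk j < l \<or> blk j = l" if "j < N" using that Nlow by (auto simp: low_def less_Suc_eq)
      then show "restr {..<N} (a f) j = (restr (low l) (a f) + restr B (a f)) j"
        using lowN by (auto simp: restr_def B_def low_def)
    qed
    have main: "comb (Suc l) (restr (low l) (a f)) = restr (low l) ?q + bspread p (synth z l ?s)"
      unfolding comb_def bosc_restr_low bosc_a bavg_restr_low bavg_a synth_restr[of l "Suc l" z ?s, OF le_SucI[OF order_refl]] ..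
    have small: "lp_norm p (comb (Suc l) (restr B (a f))) \<le> (2 + C) * (?d l + norm (?s l))"
    proof -
      let ?h = "restr B (a f)"
      have h: "?h \<in> lp p" by (rule restr_lp[OF p0(1) finB])
      have tail: "restr {l..} ?q \<in> lp p" by (rule lp_restr(1)[OF p0(1) q])
      have un: "seq_scale (?s l) (unit_seq l) \<in> lp p" "lp_norm p (seq_scale (?s l) (unit_seq l)) = norm (?s l)"
        using lp_norm_scale[OF p0(1) unit_seq_lp(1)[OF p0(1)]] by (simp_all add: unit_seq_lp(2)[OF p0(1)])
      have "lp_norm p ?h \<le> lp_norm p (restr B ?q + restr B (bspread p (seq_scale (?s l) (unit_seq l))))"
      proof -
        have "?h = restr B ?q + restr B (bspread p (seq_scale (?s l) (unit_seq l)))"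
          by (auto simp: restr_def a_def fun_eq_iff B_def bspread_def seq_scale_def unit_seq_def)
        then show ?thesis by simp
      qed
      also have "\<dots> \<le> lp_norm p (restr B ?q) + lp_norm p (restr B (bspread p (seq_scale (?s l) (unit_seq l))))"
        by (rule lp_add(2)[OF p0(2) lp_restr(1)[OF p0(1) q] lp_restr(1)[OF p0(1) bspread_lp(1)[OF p un(1)]]])
      also have "\<dots> \<le> ?d l + norm (?s l)"
      proof (rule add_mono)
        \<comment> \<open>Block \<open>l\<close> starts at 2^l - 1 >= l, so the tail from index
          \<open>l\<close> on is a generous but sufficient bound.\<close>
        have "l \<le> j" if "j \<in> B" for j
        proof -
          have "2 ^ l \<le> Suc j" using that blk_less_iff[of j l] by (simp add: B_def not_less)
          then show ?thesis using less_exp[of l] by linarith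
        qed
        then show "lp_norm p (restr B ?q) \<le> ?d l"
          by (intro lp_mono(2)[OF p0(1) tail]) (auto simp: restr_def)
        show "lp_norm p (restr B (bspread p (seq_scale (?s l) (unit_seq l)))) \<le> norm (?s l)"
          using lp_restr(2)[OF p0(1) bspread_lp(1)[OF p un(1)], of B] bspread_lp(2)[OF p un(1)] un(2) by linarith
      qed
      finally have hn: "lp_norm p ?h \<le> ?d l + norm (?s l)" .
      \<comment> \<open>The incomplete block has at most one nonzero average, so the synthesis
        reduces to one vector.\<close>
      have P: "bavg p ?h n = 0" if "n \<noteq> l" for n
        by (rule bavg_zero_outside) (use that in \<open>auto simp: restr_def B_def\<close>)
      have "lp_norm p (synth z (Suc l) (bavg p ?h)) \<le> (\<Sum>n<Suc l. C * norm (bavg p ?h n))" by (rule synth_sum_le)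
      also have "\<dots> = C * norm (bavg p ?h l)" by (simp add: P)
      also have "\<dots> \<le> C * lp_norm p ?h"
        using C1 lp_coord_le[OF p0(1) bavg_lp(1)[OF p h], of l] bavg_lp(2)[OF p h] by (intro mult_left_mono) auto
      finally have "lp_norm p (comb (Suc l) ?h) \<le> 2 * lp_norm p ?h + C * lp_norm p ?h"
        using comb_le[OF h, of "Suc l"] bosc_lp(2)[OF p h] by linarith
      also have "\<dots> = (2 + C) * lp_norm p ?h" by (simp add: distrib_right)
      also have "\<dots> \<le> (2 + C) * (?d l + norm (?s l))" using C1 by (intro mult_left_mono hn) auto
      finally show ?thesis .
    qed
    have "f = ?q + bspread p ?g" by (simp add: bosc_def)
    then have eq: "f - (\<Sum>n<N. seq_scale (a f n) (y n)) = (restr (- low l) ?q + bspread p (?g - synth z l ?s)) - comb (Suc l) (restr B (a f))"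
      unfolding sum_y[OF Nlow] dec comb_add main bspread_diff
      by (auto simp: fun_eq_iff restr_def)
    have t1: "restr (- low l) ?q \<in> lp p" "lp_norm p (restr (- low l) ?q) \<le> ?d l"
    proof -
      have "l \<le> j" if "j \<notin> low l" for j
      proof -
        have "2 ^ l \<le> Suc j" using that blk_less_iff[of j l] by (simp add: low_def not_less)
        then show ?thesis using less_exp[of l] by linarith
      qed
      then show "lp_norm p (restr (- low l) ?q) \<le> ?d l"
        by (intro lp_mono(2)[OF p0(1) lp_restr(1)[OF p0(1) q]]) (auto simp: restr_def)
      show "restr (- low l) ?q \<in> lp p" by (rule lp_restr(1)[OF p0(1) q])
    qed
    have dl: "?g - synth z l ?s \<in> lp p" by (rule lp_diff(1)[OF p0(2) g synth_lp])
    have "lp_norm p (f - (\<Sum>n<N. seq_scale (a f n) (y n))) \<le> lp_norm p (restr (- low l) ?q + bspread p (?g - synth z l ?s)) + lp_norm p (comb (Suc l) (restr B (a f)))"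
      unfolding eq by (rule lp_diff(2)[OF p0(2) lp_add(1)[OF p0(2) t1(1) bspread_lp(1)[OF p dl]] comb_lp[OF restr_lp[OF p0(1) finB]]])
    also have "lp_norm p (restr (- low l) ?q + bspread p (?g - synth z l ?s)) \<le> ?d l + ?e l"
      using lp_add(2)[OF p0(2) t1(1) bspread_lp(1)[OF p dl]] t1(2) bspread_lp(2)[OF p dl] by linarith
    finally show "norm (lp_norm p (f - (\<Sum>n<N. seq_scale (a f n) (y n)))) \<le> ?b N"
      using small by (simp add: l_def)
  qed
  have d: "(\<lambda>N. ?d (blk N)) \<longlonglongrightarrow> 0"
    by (rule filterlim_compose[OF lp_tail_tendsto[OF p0(1) q] blk_at_top])
  have e: "(\<lambda>N. ?e (blk N)) \<longlonglongrightarrow> 0"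
    by (rule filterlim_compose[OF psum_tendsto[OF g] blk_at_top])
  have s: "(\<lambda>N. norm (?s (blk N))) \<longlonglongrightarrow> 0"
    using tendsto_norm[OF filterlim_compose[OF c_tendsto[OF g] blk_at_top]] by simp
  have "?b \<longlonglongrightarrow> 0 + 0 + (2 + C) * (0 + 0)"
    by (intro tendsto_add tendsto_mult tendsto_const d e s)
  then show "?b \<longlonglongrightarrow> 0" by simp
qed

text \<open>Existence is the convergence just shown. For uniqueness, each coordinate of
  \<open>a\<close> is bounded in norm and the system is biorthogonal, so the coefficients of any
  expansion are forced in the limit.\<close>

lemma expands_iff:
  assumes f: "f \<in> lp p"
  shows "expands seq_scale (lp_norm p) y f b \<longleftrightarrow> b = a f"
proof
  assume "b = a f"
  then show "expands seq_scale (lp_norm p) y f b"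
    using expansion_tendsto[OF f] by (simp add: expands_def)
next
  assume "expands seq_scale (lp_norm p) y f b"
  then have lim: "(\<lambda>N. lp_norm p (f - (\<Sum>n<N. seq_scale (b n) (y n)))) \<longlonglongrightarrow> 0"
    by (simp add: expands_def)
  show "b = a f"
  proof
    fix j
    have le: "norm (a f j - b j) \<le> (2 + C) * lp_norm p (f - (\<Sum>n<N. seq_scale (b n) (y n)))" if "Suc j \<le> N" for N
    proof -
      have S: "(\<Sum>n<N. seq_scale (b n) (y n)) \<in> lp p"
        by (intro lp_sum(1) p0 lp_norm_scale(1) y_lp)
      have "a (f - (\<Sum>n<N. seq_scale (b n) (y n))) j = a f j - b j"
        unfolding a_diff a_sum[OF finite_lessThan] using that by (simp add: restr_def)
      then show ?thesis using a_le[OF lp_diff(1)[OF p0(2) f S], of j] by simp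
    qed
    have "(\<lambda>N. (2 + C) * lp_norm p (f - (\<Sum>n<N. seq_scale (b n) (y n)))) \<longlonglongrightarrow> (2 + C) * 0"
      by (intro tendsto_intros lim)
    then have "norm (a f j - b j) \<le> (2 + C) * 0"
      by (rule tendsto_lowerbound) (use le in \<open>auto intro!: eventually_sequentiallyI[of "Suc j"]\<close>)
    then show "b j = a f j" by simp
  qed
qed

lemma schauder: "schauder_basis seq_scale (lp p) (lp_norm p) y"
  unfolding schauder_basis_def using y_lp expands_iff by auto

lemma coord_eq: "f \<in> lp p \<Longrightarrow> coord seq_scale (lp_norm p) y f = a f"
  unfolding coord_def by (rule the_equality) (simp_all add: expands_iff)

lemma coord_proj_eq: "f \<in> lp p \<Longrightarrow> A \<subseteq> low N \<Longrightarrow> coord_proj seq_scale (lp_norm p) y A f = comb N (restr A (a f))"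
  unfolding coord_proj_def coord_eq by (rule sum_y)

section \<open>Semi-normalization, democracy and greedy projections\<close>

lemma semi_normalized_y: "semi_normalized (lp_norm p) y"
proof -
  have "1 / (2 + C) \<le> lp_norm p (y j)" for j
  proof -
    have "1 \<le> (2 + C) * lp_norm p (y j)"
      using a_le[OF y_lp, of j j] unfolding a_y by (simp add: unit_seq_def)
    then show ?thesis using C1 by (simp add: field_simps)
  qed
  then show ?thesis unfolding semi_normalized_def
    using y_norm_le C1 by (intro conjI exI[of _ "1 / (2 + C)"] exI[of _ "2 + C"]) auto
qed

text \<open>\<open>K0\<close> sums the block averages of a bounded vector and \<open>K1\<close> is
  the resulting upper democracy constant; \<open>Kt\<close> bounds \<open>comb\<close> on sparse
  vectors beyond \<open>low l\<close>; \<open>K2\<close> bounds greedy projections;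
  \<open>K3\<close> is the lower democracy constant.\<close>

definition "K0 = 2 * geo (1/p) + geo (1 - 1/p)"
definition "K1 = 2 + C * K0"
definition "Kt = 2 + C * (2 powr (p - 1) * geo (1 - 1/p))"
definition "K2 = 4 * Kt + (2 + C) + 4 * C * K1"
definition "K3 = 8 * C + 8"

lemma K_nonneg: "0 \<le> K0" "0 \<le> K1" "0 \<le> Kt" "0 \<le> K2" "0 \<le> K3"
  using geo_pos[OF p'(1)] geo_pos[OF p'(2)] C1
  by (auto simp: K0_def K1_def Kt_def K2_def K3_def intro!: add_nonneg_nonneg mult_nonneg_nonneg)

text \<open>The number of summands is at most the block length 2^n, useful for short blocks, and at
  most \<open>card B\<close>, useful for long ones; the two bounds cross at 2^n = card B.\<close>

lemma bavg_bounded: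
  assumes B: "finite B" and t: "0 \<le> t" "\<And>j. j \<in> B \<Longrightarrow> norm (h j) \<le> t"
  shows "norm (bavg p (restr B h) n) \<le> t * 2 powr ((1/p) * real n)"
    and "norm (bavg p (restr B h) n) \<le> t * real (card B) * 2 powr (- (1 - 1/p) * real n)"
proof -
  let ?e = "2 powr (real n * (1/p - 1))"
  have "norm (\<Sum>j\<in>block n. restr B h j) \<le> (\<Sum>j\<in>block n. norm (restr B h j))" by (rule norm_sum)
  also have "\<dots> = (\<Sum>j\<in>block n \<inter> B. norm (restr B h j))"
    by (rule sum.mono_neutral_right) (auto simp: restr_def)
  also have "\<dots> \<le> (\<Sum>j\<in>block n \<inter> B. t)"
    by (rule sum_mono) (use t in \<open>auto simp: restr_def\<close>)
  finally have s: "norm (\<Sum>j\<in>block n. restr B h j) \<le> real (card (block n \<inter> B)) * t" by simp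
  have n: "norm (bavg p (restr B h) n) = ?e * norm (\<Sum>j\<in>block n. restr B h j)"
    by (simp add: bavg_def norm_mult)
  have c: "real (card (block n \<inter> B)) \<le> 2 powr real n" "real (card (block n \<inter> B)) \<le> real (card B)"
    using card_mono[of "block n" "block n \<inter> B"] card_mono[OF B, of "block n \<inter> B"]
    by (auto simp: card_block powr_realpow numeral_power_le_of_nat_cancel_iff of_nat_le_numeral_power_cancel_iff)
  have "norm (bavg p (restr B h) n) \<le> ?e * (2 powr real n * t)"
    unfolding n by (intro mult_left_mono order_trans[OF s] mult_right_mono c t) auto
  also have "\<dots> = t * 2 powr ((1/p) * real n)"
    by (simp add: mult_ac flip: powr_add) (simp add: algebra_simps flip: powr_add)
  finally show "norm (bavg p (restr B h) n) \<le> t * 2 powr ((1/p) * real n)" .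
  have "norm (bavg p (restr B h) n) \<le> ?e * (real (card B) * t)"
    unfolding n by (intro mult_left_mono order_trans[OF s] mult_right_mono c t) auto
  also have "\<dots> = t * real (card B) * 2 powr (- (1 - 1/p) * real n)"
    by (simp add: algebra_simps)
  finally show "norm (bavg p (restr B h) n) \<le> t * real (card B) * 2 powr (- (1 - 1/p) * real n)" .
qed

text \<open>Split at the level \<open>l\<close> with card B <= 2^l <= 2 card B. The increasing bound
  below and the decreasing one above are geometric series dominated by their values at
  \<open>l\<close>, of order t (card B)^(1/p); the factor 2 in \<open>K0\<close> comes from
  2^(1/p).\<close>

lemma sum_bavg_bounded:
  assumes B: "finite B" and t: "0 \<le> t" "\<And>j. j \<in> B \<Longrightarrow> norm (h j) \<le> t"
  shows "(\<Sum>n<N. norm (bavg p (restr B h) n)) \<le> K0 * (t * real (card B) powr (1/p))"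
proof (cases "B = {}")
  case True
  then have "bavg p (restr B h) n = 0" for n by (intro bavg_zero_outside) (simp add: restr_def)
  then show ?thesis using t K_nonneg by simp
next
  case False
  define m where "m = card B"
  define l where "l = Suc (floor_log m)"
  have m: "0 < m" using False B by (simp add: m_def card_gt_0_iff)
  have "m < 2 ^ l" using floor_log_exp2_gt[of m] by (simp add: l_def)
  then have l1: "real m \<le> 2 powr real l"
    by (simp add: powr_realpow flip: of_nat_power_less_of_nat_cancel_iff)
  have "2 ^ floor_log m \<le> m" using m by (rule floor_log_exp2_le)
  then have "2 ^ l \<le> 2 * m" by (simp add: l_def)
  then have "real (2 ^ l) \<le> real (2 * m)" by (rule of_nat_mono)
  then have l2: "2 powr real l \<le> 2 * real m" by (simp add: powr_realpow)
  let ?b = "\<lambda>n. norm (bavg p (restr B h) n)"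
  have 1: "(\<Sum>n<l. ?b n) \<le> 2 * geo (1/p) * (t * real m powr (1/p))"
  proof -
    have "(\<Sum>n<l. ?b n) \<le> (\<Sum>n<l. t * 2 powr ((1/p) * real n))"
      by (intro sum_mono bavg_bounded(1)[OF B t])
    also have "\<dots> \<le> t * (geo (1/p) * 2 powr ((1/p) * real l))"
      unfolding sum_distrib_left[symmetric] by (intro mult_left_mono geo_head p' t)
    also have "2 powr ((1/p) * real l) = (2 powr real l) powr (1/p)" by (simp add: powr_powr mult.commute)
    also have "t * (geo (1/p) * (2 powr real l) powr (1/p)) \<le> t * (geo (1/p) * (2 * real m) powr (1/p))"
      using p' geo_pos[OF p'(1)] by (intro mult_left_mono powr_mono2 l2 t) auto
    also have "(2 * real m) powr (1/p) = 2 powr (1/p) * real m powr (1/p)" by (simp add: powr_mult)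
    also have "t * (geo (1/p) * (2 powr (1/p) * real m powr (1/p))) \<le> t * (geo (1/p) * (2 * real m powr (1/p)))"
      using powr_mono[of "1/p" 1 "2::real"] p geo_pos[OF p'(1)]
      by (intro mult_left_mono mult_right_mono t) auto
    finally show ?thesis by (simp add: mult_ac)
  qed
  have 2: "(\<Sum>n=l..<M. ?b n) \<le> geo (1 - 1/p) * (t * real m powr (1/p))" for M
  proof -
    have "(\<Sum>n=l..<M. ?b n) \<le> (\<Sum>n=l..<M. t * real m * 2 powr (- (1 - 1/p) * real n))"
      unfolding m_def by (intro sum_mono bavg_bounded(2)[OF B t])
    also have "\<dots> \<le> t * real m * (geo (1 - 1/p) * 2 powr (- (1 - 1/p) * real l))"
      unfolding sum_distrib_left[symmetric] by (intro mult_left_mono geo_tail p') (use t in auto)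
    also have "2 powr (- (1 - 1/p) * real l) = (2 powr real l) powr (- (1 - 1/p))" by (simp add: powr_powr mult.commute)
    also have "t * real m * (geo (1 - 1/p) * (2 powr real l) powr (- (1 - 1/p))) \<le> t * real m * (geo (1 - 1/p) * real m powr (- (1 - 1/p)))"
      using p' geo_pos[OF p'(2)] t m by (intro mult_left_mono powr_mono2' l1) auto
    also have "\<dots> = geo (1 - 1/p) * (t * (real m * real m powr (- (1 - 1/p))))" by (simp add: mult_ac)
    also have "real m * real m powr (- (1 - 1/p)) = real m powr (1/p)"
      using powr_mult_base[of "real m" "- (1 - 1/p)"] by simp
    finally show ?thesis .
  qed
  have "(\<Sum>n<N. ?b n) \<le> (\<Sum>n<max N l. ?b n)"
    by (rule sum_mono2) auto
  also have "\<dots> = (\<Sum>n<l. ?b n) + (\<Sum>n=l..<max N l. ?b n)"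
    by (simp add: lessThan_atLeast0 sum.atLeastLessThan_concat)
  also have "\<dots> \<le> 2 * geo (1/p) * (t * real m powr (1/p)) + geo (1 - 1/p) * (t * real m powr (1/p))"
    by (rule add_mono[OF 1 2])
  finally show ?thesis by (simp add: K0_def m_def distrib_right)
qed

text \<open>Upper democracy. The triangle inequality over the blocks suffices because the averages
  already sum to order t (card B)^(1/p), which also bounds the oscillation.\<close>

lemma comb_bounded:
  assumes B: "finite B" and t: "0 \<le> t" "\<And>j. j \<in> B \<Longrightarrow> norm (h j) \<le> t"
  shows "lp_norm p (comb N (restr B h)) \<le> K1 * (t * real (card B) powr (1/p))"
proof -
  have r: "restr B h \<in> lp p" by (rule restr_lp[OF p0(1) B])
  have "lp_norm p (synth z N (bavg p (restr B h))) \<le> C * (\<Sum>n<N. norm (bavg p (restr B h) n))"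
    unfolding sum_distrib_left by (rule synth_sum_le)
  also have "\<dots> \<le> C * (K0 * (t * real (card B) powr (1/p)))"
    using C1 by (intro mult_left_mono sum_bavg_bounded[OF B t]) auto
  finally have "lp_norm p (synth z N (bavg p (restr B h))) \<le> C * (K0 * (t * real (card B) powr (1/p)))" .
  moreover have "lp_norm p (bosc p (restr B h)) \<le> 2 * (t * real (card B) powr (1/p))"
    using bosc_lp(2)[OF p r] restr_bounded[where h = h, OF p0(1) B t] by linarith
  ultimately show ?thesis using comb_le[OF r, of N] by (simp add: K1_def distrib_right)
qed

text \<open>No block below \<open>l\<close> is met, and the blocks above are long compared with the
  support, so the averages decay geometrically from \<open>l\<close> on. The permitted excess 2^p in
  the cardinality, raised to 1 - 1/p, is the 2^(p - 1) in \<open>Kt\<close>.\<close>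

lemma comb_tail:
  assumes h: "h \<in> lp p" and A: "finite A" and supp: "\<And>j. j \<notin> A \<Longrightarrow> h j = 0" and Al: "A \<inter> low l = {}"
    and card: "real (card A) \<le> 2 powr p * 2 powr real l"
  shows "lp_norm p (comb N h) \<le> Kt * lp_norm p h"
proof -
  let ?g = "1 - 1/p"
  let ?b = "\<lambda>n. norm (bavg p h n)"
  have z0: "?b n = 0" if "n < l" for n
  proof -
    have "h j = 0" if "blk j = n" for j
      using supp[of j] Al \<open>n < l\<close> that by (auto simp: low_def)
    then show ?thesis by (simp add: bavg_zero_outside)
  qed
  have le: "?b n \<le> (2 powr (p - 1) * 2 powr (?g * real l)) * lp_norm p h * 2 powr (- ?g * real n)" for n
  proof -
    have "(real (card A) / 2 ^ n) powr ?g \<le> (2 powr p * 2 powr real l / 2 powr real n) powr ?g"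
      using p' card by (intro powr_mono2) (auto simp: powr_realpow divide_right_mono)
    also have "2 powr p * 2 powr real l / 2 powr real n = (2::real) powr (p + real l - real n)"
      by (simp add: powr_add powr_diff)
    also have "\<dots> powr ?g = 2 powr (p * ?g + ?g * real l + - ?g * real n)"
    proof -
      have "(p + real l - real n) * x = p * x + x * real l + - x * real n" for x by (simp add: algebra_simps)
      then show ?thesis unfolding powr_powr by presburger
    qed
    also have "\<dots> = 2 powr (p * ?g) * 2 powr (?g * real l) * 2 powr (- ?g * real n)"
      by (simp only: powr_add)
    also have "p * ?g = p - 1" using p by (simp add: field_simps)
    finally have "(real (card A) / 2 ^ n) powr ?g * lp_norm p h \<le> 2 powr (p - 1) * 2 powr (?g * real l) * 2 powr (- ?g * real n) * lp_norm p h"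
      by (rule mult_right_mono) simp
    then show ?thesis using bavg_le_support[OF p h A supp, of n] by (simp add: mult_ac)
  qed
  have "(\<Sum>n<N. ?b n) \<le> (\<Sum>n<max N l. ?b n)"
    by (rule sum_mono2) auto
  also have "\<dots> = (\<Sum>n<l. ?b n) + (\<Sum>n=l..<max N l. ?b n)"
    by (simp add: lessThan_atLeast0 sum.atLeastLessThan_concat)
  also have "(\<Sum>n<l. ?b n) = 0" by (simp add: z0)
  also have "(\<Sum>n=l..<max N l. ?b n) \<le> (\<Sum>n=l..<max N l. (2 powr (p - 1) * 2 powr (?g * real l)) * lp_norm p h * 2 powr (- ?g * real n))"
    by (intro sum_mono le)
  also have "\<dots> \<le> (2 powr (p - 1) * 2 powr (?g * real l)) * lp_norm p h * (geo ?g * 2 powr (- ?g * real l))"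
    unfolding sum_distrib_left[symmetric] by (intro mult_left_mono geo_tail p') auto
  also have "\<dots> = 2 powr (p - 1) * geo ?g * lp_norm p h * (2 powr (?g * real l) * 2 powr (- ?g * real l))"
    by (simp only: mult_ac)
  also have "2 powr (?g * real l) * 2 powr (- ?g * real l) = (1::real)"
    unfolding powr_add[symmetric] mult_minus_left by simp
  finally have s: "(\<Sum>n<N. ?b n) \<le> 2 powr (p - 1) * geo ?g * lp_norm p h" by simp
  have "lp_norm p (synth z N (bavg p h)) \<le> C * (\<Sum>n<N. ?b n)"
    unfolding sum_distrib_left by (rule synth_sum_le)
  also have "\<dots> \<le> C * (2 powr (p - 1) * geo ?g * lp_norm p h)"
    using C1 by (intro mult_left_mono s) auto
  finally show ?thesis using comb_le[OF h, of N] bosc_lp(2)[OF p h] by (simp add: Kt_def distrib_right)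
qed

text \<open>From level \<open>l\<close> on the spread part is at most t/2, so at least half of every
  coefficient of size \<open>t\<close> or more stems from the oscillation, where Chebyshev counts
  such indices.\<close>

lemma high_part:
  assumes f: "f \<in> lp p" and t: "0 < t" and l: "2 * C * lp_norm p f \<le> t * 2 powr ((1/p) * real l)"
    and D: "finite D" "D \<inter> low l = {}" "\<And>j. j \<in> D \<Longrightarrow> t \<le> norm (a f j)"
  shows "\<And>j. j \<in> D \<Longrightarrow> norm (a f j) \<le> 2 * norm (bosc p f j)"
    and "t * real (card D) powr (1/p) \<le> 4 * lp_norm p f"
    and "real (card D) \<le> 2 powr p * 2 powr real l"
proof -
  have half: "norm (bspread p (c (bavg p f)) j) \<le> t / 2" if "j \<in> D" for j
  proof -
    have bl: "l \<le> blk j" using D(2) that by (auto simp: low_def not_less)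
    have "- (1/p) * real (blk j) \<le> - (1/p) * real l"
      using p' bl by (intro mult_left_mono_neg) auto
    then have "2 powr (- (1/p) * real (blk j)) \<le> 2 powr (- (1/p) * real l)"
      by (rule powr_mono) simp
    then have "C * lp_norm p f * 2 powr (- (1/p) * real (blk j)) \<le> C * lp_norm p f * 2 powr (- (1/p) * real l)"
      using C1 by (intro mult_left_mono) auto
    also have "\<dots> \<le> t / 2"
      using l by (simp add: powr_minus field_simps)
    finally show ?thesis using spread_c_le[OF f, of j] by linarith
  qed
  have q: "norm (a f j) \<le> 2 * norm (bosc p f j)" "t/2 \<le> norm (bosc p f j)" if "j \<in> D" for j
  proof -
    have "norm (a f j) \<le> norm (bosc p f j) + norm (bspread p (c (bavg p f)) j)"
      unfolding a_def plus_fun_apply by (rule norm_triangle_ineq)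
    then show "norm (a f j) \<le> 2 * norm (bosc p f j)" "t/2 \<le> norm (bosc p f j)"
      using half[OF that] D(3)[OF that] by linarith+
  qed
  show "\<And>j. j \<in> D \<Longrightarrow> norm (a f j) \<le> 2 * norm (bosc p f j)" by (rule q(1))
  have "t/2 * real (card D) powr (1/p) \<le> lp_norm p (bosc p f)"
    using t by (intro card_powr_le p0 bosc_lp p f D q) auto
  then show 2: "t * real (card D) powr (1/p) \<le> 4 * lp_norm p f"
    using bosc_lp(2)[OF p f] by simp
  have "4 * lp_norm p f \<le> 2 * (2 * C * lp_norm p f)"
    using C1 mult_right_mono[of 1 C "lp_norm p f"] by simp
  then have "t * real (card D) powr (1/p) \<le> t * (2 * 2 powr ((1/p) * real l))"
    using l 2 by linarith
  then have "real (card D) powr (1/p) \<le> 2 * 2 powr ((1/p) * real l)" using t by simp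
  then have "(real (card D) powr (1/p)) powr p \<le> (2 * 2 powr ((1/p) * real l)) powr p"
    using p by (intro powr_mono2) auto
  then show "real (card D) \<le> 2 powr p * 2 powr real l"
    using p by (simp add: powr_mult powr_powr)
qed

text \<open>Because \<open>low l\<close> consists of whole blocks, the projection is a truncation
  together with a partial sum over \<open>z\<close>, both bounded independently of
  \<open>l\<close>.\<close>

lemma comb_low:
  assumes f: "f \<in> lp p" and l: "l \<le> N"
  shows "lp_norm p (comb N (restr (low l) (a f))) \<le> (2 + C) * lp_norm p f"
proof -
  have q: "bosc p f \<in> lp p" by (rule bosc_lp(1)[OF p f])
  have "comb N (restr (low l) (a f)) = restr (low l) (bosc p f) + bspread p (synth z l (c (bavg p f)))"
    unfolding comb_def bosc_restr_low bosc_a bavg_restr_low bavg_a synth_restr[OF l, of z "c (bavg p f)"] ..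
  then have "lp_norm p (comb N (restr (low l) (a f))) \<le> lp_norm p (restr (low l) (bosc p f)) + lp_norm p (bspread p (synth z l (c (bavg p f))))"
    using lp_add(2)[OF p0(2) lp_restr(1)[OF p0(1) q] bspread_lp(1)[OF p synth_lp]] by simp
  also have "\<dots> \<le> 2 * lp_norm p f + C * lp_norm p f"
  proof (rule add_mono)
    show "lp_norm p (restr (low l) (bosc p f)) \<le> 2 * lp_norm p f"
      using lp_restr(2)[OF p0(1) q, of "low l"] bosc_lp(2)[OF p f] by linarith
    have "C * lp_norm p (bavg p f) \<le> C * lp_norm p f"
      using C1 by (intro mult_left_mono bavg_lp p f) auto
    then show "lp_norm p (bspread p (synth z l (c (bavg p f)))) \<le> C * lp_norm p f"
      using bspread_lp(2)[OF p synth_lp, of l "c (bavg p f)"] psum_le[OF bavg_lp(1)[OF p f], of l] by linarith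
  qed
  finally show ?thesis by (simp add: distrib_right)
qed

text \<open>The value 0 at \<open>l = 0\<close> matters: there \<open>threshold_level\<close> offers
  no upper bound on t 2^(l/p), but the set is empty.\<close>

lemma card_low_powr:
  assumes "B \<subseteq> low l"
  shows "real (card B) powr (1/p) \<le> (if l = 0 then 0 else 2 powr ((1/p) * real l))"
proof (cases "l = 0")
  case True
  then have "B = {}" using assms by (auto simp: low_def)
  then show ?thesis by simp
next
  case False
  have "card B \<le> 2 ^ l" using card_mono[OF finite_low assms] by (simp add: card_low)
  then have "real (card B) \<le> real (2 ^ l)" by (rule of_nat_mono)
  then have "real (card B) powr (1/p) \<le> (2 powr real l) powr (1/p)"
    using p' by (intro powr_mono2) (auto simp: powr_realpow)
  then show ?thesis using False by (simp add: powr_powr mult.commute)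
qed

text \<open>Compare \<open>G\<close> with \<open>low l\<close> at the threshold level: take all of
  \<open>low l\<close> and correct by the indices \<open>B\<close> of \<open>low l\<close> missing
  from \<open>G\<close>. Coefficients on \<open>B\<close> are at most \<open>t\<close>, so
  \<open>comb_bounded\<close> applies with t (card B)^(1/p) <= 4 C ||f||; the indices of
  \<open>G\<close> beyond \<open>low l\<close> are sparse by \<open>high_part\<close>.\<close>

lemma greedy_proj_le:
  assumes f: "f \<in> lp p" and G: "finite G" and t: "0 < t"
    and ge: "\<And>j. j \<in> G \<Longrightarrow> t \<le> norm (a f j)" and le: "\<And>j. j \<notin> G \<Longrightarrow> norm (a f j) \<le> t"
  shows "lp_norm p (coord_proj seq_scale (lp_norm p) y G f) \<le> K2 * lp_norm p f"
proof -
  obtain l where l: "2 * C * lp_norm p f \<le> t * 2 powr ((1/p) * real l)"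
    "l = 0 \<or> t * 2 powr ((1/p) * real l) \<le> 2 * (2 * C * lp_norm p f)"
    using threshold_level[OF p0(2) t] by blast
  obtain N where N: "G \<union> low l \<subseteq> low N" using finite_subset_low[of "G \<union> low l"] G by auto
  define M where "M = max N l"
  have GM: "G \<subseteq> low M" and lM: "l \<le> M" using N low_mono[of N M] by (auto simp: M_def)
  define D where "D = G - low l"
  define B where "B = low l - G"
  have D: "finite D" "D \<inter> low l = {}" "\<And>j. j \<in> D \<Longrightarrow> t \<le> norm (a f j)" using G ge by (auto simp: D_def)
  note high = high_part[OF f t l(1) D]
  have dec: "restr G (a f) = (restr D (a f) + restr (low l) (a f)) - restr B (a f)"
    by (auto simp: restr_def fun_eq_iff D_def B_def)
  have 1: "lp_norm p (comb M (restr D (a f))) \<le> 4 * Kt * lp_norm p f"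
  proof -
    have h: "restr D (a f) \<in> lp p" by (rule restr_lp[OF p0(1) D(1)])
    have q: "bosc p f \<in> lp p" by (rule bosc_lp(1)[OF p f])
    have "lp_norm p (restr D (a f)) \<le> lp_norm p (seq_scale 2 (bosc p f))"
      using high(1) by (intro lp_mono(2)[OF p0(1) lp_norm_scale(1)[OF p0(1) q]]) (auto simp: restr_def seq_scale_def norm_mult)
    also have "\<dots> \<le> 4 * lp_norm p f"
      using lp_norm_scale(2)[OF p0(1) q, of 2] bosc_lp(2)[OF p f] by simp
    finally have n: "lp_norm p (restr D (a f)) \<le> 4 * lp_norm p f" .
    have "lp_norm p (comb M (restr D (a f))) \<le> Kt * lp_norm p (restr D (a f))"
      by (rule comb_tail[OF h D(1) _ D(2) high(3)]) (simp add: restr_def)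
    also have "\<dots> \<le> Kt * (4 * lp_norm p f)" by (intro mult_left_mono n K_nonneg)
    finally show ?thesis by simp
  qed
  have 2: "lp_norm p (comb M (restr B (a f))) \<le> 4 * C * K1 * lp_norm p f"
  proof -
    have "lp_norm p (comb M (restr B (a f))) \<le> K1 * (t * real (card B) powr (1/p))"
      by (rule comb_bounded) (use t le in \<open>auto simp: B_def\<close>)
    moreover have "t * real (card B) powr (1/p) \<le> 4 * C * lp_norm p f"
    proof -
      have "t * real (card B) powr (1/p) \<le> t * (if l = 0 then 0 else 2 powr ((1/p) * real l))"
        using t by (intro mult_left_mono card_low_powr) (auto simp: B_def)
      moreover have "0 \<le> 4 * C * lp_norm p f" using C1 by simp
      ultimately show ?thesis using l(2) by (cases "l = 0") auto
    qed
    then have "K1 * (t * real (card B) powr (1/p)) \<le> K1 * (4 * C * lp_norm p f)"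
      by (rule mult_left_mono) (rule K_nonneg)
    ultimately show ?thesis by (simp add: mult_ac)
  qed
  have lps: "comb M (restr D (a f)) \<in> lp p" "comb M (restr (low l) (a f)) \<in> lp p" "comb M (restr B (a f)) \<in> lp p"
    by (intro comb_lp restr_lp p0 D(1) finite_low; simp add: B_def)+
  have "lp_norm p (comb M (restr G (a f))) \<le> (lp_norm p (comb M (restr D (a f))) + lp_norm p (comb M (restr (low l) (a f)))) + lp_norm p (comb M (restr B (a f)))"
    unfolding dec comb_diff comb_add
    by (rule order_trans[OF lp_diff(2)[OF p0(2) lp_add(1)[OF p0(2) lps(1,2)] lps(3)] add_right_mono[OF lp_add(2)[OF p0(2) lps(1,2)]]])
  also have "\<dots> \<le> (4 * Kt * lp_norm p f + (2 + C) * lp_norm p f) + 4 * C * K1 * lp_norm p f"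
    by (intro add_mono 1 2 comb_low[OF f lM])
  finally show ?thesis unfolding coord_proj_eq[OF f GM] by (simp add: K2_def distrib_right)
qed

text \<open>Indices beyond the threshold level are counted by Chebyshev on the oscillation, those
  inside \<open>low l\<close> by its size. The union of the two parts costs a factor 2, whence
  \<open>K3\<close> = 2 (4 + 4 C).\<close>

lemma lower_democracy:
  assumes f: "f \<in> lp p" and G: "finite G" and t: "0 < t" and ge: "\<And>j. j \<in> G \<Longrightarrow> t \<le> norm (a f j)"
  shows "t * real (card G) powr (1/p) \<le> K3 * lp_norm p f"
proof -
  obtain l where l: "2 * C * lp_norm p f \<le> t * 2 powr ((1/p) * real l)"
    "l = 0 \<or> t * 2 powr ((1/p) * real l) \<le> 2 * (2 * C * lp_norm p f)"
    using threshold_level[OF p0(2) t] by blast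
  define D where "D = G - low l"
  define B where "B = G \<inter> low l"
  have D: "finite D" "D \<inter> low l = {}" "\<And>j. j \<in> D \<Longrightarrow> t \<le> norm (a f j)" using G ge by (auto simp: D_def)
  have d: "t * real (card D) powr (1/p) \<le> 4 * lp_norm p f" by (rule high_part(2)[OF f t l(1) D])
  have b: "t * real (card B) powr (1/p) \<le> 4 * C * lp_norm p f"
  proof -
    have "t * real (card B) powr (1/p) \<le> t * (if l = 0 then 0 else 2 powr ((1/p) * real l))"
      using t by (intro mult_left_mono card_low_powr) (auto simp: B_def)
    moreover have "0 \<le> 4 * C * lp_norm p f" using C1 by simp
    ultimately show ?thesis using l(2) by (cases "l = 0") auto
  qed
  have "card G = card D + card B"
    using G unfolding D_def B_def by (subst card_Un_disjoint[symmetric]) (auto intro: arg_cong[where f = card])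
  then have "real (card G) powr (1/p) \<le> (2 * real (max (card D) (card B))) powr (1/p)"
    using p' by (intro powr_mono2) auto
  also have "\<dots> = 2 powr (1/p) * real (max (card D) (card B)) powr (1/p)" by (simp add: powr_mult)
  also have "\<dots> \<le> 2 * (real (card D) powr (1/p) + real (card B) powr (1/p))"
    using powr_mono[of "1/p" 1 "2::real"] p by (intro mult_mono) (auto simp: max_def)
  finally have "t * real (card G) powr (1/p) \<le> t * (2 * (real (card D) powr (1/p) + real (card B) powr (1/p)))"
    using t by (intro mult_left_mono) auto
  then show ?thesis using d b by (simp add: K3_def algebra_simps)
qed

lemma coord_proj_lp: "coord_proj seq_scale (lp_norm p) y A f \<in> lp p"
  unfolding coord_proj_def by (intro lp_sum(1) p0 lp_norm_scale(1) y_lp)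

lemma a_coord_proj: "f \<in> lp p \<Longrightarrow> finite A \<Longrightarrow> a (coord_proj seq_scale (lp_norm p) y A f) = restr A (a f)"
  unfolding coord_proj_def coord_eq by (rule a_sum)

text \<open>Indices with zero coefficient are dropped so that the smallest coefficient on the set,
  taken as the threshold \<open>t\<close>, is positive.\<close>

lemma greedy_set_proj_le:
  assumes f: "f \<in> lp p" and G: "finite G" and gr: "\<And>n k. n \<in> G \<Longrightarrow> k \<notin> G \<Longrightarrow> norm (a f k) \<le> norm (a f n)"
  shows "lp_norm p (coord_proj seq_scale (lp_norm p) y G f) \<le> K2 * lp_norm p f"
proof -
  define G' where "G' = {j\<in>G. a f j \<noteq> 0}"
  have eq: "coord_proj seq_scale (lp_norm p) y G f = coord_proj seq_scale (lp_norm p) y G' f"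
    unfolding coord_proj_def coord_eq[OF f]
    by (rule sum.mono_neutral_right) (use G in \<open>auto simp: G'_def seq_scale_def fun_eq_iff\<close>)
  have finG': "finite G'" using G by (simp add: G'_def)
  show ?thesis
  proof (cases "G' = {}")
    case True
    then show ?thesis unfolding eq using K_nonneg by (simp add: coord_proj_def)
  next
    case False
    define t where "t = Min ((\<lambda>j. norm (a f j)) ` G')"
    have "t \<in> (\<lambda>j. norm (a f j)) ` G'" unfolding t_def using finG' False by (intro Min_in) auto
    then obtain j0 where j0: "j0 \<in> G'" "t = norm (a f j0)" by auto
    have t0: "0 < t" using j0 by (simp add: G'_def)
    have ge: "t \<le> norm (a f j)" if "j \<in> G'" for j unfolding t_def using finG' that by simp
    have le: "norm (a f k) \<le> t" if "k \<notin> G'" for k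
    proof (cases "k \<in> G")
      case True
      then show ?thesis using that t0 by (simp add: G'_def)
    next
      case False
      then show ?thesis using gr[of j0 k] j0 by (simp add: G'_def)
    qed
    show ?thesis unfolding eq by (rule greedy_proj_le[OF f finG' t0 ge le])
  qed
qed

text \<open>Quasi-greedy and democratic imply almost greedy. With h = f - S_A f, the set D = G - A
  is greedy for h, and f - S_G f = h - S_D h + S_B f for B = A - G. On B the coefficients of f are
  at most the smallest one on D, and card B <= card D, so upper democracy on B against lower
  democracy on D gives \<open>K1 * K3\<close>.\<close>

lemma almost_greedy: "almost_greedy_basis seq_scale (lp p) (lp_norm p) y"
proof -
  let ?S = "coord_proj seq_scale (lp_norm p) y"
  have main: "lp_norm p (f - ?S G f) \<le> (1 + K2 + K1 * K3) * lp_norm p (f - ?S A f)"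
    if f: "f \<in> lp p" and gr: "greedy_set seq_scale (lp_norm p) y f G" and A: "finite A" "card A \<le> card G" for f G and A :: "nat set"
  proof -
    have G: "finite G" "\<And>n k. n \<in> G \<Longrightarrow> k \<notin> G \<Longrightarrow> norm (a f k) \<le> norm (a f n)"
      using gr by (auto simp: greedy_set_def coord_eq[OF f])
    define h where "h = f - ?S A f"
    have h: "h \<in> lp p" unfolding h_def by (rule lp_diff(1)[OF p0(2) f coord_proj_lp])
    have ah: "a h = a f - restr A (a f)" unfolding h_def a_diff a_coord_proj[OF f A(1)] ..
    have ahD: "a h j = (if j \<in> A then 0 else a f j)" for j by (simp add: ah restr_def)
    define D where "D = G - A"
    define B where "B = A - G"
    have fin: "finite D" "finite B" using G(1) A(1) by (auto simp: D_def B_def)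
    have SD: "?S D f = ?S D h"
      unfolding coord_proj_def coord_eq[OF f] coord_eq[OF h] by (intro sum.cong) (auto simp: ahD D_def)
    have dec: "f - ?S G f = (h - ?S D h) + ?S B f"
    proof -
      have "?S G f = ?S D f + ?S (A \<inter> G) f" "?S A f = ?S B f + ?S (A \<inter> G) f"
        unfolding coord_proj_def D_def B_def using G(1) A(1)
        by (subst sum.union_disjoint[symmetric]; auto intro: sum.cong)+
      then show ?thesis unfolding h_def SD[symmetric, unfolded h_def] by (simp add: algebra_simps)
    qed
    have D_le: "lp_norm p (?S D h) \<le> K2 * lp_norm p h"
      by (rule greedy_set_proj_le[OF h fin(1)]) (use G(2) in \<open>auto simp: ahD D_def\<close>)
    have "card G = card D + card (A \<inter> G)" "card A = card B + card (A \<inter> G)"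
      unfolding D_def B_def using G(1) A(1)
      by (subst card_Un_disjoint[symmetric]; auto intro: arg_cong[where f = card])+
    then have BD: "card B \<le> card D" using A(2) by simp
    have B_le: "lp_norm p (?S B f) \<le> K1 * K3 * lp_norm p h"
    proof (cases "D = {}")
      case True
      then have "B = {}" using BD fin by simp
      then show ?thesis using K_nonneg by (simp add: coord_proj_def)
    next
      case False
      define t where "t = Min ((\<lambda>j. norm (a f j)) ` D)"
      have "t \<in> (\<lambda>j. norm (a f j)) ` D" unfolding t_def using fin False by (intro Min_in) auto
      then obtain j0 where j0: "j0 \<in> D" "t = norm (a f j0)" by auto
      have ge: "t \<le> norm (a h j)" if "j \<in> D" for j unfolding t_def using fin that by (auto simp: ahD D_def)
      have le: "norm (a f k) \<le> t" if "k \<in> B" for k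
        using that G(2)[of j0 k] j0 by (auto simp: D_def B_def)
      have t0: "0 \<le> t" by (simp add: j0)
      obtain N where N: "B \<subseteq> low N" using finite_subset_low[OF fin(2)] by auto
      have "lp_norm p (?S B f) \<le> K1 * (t * real (card B) powr (1/p))"
        unfolding coord_proj_eq[OF f N] by (rule comb_bounded[OF fin(2) t0 le])
      also have "\<dots> \<le> K1 * (K3 * lp_norm p h)"
      proof (intro mult_left_mono K_nonneg)
        show "t * real (card B) powr (1/p) \<le> K3 * lp_norm p h"
        proof (cases "t = 0")
          case False
          have "t * real (card B) powr (1/p) \<le> t * real (card D) powr (1/p)"
            using BD t0 p' by (intro mult_left_mono powr_mono2) auto
          also have "\<dots> \<le> K3 * lp_norm p h"
            using False t0 by (intro lower_democracy[OF h fin(1) _ ge]) auto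
          finally show ?thesis .
        qed (use K_nonneg in simp)
      qed
      finally show ?thesis by simp
    qed
    have "lp_norm p (f - ?S G f) \<le> (lp_norm p h + lp_norm p (?S D h)) + lp_norm p (?S B f)"
      unfolding dec
      by (rule order_trans[OF lp_add(2)[OF p0(2) lp_diff(1)[OF p0(2) h coord_proj_lp] coord_proj_lp] add_right_mono[OF lp_diff(2)[OF p0(2) h coord_proj_lp]]])
    also have "\<dots> \<le> (lp_norm p h + K2 * lp_norm p h) + K1 * K3 * lp_norm p h"
      by (intro add_mono D_le B_le order_refl)
    finally show ?thesis by (simp add: h_def distrib_right)
  qed
  then show ?thesis
    unfolding almost_greedy_basis_def using schauder semi_normalized_y by blast
qed

section \<open>Growth of the conditionality constants\<close>

lemma proj_le:
  assumes f: "f \<in> lp p" and A: "finite A" and m: "card A < 2 ^ L" and L: "1 \<le> L"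
  shows "lp_norm p (coord_proj seq_scale (lp_norm p) y A f) \<le> ((2 + C)\<^sup>2 + Kt * (2 + C)) * real L powr (\<alpha>\<^sub>1 + \<alpha>\<^sub>2) * lp_norm p f"
proof -
  \<comment> \<open>Below the cut lie \<open>L\<close> blocks, where analysis and synthesis cost
    powers of \<open>L\<close> with the exponents \<open>\<alpha>\<^sub>1\<close> and
    \<open>\<alpha>\<^sub>2\<close>; above it the set is sparse, having fewer than 2^L
    elements.\<close>
  define H where "H = A - low L"
  define B where "B = A \<inter> low L"
  have fin: "finite H" "finite B" using A by (auto simp: H_def B_def)
  obtain N where "A \<subseteq> low N" using finite_subset_low[OF A] by auto
  define M where "M = max N L"
  have AM: "A \<subseteq> low M" and LM: "L \<le> M" using \<open>A \<subseteq> low N\<close> low_mono[of N M] by (auto simp: M_def)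
  have dec: "restr A (a f) = restr B (a f) + restr H (a f)"
    by (auto simp: restr_def fun_eq_iff H_def B_def)
  have Lp: "1 \<le> real L powr x" if "0 \<le> x" for x using L that by (intro ge_one_powr_ge_zero) auto
  note q = bosc_lp[OF p f]
  have B: "lp_norm p (comb M (restr B (a f))) \<le> (2 + C)\<^sup>2 * real L powr (\<alpha>\<^sub>1 + \<alpha>\<^sub>2) * lp_norm p f"
  proof -
    let ?h = "restr B (a f)"
    have h: "?h \<in> lp p" by (rule restr_lp[OF p0(1) fin(2)])
    have s: "restr {..<L} (c (bavg p f)) \<in> lp p" by (rule restr_lp[OF p0(1)]) simp
    have sn: "lp_norm p (restr {..<L} (c (bavg p f))) \<le> C * real L powr \<alpha>\<^sub>1 * lp_norm p f"
      using C1 by (intro order_trans[OF c_restr_le[OF bavg_lp(1)[OF p f]]] mult_left_mono bavg_lp p f) auto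
    have u: "restr (low L) (bosc p f) + bspread p (restr {..<L} (c (bavg p f))) \<in> lp p"
      by (rule lp_add(1)[OF p0(2) lp_restr(1)[OF p0(1) q(1)] bspread_lp(1)[OF p s]])
    have "lp_norm p ?h \<le> lp_norm p (restr (low L) (bosc p f) + bspread p (restr {..<L} (c (bavg p f))))"
      by (rule lp_mono(2)[OF p0(1) u]) (auto simp: restr_def B_def a_def bspread_def low_def)
    also have "\<dots> \<le> lp_norm p (restr (low L) (bosc p f)) + lp_norm p (bspread p (restr {..<L} (c (bavg p f))))"
      by (rule lp_add(2)[OF p0(2) lp_restr(1)[OF p0(1) q(1)] bspread_lp(1)[OF p s]])
    also have "\<dots> \<le> 2 * lp_norm p f + C * real L powr \<alpha>\<^sub>1 * lp_norm p f"
      using lp_restr(2)[OF p0(1) q(1), of "low L"] q(2) bspread_lp(2)[OF p s] sn by linarith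
    also have "\<dots> \<le> (2 + C) * real L powr \<alpha>\<^sub>1 * lp_norm p f"
      using mult_right_mono[OF Lp[OF \<alpha>_nonneg(1)], of "2 * lp_norm p f"] by (simp add: algebra_simps)
    finally have hn: "lp_norm p ?h \<le> (2 + C) * real L powr \<alpha>\<^sub>1 * lp_norm p f" .
    have sup: "restr {..<L} (bavg p ?h) = bavg p ?h"
    proof -
      have "restr (low L) ?h = ?h" by (auto simp: restr_def B_def fun_eq_iff)
      then show ?thesis using bavg_restr_low[of p L ?h] by simp
    qed
    \<comment> \<open>The averages vanish from block \<open>L\<close> on, so the synthesis cost is
      counted with \<open>L\<close> instead of \<open>M\<close>.\<close>
    have "synth z M (bavg p ?h) = synth z L (bavg p ?h)"
      using synth_restr[OF LM, of z "bavg p ?h"] sup by simp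
    then have "lp_norm p (synth z M (bavg p ?h)) \<le> C * real L powr \<alpha>\<^sub>2 * lp_norm p (bavg p ?h)"
      using synth_le[of L "bavg p ?h"] sup by simp
    also have "\<dots> \<le> C * real L powr \<alpha>\<^sub>2 * lp_norm p ?h"
      using C1 by (intro mult_left_mono bavg_lp p h) auto
    finally have "lp_norm p (comb M ?h) \<le> 2 * lp_norm p ?h + C * real L powr \<alpha>\<^sub>2 * lp_norm p ?h"
      using comb_le[OF h, of M] bosc_lp(2)[OF p h] by linarith
    also have "\<dots> \<le> (2 + C) * real L powr \<alpha>\<^sub>2 * lp_norm p ?h"
      using mult_right_mono[OF Lp[OF \<alpha>_nonneg(2)], of "2 * lp_norm p ?h"] by (simp add: algebra_simps)
    also have "\<dots> \<le> (2 + C) * real L powr \<alpha>\<^sub>2 * ((2 + C) * real L powr \<alpha>\<^sub>1 * lp_norm p f)"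
      using C1 by (intro mult_left_mono hn) auto
    also have "\<dots> = (2 + C)\<^sup>2 * real L powr (\<alpha>\<^sub>1 + \<alpha>\<^sub>2) * lp_norm p f"
      by (simp add: power2_eq_square powr_add mult_ac)
    finally show ?thesis .
  qed
  have H: "lp_norm p (comb M (restr H (a f))) \<le> Kt * (2 + C) * real L powr (\<alpha>\<^sub>1 + \<alpha>\<^sub>2) * lp_norm p f"
  proof -
    let ?h = "restr H (a f)" and ?j = "bspread p (c (bavg p f))"
    have h: "?h \<in> lp p" by (rule restr_lp[OF p0(1) fin(1)])
    have cH: "real (card H) \<le> 2 powr real L"
    proof -
      have "card H \<le> 2 ^ L" using card_mono[OF A, of H] m by (auto simp: H_def)
      then have "real (card H) \<le> real (2 ^ L)" by (rule of_nat_mono)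
      then show ?thesis by (simp add: powr_realpow)
    qed
    \<comment> \<open>Each coordinate of the spread part on \<open>H\<close> is at most C ||f||
      2^(-L/p), and at most 2^L coordinates are involved, so the powers of 2 cancel.\<close>
    have "lp_norm p (restr H ?j) \<le> (C * lp_norm p f * 2 powr (- (1/p) * real L)) * real (card H) powr (1/p)"
    proof (rule restr_bounded[OF p0(1) fin(1)])
      fix j assume "j \<in> H"
      then have "L \<le> blk j" by (auto simp: H_def low_def not_less)
      then have "- (1/p) * real (blk j) \<le> - (1/p) * real L" using p' by (intro mult_left_mono_neg) auto
      then have "2 powr (- (1/p) * real (blk j)) \<le> 2 powr (- (1/p) * real L)" by (rule powr_mono) simp
      then show "norm (?j j) \<le> C * lp_norm p f * 2 powr (- (1/p) * real L)"
        using C1 by (intro order_trans[OF spread_c_le[OF f]] mult_left_mono) auto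
    qed (use C1 in auto)
    also have "\<dots> \<le> (C * lp_norm p f * 2 powr (- (1/p) * real L)) * (2 powr real L) powr (1/p)"
      using C1 p' by (intro mult_left_mono powr_mono2 cH) auto
    also have "\<dots> = C * lp_norm p f * (2 powr (- (1/p) * real L) * 2 powr ((1/p) * real L))"
      by (simp add: powr_powr mult.commute)
    also have "2 powr (- (1/p) * real L) * 2 powr ((1/p) * real L) = (1::real)"
      unfolding powr_add[symmetric] by simp
    finally have j: "lp_norm p (restr H ?j) \<le> C * lp_norm p f" by simp
    have "?h = restr H (bosc p f) + restr H ?j" by (auto simp: restr_def a_def fun_eq_iff)
    then have "lp_norm p ?h \<le> lp_norm p (restr H (bosc p f)) + lp_norm p (restr H ?j)"
      using lp_add(2)[OF p0(2) lp_restr(1)[OF p0(1) q(1)] restr_lp[OF p0(1) fin(1)], of H ?j] by simp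
    also have "\<dots> \<le> (2 + C) * lp_norm p f"
      using lp_restr(2)[OF p0(1) q(1), of H] q(2) j by (simp add: distrib_right)
    finally have hn: "lp_norm p ?h \<le> (2 + C) * lp_norm p f" .
    have "1 \<le> 2 powr p" using p by (intro ge_one_powr_ge_zero) auto
    then have "2 powr real L \<le> 2 powr p * 2 powr real L" by simp
    then have "real (card H) \<le> 2 powr p * 2 powr real L" using cH by linarith
    then have "lp_norm p (comb M ?h) \<le> Kt * lp_norm p ?h"
      by (intro comb_tail[OF h fin(1), of L]) (simp_all add: restr_def, auto simp: H_def)
    also have "\<dots> \<le> Kt * ((2 + C) * lp_norm p f)" by (intro mult_left_mono hn K_nonneg)
    also have "\<dots> \<le> real L powr (\<alpha>\<^sub>1 + \<alpha>\<^sub>2) * (Kt * ((2 + C) * lp_norm p f))"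
      using mult_right_mono[OF Lp[of "\<alpha>\<^sub>1 + \<alpha>\<^sub>2"], of "Kt * ((2 + C) * lp_norm p f)"] \<alpha>_nonneg K_nonneg C1 by simp
    finally show ?thesis by (simp add: mult_ac)
  qed
  have "lp_norm p (comb M (restr A (a f))) \<le> lp_norm p (comb M (restr B (a f))) + lp_norm p (comb M (restr H (a f)))"
    unfolding dec comb_add by (intro lp_add(2) p0 comb_lp restr_lp fin)
  also have "\<dots> \<le> (2 + C)\<^sup>2 * real L powr (\<alpha>\<^sub>1 + \<alpha>\<^sub>2) * lp_norm p f + Kt * (2 + C) * real L powr (\<alpha>\<^sub>1 + \<alpha>\<^sub>2) * lp_norm p f"
    by (rule add_mono[OF B H])
  finally show ?thesis unfolding coord_proj_eq[OF f AM] by (simp add: distrib_right)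
qed

lemma conditionality_upper:
  assumes m: "2 \<le> m"
  shows "conditionality_const seq_scale (lp p) (lp_norm p) y m
    \<le> ennreal (((2 + C)\<^sup>2 + Kt * (2 + C)) * 3 powr (\<alpha>\<^sub>1 + \<alpha>\<^sub>2) * ln (real m) powr (\<alpha>\<^sub>1 + \<alpha>\<^sub>2))"
proof -
  let ?K = "(2 + C)\<^sup>2 + Kt * (2 + C)"
  \<comment> \<open>Then m < 2^L <= 2 m, and ln 2 >= 2/3 converts the base: L <= 3 ln m.\<close>
  define L where "L = Suc (floor_log m)"
  have mL: "m < 2 ^ L" using floor_log_exp2_gt[of m] by (simp add: L_def)
  have "2 ^ floor_log m \<le> m" using m by (intro floor_log_exp2_le) simp
  then have "real (2 ^ floor_log m) \<le> real m" by (rule of_nat_mono)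
  then have "ln (2 ^ floor_log m) \<le> ln (real m)" using m by (subst ln_le_cancel_iff) auto
  then have 1: "real (floor_log m) * ln 2 \<le> ln (real m)" by (simp add: ln_realpow)
  have 2: "ln 2 \<le> ln (real m)" using m by (subst ln_le_cancel_iff) auto
  have ln2: "2/3 \<le> ln (2::real)" using ln2_ge_two_thirds by simp
  have "real L * (2/3) \<le> real L * ln 2" using ln2 by (intro mult_left_mono) auto
  also have "\<dots> \<le> 2 * ln (real m)" using 1 2 by (simp add: L_def distrib_right)
  finally have "real L \<le> 3 * ln (real m)" by simp
  then have "real L powr (\<alpha>\<^sub>1 + \<alpha>\<^sub>2) \<le> (3 * ln (real m)) powr (\<alpha>\<^sub>1 + \<alpha>\<^sub>2)"
    using \<alpha>_nonneg by (intro powr_mono2) auto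
  then have LK: "?K * real L powr (\<alpha>\<^sub>1 + \<alpha>\<^sub>2) \<le> ?K * (3 powr (\<alpha>\<^sub>1 + \<alpha>\<^sub>2) * ln (real m) powr (\<alpha>\<^sub>1 + \<alpha>\<^sub>2))"
    using K_nonneg C1 by (intro mult_left_mono) (auto simp: powr_mult)
  show ?thesis
    unfolding conditionality_const_def op_norm_def
  proof (intro SUP_least ennreal_leI)
    fix A :: "nat set" and f :: "nat \<Rightarrow> 'k" assume A: "A \<in> {A. finite A \<and> card A \<le> m}" and f: "f \<in> {f \<in> lp p. lp_norm p f \<le> 1}"
    have "lp_norm p (coord_proj seq_scale (lp_norm p) y A f) \<le> ?K * real L powr (\<alpha>\<^sub>1 + \<alpha>\<^sub>2) * lp_norm p f"
      by (rule proj_le) (use A f mL in \<open>auto simp: L_def\<close>)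
    also have "\<dots> \<le> ?K * real L powr (\<alpha>\<^sub>1 + \<alpha>\<^sub>2) * 1"
      using f K_nonneg C1 by (intro mult_left_mono) auto
    finally show "lp_norm p (coord_proj seq_scale (lp_norm p) y A f) \<le> ?K * 3 powr (\<alpha>\<^sub>1 + \<alpha>\<^sub>2) * ln (real m) powr (\<alpha>\<^sub>1 + \<alpha>\<^sub>2)"
      using LK by (simp add: mult.assoc)
  qed
qed

lemma conditionality_ge:
  assumes "f \<in> lp p" "lp_norm p f \<le> 1" "finite A" "card A \<le> m" "r \<le> lp_norm p (coord_proj seq_scale (lp_norm p) y A f)"
  shows "ennreal r \<le> conditionality_const seq_scale (lp p) (lp_norm p) y m"
  unfolding conditionality_const_def op_norm_def
  by (rule SUP_upper2[where i = A], use assms in simp, rule SUP_upper2[where i = f]) (use assms in \<open>auto intro: ennreal_leI\<close>)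

text \<open>Spreading a vector turns its coefficients with respect to \<open>z\<close> into
  block-constant coefficients with respect to \<open>y\<close>, so projecting onto whole blocks
  reproduces a projection in terms of \<open>z\<close>. The first 2 L blocks hold fewer than 2^(2 L)
  indices, which is why \<open>L\<close> is half of the logarithm.\<close>

lemma conditionality_lower:
  assumes m: "2 \<le> m"
  shows "ennreal (min \<kappa> 1 / 4 powr (\<alpha>\<^sub>1 + \<alpha>\<^sub>2) * ln (real m) powr (\<alpha>\<^sub>1 + \<alpha>\<^sub>2)) \<le> conditionality_const seq_scale (lp p) (lp_norm p) y m"
proof -
  let ?\<alpha> = "\<alpha>\<^sub>1 + \<alpha>\<^sub>2"
  have \<alpha>0: "0 \<le> ?\<alpha>" using \<alpha>_nonneg by simp
  have ln0: "0 \<le> ln (real m)" using m by simp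
  show ?thesis
  proof (cases "4 \<le> m")
    case True
    define L where "L = floor_log m div 2"
    have fl: "2 * L \<le> floor_log m" "floor_log m \<le> 2 * L + 1" by (auto simp: L_def)
    have "floor_log 4 \<le> floor_log m" using True by (rule floor_log_le_iff)
    moreover have "floor_log 4 = 2" using floor_log_power[of 2] by simp
    ultimately have L1: "1 \<le> L" using fl by linarith
    have mL: "2 ^ (2 * L) \<le> m"
      using power_increasing[OF fl(1), of "2::nat"] floor_log_exp2_le[of m] m by linarith
    \<comment> \<open>Here \<open>L >= 1\<close> absorbs the rounding: floor_log m + 1 <= 2 L + 2 <=
      4 L, whence ln m <= 4 L.\<close>
    have "m < 2 ^ Suc (floor_log m)" using floor_log_exp2_gt[of m] by simp
    also have "\<dots> \<le> 2 ^ (4 * L)" using fl L1 by (intro power_increasing) auto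
    finally have "real m \<le> real (2 ^ (4 * L))" by (intro of_nat_mono) simp
    then have "ln (real m) \<le> ln (2 ^ (4 * L))" using m by (subst ln_le_cancel_iff) auto
    also have "\<dots> = 4 * real L * ln 2" by (simp add: ln_realpow)
    also have "\<dots> \<le> 4 * real L * 1" using ln_le_minus_one[of "2::real"] by (intro mult_left_mono) auto
    finally have "ln (real m) powr ?\<alpha> \<le> (4 * real L) powr ?\<alpha>" using \<alpha>0 ln0 by (intro powr_mono2) auto
    then have le: "ln (real m) powr ?\<alpha> \<le> 4 powr ?\<alpha> * real L powr ?\<alpha>" by (simp add: powr_mult)
    obtain g A where g: "g \<in> lp p" "A \<subseteq> {..<2 * L}" "lp_norm p g \<le> 1"
      "\<kappa> * real L powr ?\<alpha> \<le> lp_norm p (synth z (2 * L) (restr A (c g)))"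
      using lower[OF L1] by blast
    define A' where "A' = {j. blk j \<in> A}"
    have A': "A' \<subseteq> low (2 * L)" using g(2) by (auto simp: A'_def low_def)
    have cardA': "card A' \<le> m"
      using card_mono[OF finite_low A'] mL by (simp add: card_low)
    define f where "f = bspread p g"
    have f: "f \<in> lp p" "lp_norm p f \<le> 1" using bspread_lp[OF p g(1)] g(3) by (auto simp: f_def)
    have af: "a f = bspread p (c g)" by (simp add: a_def f_def bosc_bspread bavg_bspread)
    have "restr A' (a f) = bspread p (restr A (c g))"
      by (auto simp: af restr_def A'_def bspread_def fun_eq_iff)
    then have S: "coord_proj seq_scale (lp_norm p) y A' f = bspread p (synth z (2 * L) (restr A (c g)))"
      unfolding coord_proj_eq[OF f(1) A'] by (simp add: comb_def bosc_bspread bavg_bspread)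
    have "min \<kappa> 1 / 4 powr ?\<alpha> * ln (real m) powr ?\<alpha> \<le> \<kappa> / 4 powr ?\<alpha> * (4 powr ?\<alpha> * real L powr ?\<alpha>)"
      using \<kappa> by (intro mult_mono le divide_right_mono) auto
    also have "\<dots> = \<kappa> * real L powr ?\<alpha>" by simp
    also have "\<dots> \<le> lp_norm p (coord_proj seq_scale (lp_norm p) y A' f)"
      unfolding S using g(4) bspread_norm_ge[OF p synth_lp, of "2 * L" "restr A (c g)"] by linarith
    finally show ?thesis
      using f A' cardA' by (intro conditionality_ge) (auto intro: finite_subset)
  next
    case False
    \<comment> \<open>For \<open>m < 4\<close> a projection that fixes a unit vector is enough,
      since ln m <= 4; the \<open>min\<close> with 1 provides for this case.\<close>
    define r where "r = lp_norm p (y 0)"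
    have "1 \<le> (2 + C) * r"
      using a_le[OF y_lp, of 0 0] unfolding a_y by (simp add: unit_seq_def r_def)
    then have "r \<noteq> 0" by auto
    moreover have "0 \<le> r" by (simp add: r_def)
    ultimately have r0: "0 < r" by simp
    define f where "f = seq_scale (of_real (1/r)) (y 0)"
    have f: "f \<in> lp p" "lp_norm p f = 1"
      using lp_norm_scale[OF p0(1) y_lp, of "of_real (1/r)" 0] r0 by (simp_all add: f_def norm_divide flip: r_def)
    have "a f = seq_scale (of_real (1/r)) (unit_seq 0)" by (simp only: f_def a_scale a_y)
    then have "coord_proj seq_scale (lp_norm p) y {0} f = f"
      unfolding coord_proj_def coord_eq[OF f(1)] by (simp add: seq_scale_def unit_seq_def f_def)
    moreover have "min \<kappa> 1 / 4 powr ?\<alpha> * ln (real m) powr ?\<alpha> \<le> 1"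
    proof -
      have "ln (real m) \<le> 4" using ln_le_minus_one[of "real m"] m False by linarith
      then have "ln (real m) powr ?\<alpha> \<le> 4 powr ?\<alpha>" using \<alpha>0 ln0 by (intro powr_mono2) auto
      then have "min \<kappa> 1 / 4 powr ?\<alpha> * ln (real m) powr ?\<alpha> \<le> 1 / 4 powr ?\<alpha> * 4 powr ?\<alpha>"
        using \<kappa> by (intro mult_mono divide_right_mono) auto
      then show ?thesis by simp
    qed
    ultimately show ?thesis using f m by (intro conditionality_ge[of f "{0}"]) auto
  qed
qed

end

section \<open>Choice of the exponents\<close>

lemma exists_power_conditional_basis:
  assumes p: "1 < p" and \<alpha>: "0 \<le> \<alpha>" "\<alpha> < 1"
  shows "\<exists>C z c. power_conditional_basis p (\<alpha>/p) (\<alpha> * (1 - 1/p)) C (1/8) (z :: nat \<Rightarrow> nat \<Rightarrow> 'k::real_normed_field) c"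
proof -
  define q where "q = 1/p"
  have q: "0 < q" "q < 1" using p by (auto simp: q_def)
  \<comment> \<open>Here \<alpha> < 1 enters: both exponents stay strictly inside the interval of
    bounded partial sums.\<close>
  have aq: "\<alpha> * q < q" "\<alpha> * (1 - q) < 1 - q" "0 \<le> \<alpha> * q" "0 \<le> \<alpha> * (1 - q)" using \<alpha> q by auto
  have b1: "-1/p < - (\<alpha> * q)" "- (\<alpha> * q) < 1 - 1/p" and b2: "-1/p < \<alpha> * (1 - q)" "\<alpha> * (1 - q) < 1 - 1/p"
    using aq q unfolding minus_divide_left[symmetric] q_def[symmetric] by linarith+
  obtain C1 where C1: "1 \<le> C1"
    "\<And>N (g :: nat \<Rightarrow> 'k). g \<in> lp p \<Longrightarrow> frac_psum (- (\<alpha> * q)) N g \<in> lp p"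
    "\<And>N (g :: nat \<Rightarrow> 'k). g \<in> lp p \<Longrightarrow> lp_norm p (frac_psum (- (\<alpha> * q)) N g) \<le> C1 * lp_norm p g"
    by (rule frac_psum_bounded[OF p b1]) (rule that)
  obtain C2 where C2: "1 \<le> C2"
    "\<And>N (g :: nat \<Rightarrow> 'k). g \<in> lp p \<Longrightarrow> frac_psum (\<alpha> * (1 - q)) N g \<in> lp p"
    "\<And>N (g :: nat \<Rightarrow> 'k). g \<in> lp p \<Longrightarrow> lp_norm p (frac_psum (\<alpha> * (1 - q)) N g) \<le> C2 * lp_norm p g"
    by (rule frac_psum_bounded[OF p b2]) (rule that)
  define C where "C = max C1 C2"
  have CC: "1 \<le> C" "C1 * lp_norm p g \<le> C * lp_norm p g" "C2 * lp_norm p g \<le> C * lp_norm p g" for g :: "nat \<Rightarrow> 'k"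
    using C1(1) by (auto simp: C_def intro!: mult_right_mono)
  interpret paired_basis p "- (\<alpha> * q)" "\<alpha> * (1 - q)" C "TYPE('k)"
  proof
    show "\<alpha> * (1 - q) - - (\<alpha> * q) \<le> 1" using \<alpha> by (simp add: algebra_simps)
    show "lp_norm p (frac_psum (- (\<alpha> * q)) N g) \<le> C * lp_norm p g" if "g \<in> lp p" for N and g :: "nat \<Rightarrow> 'k"
      by (rule order_trans[OF C1(3)[OF that] CC(2)])
    show "lp_norm p (frac_psum (\<alpha> * (1 - q)) N g) \<le> C * lp_norm p g" if "g \<in> lp p" for N and g :: "nat \<Rightarrow> 'k"
      by (rule order_trans[OF C2(3)[OF that] CC(3)])
  qed (use p b1 b2 aq CC(1) C1(2) C2(2) in auto)
  from power_conditional show ?thesis unfolding q_def[symmetric] by (auto simp: q_def)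
qed

text \<open>Carried out over an arbitrary real normed field, so that real and complex scalars are
  instances of one statement.\<close>

lemma exists_almost_greedy_basis:
  assumes p: "1 < p" and \<alpha>: "0 \<le> \<alpha>" "\<alpha> < 1"
  shows "\<exists>Y :: nat \<Rightarrow> nat \<Rightarrow> 'k::real_normed_field.
        almost_greedy_basis seq_scale (lp p) (lp_norm p) Y \<and>
        (\<exists>c C :: real. 0 < c \<and> c \<le> C \<and>
          (\<forall>m::nat. m \<ge> 2 \<longrightarrow>
             ennreal (c * ln (real m) powr \<alpha>)
               \<le> conditionality_const seq_scale (lp p) (lp_norm p) Y m \<and>
             conditionality_const seq_scale (lp p) (lp_norm p) Y m
               \<le> ennreal (C * ln (real m) powr \<alpha>)))"
proof -
  obtain C and z :: "nat \<Rightarrow> nat \<Rightarrow> 'k" and c where "power_conditional_basis p (\<alpha>/p) (\<alpha> * (1 - 1/p)) C (1/8) z c"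
    using exists_power_conditional_basis[OF assms] by blast
  then interpret power_conditional_basis p "\<alpha>/p" "\<alpha> * (1 - 1/p)" C "1/8" z c .
  have e: "\<alpha>/p + \<alpha> * (1 - 1/p) = \<alpha>" using p by (simp add: field_simps)
  define c' where "c' = min (1/8) 1 / 4 powr \<alpha>"
  define C' where "C' = max c' (((2 + C)\<^sup>2 + Kt * (2 + C)) * 3 powr \<alpha>)"
  have up: "conditionality_const seq_scale (lp p) (lp_norm p) y m \<le> ennreal (C' * ln (real m) powr \<alpha>)" if "2 \<le> m" for m
    using conditionality_upper[OF that] unfolding e C'_def
    by (rule order_trans) (intro ennreal_leI mult_right_mono, auto)
  have lo: "ennreal (c' * ln (real m) powr \<alpha>) \<le> conditionality_const seq_scale (lp p) (lp_norm p) y m" if "2 \<le> m" for m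
    using conditionality_lower[OF that] unfolding e c'_def .
  have "0 < c'" "c' \<le> C'" by (auto simp: c'_def C'_def)
  then show ?thesis using almost_greedy up lo by blast
qed

theorem theorem1p5:
  fixes p \<alpha> :: real
  assumes "1 < p" and "\<bar>1 / 2 - 1 / p\<bar> \<le> \<alpha>" and "\<alpha> < 1"
  shows
    "(\<exists>Y :: nat \<Rightarrow> nat \<Rightarrow> real.
        almost_greedy_basis seq_scale (lp p) (lp_norm p) Y \<and>
        (\<exists>c C :: real. 0 < c \<and> c \<le> C \<and>
          (\<forall>m::nat. m \<ge> 2 \<longrightarrow>
             ennreal (c * ln (real m) powr \<alpha>)
               \<le> conditionality_const seq_scale (lp p) (lp_norm p) Y m \<and>
             conditionality_const seq_scale (lp p) (lp_norm p) Y m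
               \<le> ennreal (C * ln (real m) powr \<alpha>)))) \<and>
     (\<exists>Y :: nat \<Rightarrow> nat \<Rightarrow> complex.
        almost_greedy_basis seq_scale (lp p) (lp_norm p) Y \<and>
        (\<exists>c C :: real. 0 < c \<and> c \<le> C \<and>
          (\<forall>m::nat. m \<ge> 2 \<longrightarrow>
             ennreal (c * ln (real m) powr \<alpha>)
               \<le> conditionality_const seq_scale (lp p) (lp_norm p) Y m \<and>
             conditionality_const seq_scale (lp p) (lp_norm p) Y m
               \<le> ennreal (C * ln (real m) powr \<alpha>))))"
proof -
  have "0 \<le> \<alpha>" using assms(2) by linarith
  then show ?thesis using assms by (intro conjI exists_almost_greedy_basis)
qed

end
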